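(* Let $k$ be a field. For a finite group $G$ there are algebra isomorphisms $$k_{glob}G\cong k\Gamma_{glob}(G)\cong\mathcal B(G)\#kG\cong\overline{A_{par}(G)}\#kG\cong\{A_{par},A_{par}\}\#kG\cong(kG)_{glob}.$$
   Context: $G$ is a finite group, $e$ its neutral element, $kG$ its group algebra with antipode $S(g)=g^{-1}$; $\otimes=\otimes_k$. $\mathcal P'(G)$ is the set of nonempty subsets of $G$. $\Gamma_{glob}(G)$ is the groupoid with object set $\mathcal P'(G)$ and morphism set $G\times\mathcal P'(G)$, where $(g,A)$ goes from $A$ to $gA$, and $(g,A)(h,B)=(gh,B)$ if $A=hB$, undefined otherwise. $k\Gamma_{glob}(G)$ is its groupoid algebra, and $k_{glob}G$ denotes this same algebra as described in Velasco's thesis: $k_{glob}G$ has basis $G\times\mathcal P'(G)$ with this product (and product zero when undefined). $\mathcal B(G)=k\mathcal P'(G)$ is the semigroup algebra of the semilattice $(\mathcal P'(G),\cup)$; it has a basis of orthogonal idempotents $\{Q_X\mid X\in\mathcal P'(G)\}$ and is a $kG$-module algebra by $g\triangleright Q_X=Q_{gX}$. $(kG)_{par}=k_{par}G$ is the algebra generated by symbols $[g]$, $g\in G$, with relations $[e]=1$, $[g][h][h^{-1}]=[gh][h^{-1}]$, $[g^{-1}][g][h]=[g^{-1}][gh]$. A partial $kG$-module is a left $k_{par}G$-module $M$, written $g\bullet m=[g]m$ and extended linearly to $kG$; their category is ${}_{kG}\mathsf{PMod}$. $A_{par}=A_{par}(G)\subseteq k_{par}G$ is the (commutative) subalgebra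 generated by the idempotents $\varepsilon_g=[g][g^{-1}]$; it is a partial $kG$-module (algebra) via $g\bullet a=[g]a[g^{-1}]$. $\overline{A_{par}(G)}$ is the standard globalization: $\mathrm{Hom}_k(kG,A_{par})$ is a $kG$-module by $(g\rightharpoonup f)(x)=f(xg)$ and an algebra under the convolution product $(f*f')(g)=f(g)f'(g)$ for $g\in G$; put $\varphi(a)(x)=x\bullet a$; then $\overline{A_{par}(G)}$ is the $kG$-submodule generated by $\varphi(A_{par})$, which is closed under convolution and is a $kG$-module algebra. $\{A_{par},A_{par}\}=\mathrm{Hom}_{{}_{kG}\mathsf{PMod}}(A_{par}\otimes kG,A_{par})$, where $g\bullet(a\otimes h)=g\bullet a\otimes gh$; it is a $kG$-module algebra with $(g\rightharpoonup f)(a\otimes h)=f(a\otimes hg)$ and $(f\circ f')(a\otimes h)=f'(f(a\otimes h)\otimes h)$ for $g,h\in G$. For a $kG$-module algebra $B$, $B\#kG$ is the smash product $B\otimes kG$ with $(b\#g)(c\#h)=b(g\cdot c)\#gh$. By definition $(kG)_{glob}=\{A_{par},A_{par}\}\#kG$. *)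

theory Defs
  imports "HOL-Algebra.Module" "HOL-Algebra.QuotRing" "HOL.Hull"
begin

section \<open>Algebras over a field, and algebra isomorphisms\<close>

text \<open>
  The base field \<open>k\<close> is a type \<open>'k\<close> of class \<^class>\<open>field\<close>; \<open>scalars\<close> is that field as a HOL-Algebra
  record, so that the library locale \<^locale>\<open>module\<close> over \<open>scalars\<close> is the notion of a \<open>k\<close>-vector space.
  The library locale \<^locale>\<open>algebra\<close> covers commutative algebras only, hence \<open>k_algebra\<close>.
\<close>

definition scalars :: "'k::field ring" where
  "scalars = \<lparr>carrier = UNIV, mult = (*), one = 1, zero = 0, add = (+)\<rparr>"

definition k_algebra :: "('k::field, 'a) module \<Rightarrow> bool" where
  "k_algebra A \<longleftrightarrow> module scalars A \<and> ring A \<and>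
     (\<forall>c. \<forall>x\<in>carrier A. \<forall>y\<in>carrier A.
        (c \<odot>\<^bsub>A\<^esub> x) \<otimes>\<^bsub>A\<^esub> y = c \<odot>\<^bsub>A\<^esub> (x \<otimes>\<^bsub>A\<^esub> y) \<and> x \<otimes>\<^bsub>A\<^esub> (c \<odot>\<^bsub>A\<^esub> y) = c \<odot>\<^bsub>A\<^esub> (x \<otimes>\<^bsub>A\<^esub> y))"

definition alg_iso :: "('k::field, 'a) module \<Rightarrow> ('k, 'b) module \<Rightarrow> ('a \<Rightarrow> 'b) set" where
  "alg_iso A B = {h \<in> ring_iso A B. \<forall>c. \<forall>x\<in>carrier A. h (c \<odot>\<^bsub>A\<^esub> x) = c \<odot>\<^bsub>B\<^esub> h x}"

definition alg_isomorphic :: "('k::field, 'a) module \<Rightarrow> ('k, 'b) module \<Rightarrow> bool"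
    (infix \<open>\<cong>\<^sub>k\<close> 50) where
  "A \<cong>\<^sub>k B \<longleftrightarrow> k_algebra A \<and> k_algebra B \<and> alg_iso A B \<noteq> {}"

definition subspace_of :: "('k, 'a) module \<Rightarrow> 'a set \<Rightarrow> bool" where
  "subspace_of V S \<longleftrightarrow> S \<subseteq> carrier V \<and> \<zero>\<^bsub>V\<^esub> \<in> S \<and>
     (\<forall>x\<in>S. \<forall>y\<in>S. x \<oplus>\<^bsub>V\<^esub> y \<in> S) \<and> (\<forall>c. \<forall>x\<in>S. c \<odot>\<^bsub>V\<^esub> x \<in> S)"

definition subalgebra_of :: "('k, 'a) module \<Rightarrow> 'a set \<Rightarrow> bool" where
  "subalgebra_of A S \<longleftrightarrow> subspace_of A S \<and> \<one>\<^bsub>A\<^esub> \<in> S \<and> (\<forall>x\<in>S. \<forall>y\<in>S. x \<otimes>\<^bsub>A\<^esub> y \<in> S)"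

definition lin_maps :: "('k, 'a) module \<Rightarrow> ('k, 'b) module \<Rightarrow> ('a \<Rightarrow> 'b) set" where
  "lin_maps V W = {f \<in> carrier V \<rightarrow>\<^sub>E carrier W.
     (\<forall>x\<in>carrier V. \<forall>y\<in>carrier V. f (x \<oplus>\<^bsub>V\<^esub> y) = f x \<oplus>\<^bsub>W\<^esub> f y) \<and>
     (\<forall>c. \<forall>x\<in>carrier V. f (c \<odot>\<^bsub>V\<^esub> x) = c \<odot>\<^bsub>W\<^esub> f x)}"

text \<open>The quotient by a two-sided ideal: the library's quotient ring together with its scalars.\<close>

definition quot_alg :: "('k, 'a) module \<Rightarrow> 'a set \<Rightarrow> ('k, 'a set) module" where
  "quot_alg A I = \<lparr>carrier = carrier (A Quot I), mult = mult (A Quot I), one = one (A Quot I),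
     zero = zero (A Quot I), add = add (A Quot I),
     smult = (\<lambda>c C. \<Union>x\<in>C. I +>\<^bsub>A\<^esub> (c \<odot>\<^bsub>A\<^esub> x))\<rparr>"

section \<open>Algebras with a multiplicative basis\<close>

text \<open>
  \<open>span_alg X m u\<close> has basis \<open>X\<close>, unit \<open>u\<close>, and the product of two basis elements \<open>x\<close>, \<open>y\<close> is the
  basis element \<open>z\<close> if \<open>m x y = Some z\<close> and zero if \<open>m x y = None\<close>. A linear combination of basis
  elements is its coefficient function, which vanishes outside \<open>X\<close>.
\<close>

definition ind :: "'x \<Rightarrow> 'x \<Rightarrow> 'k::field" where
  "ind x = (\<lambda>y. if y = x then 1 else 0)"

definition span_alg ::
    "'x set \<Rightarrow> ('x \<Rightarrow> 'x \<Rightarrow> 'x option) \<Rightarrow> ('x \<Rightarrow> 'k) \<Rightarrow> ('k::field, 'x \<Rightarrow> 'k) module" where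
  "span_alg X m u = \<lparr>
     carrier = {f. finite {x. f x \<noteq> 0} \<and> {x. f x \<noteq> 0} \<subseteq> X},
     mult = (\<lambda>f f' z. \<Sum>(x, y) \<in> {(x, y). f x \<noteq> 0 \<and> f' y \<noteq> 0 \<and> m x y = Some z}. f x * f' y),
     one = u,
     zero = (\<lambda>_. 0),
     add = (\<lambda>f f' x. f x + f' x),
     smult = (\<lambda>c f x. c * f x)\<rparr>"

definition group_alg :: "('g, 'm) monoid_scheme \<Rightarrow> ('k::field, 'g \<Rightarrow> 'k) module" where
  "group_alg G = span_alg (carrier G) (\<lambda>g h. Some (g \<otimes>\<^bsub>G\<^esub> h)) (ind \<one>\<^bsub>G\<^esub>)"

section \<open>Tensor products with \<open>kG\<close>, and smash products\<close>

text \<open>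
  Since \<open>kG\<close> has basis \<open>G\<close>, the tensor product of \<open>V\<close> with \<open>kG\<close> over \<open>k\<close> is modelled by the finitely
  supported functions \<open>t\<close> from \<open>G\<close> to \<open>V\<close>, where \<open>t\<close> stands for the sum of the \<open>t h \<otimes> h\<close>;
  \<open>tens_kG_universal\<close> below is its universal property. \<open>tens_kG\<close> is only a
  vector space: its \<open>mult\<close> and \<open>one\<close> fields are arbitrary.
\<close>

definition tens_kG :: "('g, 'm) monoid_scheme \<Rightarrow> ('k::field, 'v) module \<Rightarrow> ('k, 'g \<Rightarrow> 'v) module" where
  "tens_kG G V = \<lparr>
     carrier = {t \<in> carrier G \<rightarrow>\<^sub>E carrier V. finite {h \<in> carrier G. t h \<noteq> \<zero>\<^bsub>V\<^esub>}},
     mult = undefined,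
     one = undefined,
     zero = (\<lambda>h\<in>carrier G. \<zero>\<^bsub>V\<^esub>),
     add = (\<lambda>t t'. \<lambda>h\<in>carrier G. t h \<oplus>\<^bsub>V\<^esub> t' h),
     smult = (\<lambda>c t. \<lambda>h\<in>carrier G. c \<odot>\<^bsub>V\<^esub> t h)\<rparr>"

definition tens :: "('g, 'm) monoid_scheme \<Rightarrow> ('k::field, 'v) module \<Rightarrow> 'v \<Rightarrow> ('g \<Rightarrow> 'k) \<Rightarrow> ('g \<Rightarrow> 'v)" where
  "tens G V v x = (\<lambda>h\<in>carrier G. x h \<odot>\<^bsub>V\<^esub> v)"

text \<open>\<open>act g\<close> is the action of \<open>g \<in> G\<close> on \<open>B\<close>. The product is the bilinear extension of
  \<open>(b # g)(c # h) = b (g \<cdot> c) # gh\<close>, for \<open>G\<close> finite; see \<open>smash_mult_tens\<close> below.\<close>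

definition smash ::
    "('g, 'm) monoid_scheme \<Rightarrow> ('k::field, 'b) module \<Rightarrow> ('g \<Rightarrow> 'b \<Rightarrow> 'b) \<Rightarrow> ('k, 'g \<Rightarrow> 'b) module" where
  "smash G B act = (tens_kG G B)\<lparr>
     mult := (\<lambda>s t. \<lambda>l\<in>carrier G. \<Oplus>\<^bsub>B\<^esub>g\<in>carrier G. s g \<otimes>\<^bsub>B\<^esub> act g (t (inv\<^bsub>G\<^esub> g \<otimes>\<^bsub>G\<^esub> l))),
     one := tens G B \<one>\<^bsub>B\<^esub> (ind \<one>\<^bsub>G\<^esub>)\<rparr>"

section \<open>Groupoid algebras, the global groupoid, and \<open>k\<^sub>g\<^sub>l\<^sub>o\<^sub>bG\<close>\<close>

record ('o, 'a) groupoid_data =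
  Obj :: "'o set"
  Arr :: "'a set"
  Dom :: "'a \<Rightarrow> 'o"
  Cod :: "'a \<Rightarrow> 'o"
  Id :: "'o \<Rightarrow> 'a"
  Comp :: "'a \<Rightarrow> 'a \<Rightarrow> 'a"

text \<open>\<open>Comp \<Gamma> x y\<close> is \<open>x\<close> after \<open>y\<close>, meaningful if \<open>Dom x = Cod y\<close>.\<close>

definition is_groupoid :: "('o, 'a) groupoid_data \<Rightarrow> bool" where
  "is_groupoid \<Gamma> \<longleftrightarrow>
     (\<forall>x\<in>Arr \<Gamma>. Dom \<Gamma> x \<in> Obj \<Gamma> \<and> Cod \<Gamma> x \<in> Obj \<Gamma>) \<and>
     (\<forall>A\<in>Obj \<Gamma>. Id \<Gamma> A \<in> Arr \<Gamma> \<and> Dom \<Gamma> (Id \<Gamma> A) = A \<and> Cod \<Gamma> (Id \<Gamma> A) = A) \<and>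
     (\<forall>x\<in>Arr \<Gamma>. \<forall>y\<in>Arr \<Gamma>. Dom \<Gamma> x = Cod \<Gamma> y \<longrightarrow>
        Comp \<Gamma> x y \<in> Arr \<Gamma> \<and> Dom \<Gamma> (Comp \<Gamma> x y) = Dom \<Gamma> y \<and> Cod \<Gamma> (Comp \<Gamma> x y) = Cod \<Gamma> x) \<and>
     (\<forall>x\<in>Arr \<Gamma>. Comp \<Gamma> x (Id \<Gamma> (Dom \<Gamma> x)) = x \<and> Comp \<Gamma> (Id \<Gamma> (Cod \<Gamma> x)) x = x) \<and>
     (\<forall>x\<in>Arr \<Gamma>. \<forall>y\<in>Arr \<Gamma>. \<forall>z\<in>Arr \<Gamma>. Dom \<Gamma> x = Cod \<Gamma> y \<and> Dom \<Gamma> y = Cod \<Gamma> z \<longrightarrow>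
        Comp \<Gamma> (Comp \<Gamma> x y) z = Comp \<Gamma> x (Comp \<Gamma> y z)) \<and>
     (\<forall>x\<in>Arr \<Gamma>. \<exists>y\<in>Arr \<Gamma>. Dom \<Gamma> y = Cod \<Gamma> x \<and> Cod \<Gamma> y = Dom \<Gamma> x \<and>
        Comp \<Gamma> x y = Id \<Gamma> (Cod \<Gamma> x) \<and> Comp \<Gamma> y x = Id \<Gamma> (Dom \<Gamma> x))"

text \<open>For a groupoid with finitely many objects; the unit is the sum of the identities.\<close>

definition groupoid_alg :: "('o, 'a) groupoid_data \<Rightarrow> ('k::field, 'a \<Rightarrow> 'k) module" where
  "groupoid_alg \<Gamma> = span_alg (Arr \<Gamma>)
     (\<lambda>x y. if Dom \<Gamma> x = Cod \<Gamma> y then Some (Comp \<Gamma> x y) else None)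
     (\<lambda>x. \<Sum>A\<in>Obj \<Gamma>. ind (Id \<Gamma> A) x)"

definition nesubsets :: "('g, 'm) monoid_scheme \<Rightarrow> 'g set set" where
  "nesubsets G = Pow (carrier G) - {{}}"

definition Gamma_glob :: "('g, 'm) monoid_scheme \<Rightarrow> ('g set, 'g \<times> 'g set) groupoid_data" where
  "Gamma_glob G = \<lparr>
     Obj = nesubsets G,
     Arr = carrier G \<times> nesubsets G,
     Dom = (\<lambda>(g, A). A),
     Cod = (\<lambda>(g, A). g <#\<^bsub>G\<^esub> A),
     Id = (\<lambda>A. (\<one>\<^bsub>G\<^esub>, A)),
     Comp = (\<lambda>(g, A) (h, B). (g \<otimes>\<^bsub>G\<^esub> h, B))\<rparr>"

definition k_glob :: "('g, 'm) monoid_scheme \<Rightarrow> ('k::field, 'g \<times> 'g set \<Rightarrow> 'k) module" where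
  "k_glob G = span_alg (carrier G \<times> nesubsets G)
     (\<lambda>(g, A) (h, B). if A = h <#\<^bsub>G\<^esub> B then Some (g \<otimes>\<^bsub>G\<^esub> h, B) else None)
     (\<lambda>x. \<Sum>A\<in>nesubsets G. ind (\<one>\<^bsub>G\<^esub>, A) x)"

section \<open>The semilattice algebra \<open>\<B>(G)\<close>\<close>

text \<open>
  In the semilattice of nonempty subsets under union one has \<open>Y \<le> X\<close> iff \<open>X \<subseteq> Y\<close>. The idempotents
  are given by Moebius inversion of \<open>X = \<Sum>\<^bsub>Y \<supseteq> X\<^esub> Q\<^sub>Y\<close>, and \<open>Q_coord G a X\<close> is the
  coefficient of \<open>Q\<^sub>X\<close> in \<open>a\<close>. The semilattice has no neutral element, but its algebra
  has the unit \<open>\<Sum>\<^sub>X Q\<^sub>X\<close>.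
\<close>

definition Q_idem :: "('g, 'm) monoid_scheme \<Rightarrow> 'g set \<Rightarrow> 'g set \<Rightarrow> 'k::field" where
  "Q_idem G X = (\<lambda>Y. if Y \<in> nesubsets G \<and> X \<subseteq> Y then (- 1) ^ card (Y - X) else 0)"

definition Q_coord :: "('g, 'm) monoid_scheme \<Rightarrow> ('g set \<Rightarrow> 'k::field) \<Rightarrow> 'g set \<Rightarrow> 'k" where
  "Q_coord G a X = (\<Sum>Y\<in>{Y \<in> nesubsets G. Y \<subseteq> X}. a Y)"

definition B_alg :: "('g, 'm) monoid_scheme \<Rightarrow> ('k::field, 'g set \<Rightarrow> 'k) module" where
  "B_alg G = span_alg (nesubsets G) (\<lambda>X Y. Some (X \<union> Y)) (\<lambda>Y. \<Sum>X\<in>nesubsets G. Q_idem G X Y)"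

text \<open>The linear extension of \<open>g \<triangleright> Q\<^sub>X = Q\<^bsub>gX\<^esub>\<close>.\<close>

definition B_act :: "('g, 'm) monoid_scheme \<Rightarrow> 'g \<Rightarrow> ('g set \<Rightarrow> 'k::field) \<Rightarrow> 'g set \<Rightarrow> 'k" where
  "B_act G g a = (\<lambda>Y. \<Sum>X\<in>nesubsets G. Q_coord G a X * Q_idem G (g <#\<^bsub>G\<^esub> X) Y)"

section \<open>The partial group algebra and \<open>A\<^sub>p\<^sub>a\<^sub>r\<close>\<close>

definition free_alg :: "('g, 'm) monoid_scheme \<Rightarrow> ('k::field, 'g list \<Rightarrow> 'k) module" where
  "free_alg G = span_alg (lists (carrier G)) (\<lambda>u v. Some (u @ v)) (ind [])"

definition par_rels :: "('g, 'm) monoid_scheme \<Rightarrow> ('g list \<Rightarrow> 'k::field) set" where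
  "par_rels G =
     {ind [\<one>\<^bsub>G\<^esub>] \<ominus>\<^bsub>free_alg G\<^esub> ind []} \<union>
     {ind [g, h, inv\<^bsub>G\<^esub> h] \<ominus>\<^bsub>free_alg G\<^esub> ind [g \<otimes>\<^bsub>G\<^esub> h, inv\<^bsub>G\<^esub> h] | g h. g \<in> carrier G \<and> h \<in> carrier G} \<union>
     {ind [inv\<^bsub>G\<^esub> g, g, h] \<ominus>\<^bsub>free_alg G\<^esub> ind [inv\<^bsub>G\<^esub> g, g \<otimes>\<^bsub>G\<^esub> h] | g h. g \<in> carrier G \<and> h \<in> carrier G}"

definition k_par :: "('g, 'm) monoid_scheme \<Rightarrow> ('k::field, ('g list \<Rightarrow> 'k) set) module" where
  "k_par G = quot_alg (free_alg G) (Idl\<^bsub>free_alg G\<^esub> (par_rels G))"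

definition par_gen :: "('g, 'm) monoid_scheme \<Rightarrow> 'g \<Rightarrow> ('g list \<Rightarrow> 'k::field) set" where
  "par_gen G g = (Idl\<^bsub>free_alg G\<^esub> (par_rels G)) +>\<^bsub>free_alg G\<^esub> ind [g]"

definition A_par :: "('g, 'm) monoid_scheme \<Rightarrow> ('k::field, ('g list \<Rightarrow> 'k) set) module" where
  "A_par G = (k_par G)\<lparr>carrier :=
     subalgebra_of (k_par G) hull {par_gen G g \<otimes>\<^bsub>k_par G\<^esub> par_gen G (inv\<^bsub>G\<^esub> g) | g. g \<in> carrier G}\<rparr>"

definition A_par_act ::
    "('g, 'm) monoid_scheme \<Rightarrow> 'g \<Rightarrow> ('g list \<Rightarrow> 'k::field) set \<Rightarrow> ('g list \<Rightarrow> 'k) set" where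
  "A_par_act G g a = par_gen G g \<otimes>\<^bsub>k_par G\<^esub> a \<otimes>\<^bsub>k_par G\<^esub> par_gen G (inv\<^bsub>G\<^esub> g)"

section \<open>The standard globalization of \<open>A\<^sub>p\<^sub>a\<^sub>r\<close>\<close>

text \<open>\<open>Hom\<^sub>k(kG, A)\<close> for an algebra \<open>A\<close>, with the linear extension of the convolution
  product \<open>(f * f')(g) = f(g) f'(g)\<close>, for \<open>G\<close> finite; its unit is \<open>g \<mapsto> 1\<close> on \<open>G\<close>.\<close>

definition conv_alg ::
    "('g, 'm) monoid_scheme \<Rightarrow> ('k::field, 'a) module \<Rightarrow> ('k, ('g \<Rightarrow> 'k) \<Rightarrow> 'a) module" where
  "conv_alg G A = \<lparr>
     carrier = lin_maps (group_alg G) A,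
     mult = (\<lambda>f f'. \<lambda>x\<in>carrier (group_alg G).
               \<Oplus>\<^bsub>A\<^esub>g\<in>carrier G. x g \<odot>\<^bsub>A\<^esub> (f (ind g) \<otimes>\<^bsub>A\<^esub> f' (ind g))),
     one = (\<lambda>x\<in>carrier (group_alg G). \<Oplus>\<^bsub>A\<^esub>g\<in>carrier G. x g \<odot>\<^bsub>A\<^esub> \<one>\<^bsub>A\<^esub>),
     zero = (\<lambda>x\<in>carrier (group_alg G). \<zero>\<^bsub>A\<^esub>),
     add = (\<lambda>f f'. \<lambda>x\<in>carrier (group_alg G). f x \<oplus>\<^bsub>A\<^esub> f' x),
     smult = (\<lambda>c f. \<lambda>x\<in>carrier (group_alg G). c \<odot>\<^bsub>A\<^esub> f x)\<rparr>"

definition conv_act :: "('g, 'm) monoid_scheme \<Rightarrow> 'g \<Rightarrow> (('g \<Rightarrow> 'k::field) \<Rightarrow> 'a) \<Rightarrow> ('g \<Rightarrow> 'k) \<Rightarrow> 'a" where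
  "conv_act G g f = (\<lambda>x\<in>carrier (group_alg G). f (x \<otimes>\<^bsub>group_alg G\<^esub> ind g))"

definition glob_phi ::
    "('g, 'm) monoid_scheme \<Rightarrow> ('g list \<Rightarrow> 'k::field) set \<Rightarrow> ('g \<Rightarrow> 'k) \<Rightarrow> ('g list \<Rightarrow> 'k) set" where
  "glob_phi G a = (\<lambda>x\<in>carrier (group_alg G). \<Oplus>\<^bsub>A_par G\<^esub>g\<in>carrier G. x g \<odot>\<^bsub>A_par G\<^esub> A_par_act G g a)"

text \<open>A \<open>kG\<close>-submodule of a \<open>kG\<close>-module is a \<open>G\<close>-stable subspace.\<close>

definition kG_submodule ::
    "('g, 'm) monoid_scheme \<Rightarrow> ('k::field, 'v) module \<Rightarrow> ('g \<Rightarrow> 'v \<Rightarrow> 'v) \<Rightarrow> 'v set \<Rightarrow> bool" where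
  "kG_submodule G V act S \<longleftrightarrow> subspace_of V S \<and> (\<forall>g\<in>carrier G. \<forall>v\<in>S. act g v \<in> S)"

definition A_par_bar ::
    "('g, 'm) monoid_scheme \<Rightarrow> ('k::field, ('g \<Rightarrow> 'k) \<Rightarrow> ('g list \<Rightarrow> 'k) set) module" where
  "A_par_bar G = (conv_alg G (A_par G))\<lparr>carrier :=
     kG_submodule G (conv_alg G (A_par G)) (conv_act G) hull (glob_phi G ` carrier (A_par G))\<rparr>"

section \<open>The algebra \<open>{A\<^sub>p\<^sub>a\<^sub>r, A\<^sub>p\<^sub>a\<^sub>r}\<close> and \<open>(kG)\<^sub>g\<^sub>l\<^sub>o\<^sub>b\<close>\<close>

text \<open>
  A partial \<open>kG\<close>-module is given by a vector space \<open>V\<close> and the action \<open>act\<close> of the generators \<open>[g]\<close>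
  of \<open>k\<^sub>p\<^sub>a\<^sub>rG\<close>; the \<open>k\<^sub>p\<^sub>a\<^sub>rG\<close>-linear maps are the linear maps that commute with the
  action of all \<open>[g]\<close>.
\<close>

definition partial_module ::
    "('g, 'm) monoid_scheme \<Rightarrow> ('k::field, 'v) module \<Rightarrow> ('g \<Rightarrow> 'v \<Rightarrow> 'v) \<Rightarrow> bool" where
  "partial_module G V act \<longleftrightarrow> module scalars V \<and>
     (\<forall>g\<in>carrier G. restrict (act g) (carrier V) \<in> lin_maps V V) \<and>
     (\<forall>v\<in>carrier V. act \<one>\<^bsub>G\<^esub> v = v) \<and>
     (\<forall>g\<in>carrier G. \<forall>h\<in>carrier G. \<forall>v\<in>carrier V.
        act g (act h (act (inv\<^bsub>G\<^esub> h) v)) = act (g \<otimes>\<^bsub>G\<^esub> h) (act (inv\<^bsub>G\<^esub> h) v) \<and>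
        act (inv\<^bsub>G\<^esub> g) (act g (act h v)) = act (inv\<^bsub>G\<^esub> g) (act (g \<otimes>\<^bsub>G\<^esub> h) v))"

definition pmod_hom ::
    "('g, 'm) monoid_scheme \<Rightarrow> ('k::field, 'v) module \<Rightarrow> ('g \<Rightarrow> 'v \<Rightarrow> 'v) \<Rightarrow>
     ('k, 'w) module \<Rightarrow> ('g \<Rightarrow> 'w \<Rightarrow> 'w) \<Rightarrow> ('v \<Rightarrow> 'w) set" where
  "pmod_hom G V act W act' =
     {f \<in> lin_maps V W. \<forall>g\<in>carrier G. \<forall>v\<in>carrier V. f (act g v) = act' g (f v)}"

text \<open>The linear extensions of \<open>g \<bullet> (v \<otimes> h) = g \<bullet> v \<otimes> gh\<close> and of \<open>v \<otimes> h \<mapsto> v \<otimes> hg\<close>;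
  see \<open>diag_act_tens\<close> and \<open>rshift_tens\<close> below.\<close>

definition diag_act ::
    "('g, 'm) monoid_scheme \<Rightarrow> ('g \<Rightarrow> 'v \<Rightarrow> 'v) \<Rightarrow> 'g \<Rightarrow> ('g \<Rightarrow> 'v) \<Rightarrow> ('g \<Rightarrow> 'v)" where
  "diag_act G act g t = (\<lambda>l\<in>carrier G. act g (t (inv\<^bsub>G\<^esub> g \<otimes>\<^bsub>G\<^esub> l)))"

definition rshift :: "('g, 'm) monoid_scheme \<Rightarrow> 'g \<Rightarrow> ('g \<Rightarrow> 'v) \<Rightarrow> ('g \<Rightarrow> 'v)" where
  "rshift G g t = (\<lambda>l\<in>carrier G. t (l \<otimes>\<^bsub>G\<^esub> inv\<^bsub>G\<^esub> g))"

text \<open>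
  The product is \<open>(f \<circ> f')(a \<otimes> h) = f'(f(a \<otimes> h) \<otimes> h)\<close> and the unit is \<open>a \<otimes> h \<mapsto> a\<close> for
  \<open>h \<in> G\<close>, both evaluated at \<open>t = \<Sum>\<^sub>h t h \<otimes> h\<close> by linearity, for \<open>G\<close> finite.
\<close>

definition AA_alg ::
    "('g, 'm) monoid_scheme \<Rightarrow> ('k::field, ('g \<Rightarrow> ('g list \<Rightarrow> 'k) set) \<Rightarrow> ('g list \<Rightarrow> 'k) set) module" where
  "AA_alg G = (let A = A_par G; T = tens_kG G A; tn = (\<lambda>a h. tens G A a (ind h)) in \<lparr>
     carrier = pmod_hom G T (diag_act G (A_par_act G)) A (A_par_act G),
     mult = (\<lambda>f f'. \<lambda>t\<in>carrier T. \<Oplus>\<^bsub>A\<^esub>h\<in>carrier G. f' (tn (f (tn (t h) h)) h)),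
     one = (\<lambda>t\<in>carrier T. \<Oplus>\<^bsub>A\<^esub>h\<in>carrier G. t h),
     zero = (\<lambda>t\<in>carrier T. \<zero>\<^bsub>A\<^esub>),
     add = (\<lambda>f f'. \<lambda>t\<in>carrier T. f t \<oplus>\<^bsub>A\<^esub> f' t),
     smult = (\<lambda>c f. \<lambda>t\<in>carrier T. c \<odot>\<^bsub>A\<^esub> f t)\<rparr>)"

definition AA_act ::
    "('g, 'm) monoid_scheme \<Rightarrow> 'g \<Rightarrow> (('g \<Rightarrow> ('g list \<Rightarrow> 'k::field) set) \<Rightarrow> ('g list \<Rightarrow> 'k) set) \<Rightarrow>
     (('g \<Rightarrow> ('g list \<Rightarrow> 'k) set) \<Rightarrow> ('g list \<Rightarrow> 'k) set)" where
  "AA_act G g f = (\<lambda>t\<in>carrier (tens_kG G (A_par G)). f (rshift G g t))"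

definition kG_glob ::
    "('g, 'm) monoid_scheme \<Rightarrow>
     ('k::field, 'g \<Rightarrow> ('g \<Rightarrow> ('g list \<Rightarrow> 'k) set) \<Rightarrow> ('g list \<Rightarrow> 'k) set) module" where
  "kG_glob G = smash G (AA_alg G) (AA_act G)"

section \<open>Facts that pin down the encodings\<close>

text \<open>
  The universal property of \<open>tens_kG\<close>; the formulas for the smash product and for the two
  actions on pure tensors; the groupoid laws for \<open>\<Gamma>\<^sub>g\<^sub>l\<^sub>o\<^sub>b(G)\<close>; and that the \<open>Q\<^sub>X\<close> are
  orthogonal idempotents that form a basis of \<open>\<B>(G)\<close> permuted by \<open>G\<close>.
\<close>

lemma scalars_simps [simp]:
  "carrier scalars = UNIV" "\<one>\<^bsub>scalars\<^esub> = 1" "\<zero>\<^bsub>scalars\<^esub> = 0"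
  "x \<otimes>\<^bsub>scalars\<^esub> y = x * y" "x \<oplus>\<^bsub>scalars\<^esub> y = x + y"
  by (simp_all add: scalars_def)

lemma tens_ind:
  assumes "module scalars V" "v \<in> carrier V"
  shows "tens G V v (ind h) = (\<lambda>l\<in>carrier G. if l = h then v else \<zero>\<^bsub>V\<^esub>)"
proof -
  interpret module scalars V by fact
  have "1 \<odot>\<^bsub>V\<^esub> v = v" "0 \<odot>\<^bsub>V\<^esub> v = \<zero>\<^bsub>V\<^esub>"
    using smult_one[OF assms(2)] smult_l_null[OF assms(2)] by simp_all
  then show ?thesis by (auto simp: tens_def ind_def)
qed

lemma diag_act_tens:
  fixes G (structure)
  assumes "group G" "module scalars V" "v \<in> carrier V" "act g v \<in> carrier V"
    and "act g \<zero>\<^bsub>V\<^esub> = \<zero>\<^bsub>V\<^esub>" "g \<in> carrier G" "h \<in> carrier G"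
  shows "diag_act G act g (tens G V v (ind h)) = tens G V (act g v) (ind (g \<otimes>\<^bsub>G\<^esub> h))"
proof -
  interpret group G by fact
  have "inv g \<otimes> l = h \<longleftrightarrow> l = g \<otimes> h" if "l \<in> carrier G" for l
    using that assms by (metis inv_solve_left)
  then show ?thesis
    using assms by (auto simp: diag_act_def tens_ind)
qed

lemma rshift_tens:
  fixes G (structure)
  assumes "group G" "module scalars V" "v \<in> carrier V" "g \<in> carrier G" "h \<in> carrier G"
  shows "rshift G g (tens G V v (ind h)) = tens G V v (ind (h \<otimes>\<^bsub>G\<^esub> g))"
proof -
  interpret group G by fact
  have "l \<otimes> inv g = h \<longleftrightarrow> l = h \<otimes> g" if "l \<in> carrier G" for l
    using that assms by (metis inv_solve_right)
  then show ?thesis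
    using assms by (auto simp: rshift_def tens_ind)
qed

lemma smash_mult_tens:
  assumes "group G" "finite (carrier G)" "k_algebra B" "b \<in> carrier B" "c \<in> carrier B"
    and "act g c \<in> carrier B" "act g \<zero>\<^bsub>B\<^esub> = \<zero>\<^bsub>B\<^esub>"
    and clo: "\<And>h d. h \<in> carrier G \<Longrightarrow> d \<in> carrier B \<Longrightarrow> act h d \<in> carrier B"
    and g: "g \<in> carrier G" and h: "h \<in> carrier G"
  shows "tens G B b (ind g) \<otimes>\<^bsub>smash G B act\<^esub> tens G B c (ind h)
       = tens G B (b \<otimes>\<^bsub>B\<^esub> act g c) (ind (g \<otimes>\<^bsub>G\<^esub> h))"
proof -
  interpret G: group G by fact
  interpret B: ring B using assms(3) by (simp add: k_algebra_def)
  have M: "module scalars B" using assms(3) by (simp add: k_algebra_def)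
  have *: "inv\<^bsub>G\<^esub> g \<otimes>\<^bsub>G\<^esub> l = h \<longleftrightarrow> l = g \<otimes>\<^bsub>G\<^esub> h" if "l \<in> carrier G" for l
    using that g h by (metis G.inv_solve_left)
  have "(\<Oplus>\<^bsub>B\<^esub>x\<in>carrier G. tens G B b (ind g) x \<otimes>\<^bsub>B\<^esub>
           act x (tens G B c (ind h) (inv\<^bsub>G\<^esub> x \<otimes>\<^bsub>G\<^esub> l)))
      = tens G B (b \<otimes>\<^bsub>B\<^esub> act g c) (ind (g \<otimes>\<^bsub>G\<^esub> h)) l" (is "?L = ?R") if "l \<in> carrier G" for l
  proof -
    have "?L = (\<Oplus>\<^bsub>B\<^esub>x\<in>carrier G. if g = x then ?R else \<zero>\<^bsub>B\<^esub>)"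
      by (rule B.finsum_cong') (use assms M * that clo in \<open>auto simp: tens_ind\<close>)
    also have "\<dots> = ?R"
      by (rule B.finsum_singleton) (use assms M that in \<open>auto simp: tens_ind\<close>)
    finally show ?thesis .
  qed
  then have "tens G B b (ind g) \<otimes>\<^bsub>smash G B act\<^esub> tens G B c (ind h)
       = restrict (tens G B (b \<otimes>\<^bsub>B\<^esub> act g c) (ind (g \<otimes>\<^bsub>G\<^esub> h))) (carrier G)"
    by (simp add: smash_def cong: restrict_cong)
  then show ?thesis by (simp add: tens_def)
qed

lemma Gamma_glob_is_groupoid:
  fixes G (structure)
  assumes "group G" shows "is_groupoid (Gamma_glob G)"
proof -
  interpret group G by fact
  have co: "g <# (h <# A) = (g \<otimes> h) <# A" if "g \<in> carrier G" "h \<in> carrier G" "A \<subseteq> carrier G" for g h A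
    using that by (auto simp: l_coset_def m_assoc subset_iff)
  have one: "\<one> <# A = A" if "A \<subseteq> carrier G" for A
    using that by (auto simp: l_coset_def subset_iff)
  have clo: "g <# A \<in> nesubsets G" if "g \<in> carrier G" "A \<in> nesubsets G" for g A
    using that by (auto simp: l_coset_def nesubsets_def)
  have sub: "A \<subseteq> carrier G" if "A \<in> nesubsets G" for A
    using that by (auto simp: nesubsets_def)
  have "\<exists>y\<in>Arr (Gamma_glob G). Dom (Gamma_glob G) y = Cod (Gamma_glob G) x \<and> Cod (Gamma_glob G) y = Dom (Gamma_glob G) x \<and>
        Comp (Gamma_glob G) x y = Id (Gamma_glob G) (Cod (Gamma_glob G) x) \<and>
        Comp (Gamma_glob G) y x = Id (Gamma_glob G) (Dom (Gamma_glob G) x)" if "x \<in> Arr (Gamma_glob G)" for x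
  proof -
    obtain g A where x: "x = (g, A)" by (cases x)
    then have "g \<in> carrier G" "A \<in> nesubsets G"
      using that by (auto simp: Gamma_glob_def)
    with x show ?thesis
      by (intro bexI[of _ "(inv g, g <# A)"]) (auto simp: Gamma_glob_def co one clo sub)
  qed
  then show ?thesis
    unfolding is_groupoid_def by (auto simp: Gamma_glob_def co one clo sub m_assoc)
qed

lemma finite_nesubsets: "finite (carrier G) \<Longrightarrow> finite (nesubsets G)"
  by (simp add: nesubsets_def)

lemma Q_coord_expansion:
  assumes "finite (carrier G)" "a \<in> carrier (B_alg G)"
  shows "a = (\<lambda>Y. \<Sum>X\<in>nesubsets G. Q_coord G a X * Q_idem G X Y)"
proof
  fix Y
  have a0: "a Z = 0" if "Z \<notin> nesubsets G" for Z
    using assms(2) that by (auto simp: B_alg_def span_alg_def)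
  show "a Y = (\<Sum>X\<in>nesubsets G. Q_coord G a X * Q_idem G X Y)"
  proof (cases "Y \<in> nesubsets G")
    case False
    then show ?thesis by (simp add: a0 Q_idem_def)
  next
    case True
    then have Y: "finite Y" "Y \<subseteq> carrier G"
      using assms(1) by (auto simp: nesubsets_def intro: finite_subset)
    have g: "Q_coord G a S = sum a (Pow S)" if "S \<subseteq> carrier G" for S
      unfolding Q_coord_def
      by (rule sum.mono_neutral_left)
        (use that assms(1) a0 in \<open>auto intro: finite_subset\<close>)
    define a' where "a' = (\<lambda>Z. a Z)"
    have "a Y = (\<Sum>T \<in> Pow Y. (-1) ^ (card Y - card T) * sum a (Pow T))"
      by (rule inclusion_exclusion_mobius[where g = "\<lambda>S. sum a (Pow S)"]) (use Y in auto)
    also have "\<dots> = (\<Sum>T \<in> Pow Y. (-1) ^ card (Y - T) * Q_coord G a T)"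
      by (rule sum.cong) (use Y in \<open>auto simp: g card_Diff_subset finite_subset\<close>)
    also have "\<dots> = (\<Sum>T \<in> {T \<in> nesubsets G. T \<subseteq> Y}. (-1) ^ card (Y - T) * Q_coord G a T)"
    proof (rule sum.mono_neutral_right)
      show "\<forall>T\<in>Pow Y - {T \<in> nesubsets G. T \<subseteq> Y}. (-1) ^ card (Y - T) * Q_coord G a T = 0"
        using Y by (auto simp: nesubsets_def Q_coord_def)
    qed (use Y in auto)
    also have "\<dots> = (\<Sum>X\<in>nesubsets G. Q_coord G a X * Q_idem G X Y)"
      using True finite_nesubsets[OF assms(1)]
      by (intro sum.mono_neutral_cong_left) (auto simp: Q_idem_def)
    finally show ?thesis .
  qed
qed

lemma Q_idem_carrier:
  assumes "finite (carrier G)" shows "Q_idem G X \<in> carrier (B_alg G)"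
  using finite_nesubsets[OF assms]
  by (auto simp: B_alg_def span_alg_def Q_idem_def elim: rev_finite_subset split: if_splits)

lemma sum_Pow_sign:
  "finite S \<Longrightarrow> (\<Sum>W\<in>Pow S. (- 1) ^ card W) = (if S = {} then 1 else (0 :: 'k::field))"
proof (induction S rule: finite_induct)
  case (insert x S)
  have "(\<Sum>W\<in>insert x ` Pow S. (- 1) ^ card W) = (\<Sum>W\<in>Pow S. - ((- 1) ^ card W) :: 'k)"
  proof (subst sum.reindex)
    show "inj_on (insert x) (Pow S)"
      using insert.hyps by (auto simp: inj_on_def)
    show "sum ((\<lambda>W. (- 1) ^ card W) \<circ> insert x) (Pow S) = (\<Sum>W\<in>Pow S. - ((- 1) ^ card W) :: 'k)"
    proof (rule sum.cong)
      fix W assume "W \<in> Pow S"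
      then have "finite W" "x \<notin> W" using insert.hyps by (auto intro: finite_subset)
      then show "((\<lambda>W. (- 1) ^ card W) \<circ> insert x) W = (- ((- 1) ^ card W) :: 'k)" by simp
    qed simp
  qed
  moreover have "Pow S \<inter> insert x ` Pow S = {}" using insert.hyps by auto
  ultimately show ?case
    using insert.hyps by (simp add: Pow_insert sum.union_disjoint sum_negf)
qed simp

lemma Q_coord_Q_idem:
  assumes "finite (carrier G)" "X \<in> nesubsets G" "Z \<in> nesubsets G"
  shows "Q_coord G (Q_idem G X :: 'g set \<Rightarrow> 'k::field) Z = (if Z = X then 1 else 0)"
proof -
  have fin: "finite Z" "finite X" "Z \<subseteq> carrier G"
    using assms by (auto simp: nesubsets_def intro: finite_subset)
  have "Q_coord G (Q_idem G X) Z = (\<Sum>Y | X \<subseteq> Y \<and> Y \<subseteq> Z. (-1) ^ card (Y - X) :: 'k)"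
    unfolding Q_coord_def Q_idem_def
    by (rule sum.mono_neutral_cong_right) (use fin assms in \<open>auto simp: nesubsets_def\<close>)
  also have "\<dots> = (if Z = X then 1 else 0)"
  proof (cases "X \<subseteq> Z")
    case True
    have "(\<Sum>Y | X \<subseteq> Y \<and> Y \<subseteq> Z. (- 1) ^ card (Y - X)) = (\<Sum>W\<in>Pow (Z - X). (- 1) ^ card W :: 'k)"
      by (rule sum.reindex_bij_witness[of _ "\<lambda>W. X \<union> W" "\<lambda>Y. Y - X"])
         (use True in \<open>auto simp: Un_Diff Diff_triv Int_commute\<close>)
    then show ?thesis
      using fin True by (auto simp: sum_Pow_sign[OF finite_Diff])
  next
    case False
    then have "{Y. X \<subseteq> Y \<and> Y \<subseteq> Z} = {}" by auto
    then show ?thesis by (subst \<open>_ = {}\<close>) (use False in auto)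
  qed
  finally show ?thesis .
qed

lemma Q_idem_orthogonal:
  assumes fin: "finite (carrier G)" and X: "X \<in> nesubsets G" "Y \<in> nesubsets G"
  shows "Q_idem G X \<otimes>\<^bsub>B_alg G\<^esub> Q_idem G Y = (if X = Y then Q_idem G X else (\<lambda>_. 0 :: 'k::field))"
proof -
  let ?N = "nesubsets G"
  define p :: "'a set \<Rightarrow> 'k" where "p = Q_idem G X \<otimes>\<^bsub>B_alg G\<^esub> Q_idem G Y"
  have p: "p W = (\<Sum>(U, V)\<in>{(U, V). U \<in> ?N \<and> V \<in> ?N \<and> U \<union> V = W}. Q_idem G X U * Q_idem G Y V)" for W
    unfolding p_def B_alg_def span_alg_def
    by simp (rule sum.mono_neutral_left,
        auto simp: Q_idem_def split: if_splits intro: finite_subset[OF _ finite_cartesian_product[OF finite_nesubsets[OF fin] finite_nesubsets[OF fin]]])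
  have N: "U \<union> V \<in> ?N" if "U \<in> ?N" "V \<in> ?N" for U V using that by (auto simp: nesubsets_def)
  have "p W = 0" if "W \<notin> ?N" for W
    unfolding p by (rule sum.neutral) (use N that in auto)
  then have "p \<in> carrier (B_alg G)"
    by (auto simp: B_alg_def span_alg_def intro!: rev_finite_subset[OF finite_nesubsets[OF fin]])
  then have "p = (\<lambda>W. \<Sum>Z\<in>?N. Q_coord G p Z * Q_idem G Z W)"
    by (rule Q_coord_expansion[OF fin])
  moreover have "Q_coord G p Z = (if Z = X \<and> Z = Y then 1 else 0)" if Z: "Z \<in> ?N" for Z
  proof -
    let ?D = "{U \<in> ?N. U \<subseteq> Z}" and ?q = "\<lambda>(U, V). Q_idem G X U * Q_idem G Y V :: 'k"
    have finD: "finite ?D" using finite_nesubsets[OF fin] by simp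
    have "Q_coord G p Z = (\<Sum>W\<in>?D. \<Sum>x\<in>{x \<in> ?D \<times> ?D. (case x of (U, V) \<Rightarrow> U \<union> V) = W}. ?q x)"
      unfolding Q_coord_def p by (intro sum.cong) auto
    also have "\<dots> = sum ?q (?D \<times> ?D)"
      by (rule sum.group) (use finD N in auto)
    also have "\<dots> = Q_coord G (Q_idem G X) Z * Q_coord G (Q_idem G Y) Z"
      unfolding Q_coord_def by (simp add: sum_product sum.cartesian_product)
    also have "\<dots> = (if Z = X \<and> Z = Y then 1 else 0)"
      using fin X Z by (simp add: Q_coord_Q_idem)
    finally show ?thesis .
  qed
  ultimately have "p = (\<lambda>W. \<Sum>Z\<in>?N. (if Z = X \<and> Z = Y then 1 else 0) * Q_idem G Z W)"
    by (simp cong: sum.cong)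
  also have "\<dots> = (\<lambda>W. \<Sum>Z\<in>?N. if Z = X then (if X = Y then Q_idem G X W else 0) else 0)"
    by (intro ext sum.cong) auto
  finally show ?thesis
    using X finite_nesubsets[OF fin] unfolding p_def by (auto simp: fun_eq_iff)
qed

lemma B_act_Q_idem:
  assumes "finite (carrier G)" "X \<in> nesubsets G"
  shows "B_act G g (Q_idem G X) = (Q_idem G (g <#\<^bsub>G\<^esub> X) :: _ \<Rightarrow> 'k::field)"
proof
  fix Y
  have "B_act G g (Q_idem G X) Y
      = (\<Sum>Z\<in>nesubsets G. if Z = X then Q_idem G (g <#\<^bsub>G\<^esub> X) Y else (0 :: 'k))"
    unfolding B_act_def by (rule sum.cong) (use assms in \<open>auto simp: Q_coord_Q_idem\<close>)
  then show "B_act G g (Q_idem G X) Y = (Q_idem G (g <#\<^bsub>G\<^esub> X) Y :: 'k)"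
    using assms finite_nesubsets[OF assms(1)] by simp
qed

lemma lin_maps_zero:
  assumes "module scalars V" "module scalars W" "f \<in> lin_maps V W"
  shows "f \<zero>\<^bsub>V\<^esub> = \<zero>\<^bsub>W\<^esub>"
proof -
  interpret V: module scalars V by fact
  interpret W: module scalars W by fact
  have "f (0 \<odot>\<^bsub>V\<^esub> \<zero>\<^bsub>V\<^esub>) = 0 \<odot>\<^bsub>W\<^esub> f \<zero>\<^bsub>V\<^esub>" "f \<zero>\<^bsub>V\<^esub> \<in> carrier W"
    using assms(3) V.zero_closed unfolding lin_maps_def by blast+
  then show ?thesis
    using V.smult_l_null[of "\<zero>\<^bsub>V\<^esub>"] W.smult_l_null[of "f \<zero>\<^bsub>V\<^esub>"] by simp
qed

lemma scalars_field: "field (scalars :: 'k::field ring)"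
proof (rule cring.cring_fieldI)
  show "cring (scalars :: 'k ring)"
    by (rule cringI, rule abelian_groupI, unfold_locales)
       (auto simp: algebra_simps intro: exI[of _ "- _"])
  show "Units (scalars :: 'k ring) = carrier scalars - {\<zero>\<^bsub>scalars\<^esub>}"
    by (auto simp: Units_def) (metis left_inverse mult.commute)
qed

lemma module_scalarsI:
  assumes "abelian_group V"
    and "\<And>c v. v \<in> carrier V \<Longrightarrow> c \<odot>\<^bsub>V\<^esub> v \<in> carrier V"
    and "\<And>c d v. v \<in> carrier V \<Longrightarrow> (c + d) \<odot>\<^bsub>V\<^esub> v = c \<odot>\<^bsub>V\<^esub> v \<oplus>\<^bsub>V\<^esub> d \<odot>\<^bsub>V\<^esub> v"
    and "\<And>c v w. v \<in> carrier V \<Longrightarrow> w \<in> carrier V \<Longrightarrow> c \<odot>\<^bsub>V\<^esub> (v \<oplus>\<^bsub>V\<^esub> w) = c \<odot>\<^bsub>V\<^esub> v \<oplus>\<^bsub>V\<^esub> c \<odot>\<^bsub>V\<^esub> w"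
    and "\<And>c d v. v \<in> carrier V \<Longrightarrow> (c * d) \<odot>\<^bsub>V\<^esub> v = c \<odot>\<^bsub>V\<^esub> (d \<odot>\<^bsub>V\<^esub> v)"
    and "\<And>v. v \<in> carrier V \<Longrightarrow> 1 \<odot>\<^bsub>V\<^esub> v = v"
  shows "module scalars V"
proof -
  interpret field scalars by (rule scalars_field)
  show ?thesis
    by (rule moduleI) (use assms is_cring in auto)
qed

lemma tens_kG_module:
  assumes "finite (carrier G)" "module scalars V"
  shows "module scalars (tens_kG G V)"
proof -
  interpret V: module scalars V by fact
  have "1 \<odot>\<^bsub>V\<^esub> v = v" if "v \<in> carrier V" for v
    using V.smult_one[OF that] by simp
  moreover have "abelian_group (tens_kG G V)"
  proof (rule abelian_groupI)
    fix t assume "t \<in> carrier (tens_kG G V)"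
    then show "\<exists>u\<in>carrier (tens_kG G V). u \<oplus>\<^bsub>tens_kG G V\<^esub> t = \<zero>\<^bsub>tens_kG G V\<^esub>"
      using assms(1)
      by (intro bexI[of _ "\<lambda>h\<in>carrier G. \<ominus>\<^bsub>V\<^esub> t h"])
         (auto simp: tens_kG_def PiE_iff V.l_neg)
  qed (use assms in \<open>auto simp: tens_kG_def PiE_iff extensional_def fun_eq_iff V.a_ac\<close>)
  ultimately show ?thesis
    using assms V.smult_l_distr V.smult_r_distr V.smult_assoc1
    by (intro module_scalarsI) (auto simp: tens_kG_def PiE_iff extensional_def fun_eq_iff)
qed

lemma group_alg_module: "module scalars (group_alg G :: ('k::field, 'g \<Rightarrow> 'k) module)"
proof (rule module_scalarsI)
  show "abelian_group (group_alg G :: ('k, 'g \<Rightarrow> 'k) module)"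
  proof (rule abelian_groupI)
    fix x y :: "'g \<Rightarrow> 'k" assume "x \<in> carrier (group_alg G)" "y \<in> carrier (group_alg G)"
    then show "x \<oplus>\<^bsub>group_alg G\<^esub> y \<in> carrier (group_alg G)"
      by (auto simp: group_alg_def span_alg_def subset_iff
               intro: finite_subset[of _ "{h. x h \<noteq> 0} \<union> {h. y h \<noteq> 0}"]) (metis add_0)
  next
    fix x :: "'g \<Rightarrow> 'k" assume "x \<in> carrier (group_alg G)"
    then show "\<exists>y\<in>carrier (group_alg G). y \<oplus>\<^bsub>group_alg G\<^esub> x = \<zero>\<^bsub>group_alg G\<^esub>"
      by (intro bexI[of _ "\<lambda>h. - x h"]) (auto simp: group_alg_def span_alg_def)
  qed (auto simp: group_alg_def span_alg_def algebra_simps)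
  fix c and x :: "'g \<Rightarrow> 'k" assume "x \<in> carrier (group_alg G)"
  then show "c \<odot>\<^bsub>group_alg G\<^esub> x \<in> carrier (group_alg G)"
    by (auto simp: group_alg_def span_alg_def)
qed (auto simp: group_alg_def span_alg_def algebra_simps)

lemma tens_closed:
  assumes "finite (carrier G)" "module scalars V" "v \<in> carrier V"
  shows "tens G V v x \<in> carrier (tens_kG G V)"
proof -
  interpret V: module scalars V by fact
  show ?thesis using assms by (auto simp: tens_kG_def tens_def)
qed

lemma lin_maps_tens_expand:
  assumes fin: "finite (carrier G)" and V: "module scalars V" and W: "module scalars W"
    and F: "F \<in> lin_maps (tens_kG G V) W" and S: "finite S" "S \<subseteq> carrier G"
    and t: "t \<in> carrier (tens_kG G V)" "\<And>h. h \<in> carrier G - S \<Longrightarrow> t h = \<zero>\<^bsub>V\<^esub>"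
  shows "F t = (\<Oplus>\<^bsub>W\<^esub>h\<in>S. F (tens G V (t h) (ind h)))"
proof -
  interpret V: module scalars V by fact
  interpret W: module scalars W by fact
  have Fc: "F u \<in> carrier W" if "u \<in> carrier (tens_kG G V)" for u
    using F that by (auto simp: lin_maps_def)
  show ?thesis
    using S t
  proof (induction S arbitrary: t rule: finite_induct)
    case empty
    then have "t = \<zero>\<^bsub>tens_kG G V\<^esub>" by (auto simp: tens_kG_def PiE_iff extensional_def)
    with lin_maps_zero[OF tens_kG_module[OF fin V] W F] show ?case by simp
  next
    case (insert h S)
    let ?t = "\<lambda>l\<in>carrier G. if l = h then \<zero>\<^bsub>V\<^esub> else t l"
    have tc: "t l \<in> carrier V" if "l \<in> carrier G" for l
      using insert.prems(2) that by (auto simp: tens_kG_def)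
    have h: "h \<in> carrier G" using insert.prems by auto
    have t': "?t \<in> carrier (tens_kG G V)"
      using tc fin by (auto simp: tens_kG_def)
    have sum: "t = tens G V (t h) (ind h) \<oplus>\<^bsub>tens_kG G V\<^esub> ?t"
      using insert.prems(2) tc h V
      by (auto simp: tens_ind fun_eq_iff tens_kG_def PiE_iff extensional_def)
    have th: "tens G V (t h) (ind h) \<in> carrier (tens_kG G V)"
      by (rule tens_closed[OF fin V tc[OF h]])
    have "F (tens G V (t h) (ind h) \<oplus>\<^bsub>tens_kG G V\<^esub> ?t) = F (tens G V (t h) (ind h)) \<oplus>\<^bsub>W\<^esub> F ?t"
      using F th t' by (auto simp: lin_maps_def)
    then have "F t = F (tens G V (t h) (ind h)) \<oplus>\<^bsub>W\<^esub> F ?t"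
      using sum by simp
    also have "F ?t = (\<Oplus>\<^bsub>W\<^esub>l\<in>S. F (tens G V (?t l) (ind l)))"
      by (rule insert.IH[OF _ t']) (use insert.prems in auto)
    also have "\<dots> = (\<Oplus>\<^bsub>W\<^esub>l\<in>S. F (tens G V (t l) (ind l)))"
    proof (rule W.finsum_cong')
      show "(\<lambda>l. F (tens G V (t l) (ind l))) \<in> S \<rightarrow> carrier W"
        using insert.prems tc by (auto intro!: Fc tens_closed fin V)
      fix l assume "l \<in> S"
      then show "F (tens G V (?t l) (ind l)) = F (tens G V (t l) (ind l))"
        using insert by auto
    qed simp
    also have "F (tens G V (t h) (ind h)) \<oplus>\<^bsub>W\<^esub> \<dots> = (\<Oplus>\<^bsub>W\<^esub>l\<in>insert h S. F (tens G V (t l) (ind l)))"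
      by (rule W.finsum_insert[symmetric])
         (use insert tc in \<open>auto intro!: Fc tens_closed fin V\<close>)
    finally show ?case .
  qed
qed

lemma lin_maps_kG_expand:
  fixes x :: "'g \<Rightarrow> 'k::field"
  assumes W: "module scalars W"
    and f: "f \<in> lin_maps (group_alg G) W" and S: "finite S" "S \<subseteq> carrier G"
    and x: "\<And>h. h \<notin> S \<Longrightarrow> x h = 0"
  shows "f x = (\<Oplus>\<^bsub>W\<^esub>h\<in>S. x h \<odot>\<^bsub>W\<^esub> f (ind h))"
proof -
  interpret W: module scalars W by fact
  have ic: "(ind h :: 'g \<Rightarrow> 'k) \<in> carrier (group_alg G)" if "h \<in> carrier G" for h
    using that by (auto simp: group_alg_def span_alg_def ind_def)
  have fc: "f y \<in> carrier W" if "y \<in> carrier (group_alg G)" for y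
    using f that by (auto simp: lin_maps_def)
  have sc: "c \<odot>\<^bsub>W\<^esub> w \<in> carrier W" if "w \<in> carrier W" for c w
    using W.smult_closed[of c w] that by simp
  show ?thesis
    using S x
  proof (induction S arbitrary: x rule: finite_induct)
    case empty
    then have "x = \<zero>\<^bsub>group_alg G\<^esub>" by (auto simp: group_alg_def span_alg_def)
    with lin_maps_zero[OF group_alg_module W f] show ?case by simp
  next
    case (insert h S)
    let ?x = "\<lambda>l. if l = h then 0 else x l"
    have h: "h \<in> carrier G" using insert.prems by auto
    have x': "?x \<in> carrier (group_alg G)"
      using insert.prems insert.hyps
      by (auto simp: group_alg_def span_alg_def intro: finite_subset[of _ S])
    have sum: "x = (x h \<odot>\<^bsub>group_alg G\<^esub> ind h) \<oplus>\<^bsub>group_alg G\<^esub> ?x"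
      by (auto simp: group_alg_def span_alg_def ind_def)
    have xh: "x h \<odot>\<^bsub>group_alg G\<^esub> ind h \<in> carrier (group_alg G)"
      using module.smult_closed[OF group_alg_module, of "x h" "ind h"] ic[OF h] by simp
    have "f (x h \<odot>\<^bsub>group_alg G\<^esub> ind h \<oplus>\<^bsub>group_alg G\<^esub> ?x) = x h \<odot>\<^bsub>W\<^esub> f (ind h) \<oplus>\<^bsub>W\<^esub> f ?x"
      using f xh x' ic[OF h] by (auto simp: lin_maps_def)
    then have "f x = x h \<odot>\<^bsub>W\<^esub> f (ind h) \<oplus>\<^bsub>W\<^esub> f ?x"
      using sum by simp
    also have "f ?x = (\<Oplus>\<^bsub>W\<^esub>l\<in>S. ?x l \<odot>\<^bsub>W\<^esub> f (ind l))"
      by (rule insert.IH) (use insert.prems in auto)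
    also have "\<dots> = (\<Oplus>\<^bsub>W\<^esub>l\<in>S. x l \<odot>\<^bsub>W\<^esub> f (ind l))"
      by (rule W.finsum_cong') (use insert ic fc sc in \<open>auto simp: subset_iff\<close>)
    also have "x h \<odot>\<^bsub>W\<^esub> f (ind h) \<oplus>\<^bsub>W\<^esub> \<dots> = (\<Oplus>\<^bsub>W\<^esub>l\<in>insert h S. x l \<odot>\<^bsub>W\<^esub> f (ind l))"
      by (rule W.finsum_insert[symmetric]) (use insert ic fc sc in \<open>auto simp: subset_iff\<close>)
    finally show ?case .
  qed
qed

lemma tens_kG_universal:
  fixes G :: "('g, 'm) monoid_scheme" and V :: "('k::field, 'v) module" and W :: "('k, 'w) module"
  assumes fin: "finite (carrier G)" and V: "module scalars V" and W: "module scalars W"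
    and clo: "\<And>v x. v \<in> carrier V \<Longrightarrow> x \<in> carrier (group_alg G) \<Longrightarrow> \<beta> v x \<in> carrier W"
    and lin1: "\<And>x. x \<in> carrier (group_alg G) \<Longrightarrow> restrict (\<lambda>v. \<beta> v x) (carrier V) \<in> lin_maps V W"
    and lin2: "\<And>v. v \<in> carrier V \<Longrightarrow> restrict (\<beta> v) (carrier (group_alg G)) \<in> lin_maps (group_alg G) W"
  shows "\<exists>!F. F \<in> lin_maps (tens_kG G V) W \<and>
     (\<forall>v\<in>carrier V. \<forall>x\<in>carrier (group_alg G). F (tens G V v x) = \<beta> v x)"
proof
  interpret V: module scalars V by fact
  interpret W: module scalars W by fact
  let ?T = "tens_kG G V"
  interpret T: module scalars ?T by (rule tens_kG_module[OF fin V])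
  have ic: "(ind h :: 'g \<Rightarrow> 'k) \<in> carrier (group_alg G)" if "h \<in> carrier G" for h
    using that by (auto simp: group_alg_def span_alg_def ind_def)
  have tc: "t h \<in> carrier V" if "t \<in> carrier ?T" "h \<in> carrier G" for t h
    using that by (auto simp: tens_kG_def)
  have sc: "c \<odot>\<^bsub>W\<^esub> w \<in> carrier W" if "w \<in> carrier W" for c w
    using W.smult_closed[of c w] that by simp
  define F where "F = (\<lambda>t\<in>carrier ?T. \<Oplus>\<^bsub>W\<^esub>h\<in>carrier G. \<beta> (t h) (ind h))"
  have bc: "(\<lambda>h. \<beta> (t h) (ind h)) \<in> carrier G \<rightarrow> carrier W" if "t \<in> carrier ?T" for t
    using that by (auto intro!: clo ic tc)
  have badd: "\<beta> (v \<oplus>\<^bsub>V\<^esub> w) x = \<beta> v x \<oplus>\<^bsub>W\<^esub> \<beta> w x"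
    if "v \<in> carrier V" "w \<in> carrier V" "x \<in> carrier (group_alg G)" for v w x
    using lin1[OF that(3)] that by (auto simp: lin_maps_def)
  have bsc: "\<beta> (c \<odot>\<^bsub>V\<^esub> v) x = c \<odot>\<^bsub>W\<^esub> \<beta> v x"
    if "v \<in> carrier V" "x \<in> carrier (group_alg G)" for v x c
    using lin1[OF that(2)] that V.smult_closed[of c v] by (auto simp: lin_maps_def)
  have Flin: "F \<in> lin_maps ?T W"
    unfolding lin_maps_def
  proof (intro CollectI conjI ballI allI)
    show "F \<in> carrier ?T \<rightarrow>\<^sub>E carrier W"
      using bc W.finsum_closed by (auto simp: F_def)
  next
    fix s t assume st: "s \<in> carrier ?T" "t \<in> carrier ?T"
    have "F (s \<oplus>\<^bsub>?T\<^esub> t) = (\<Oplus>\<^bsub>W\<^esub>h\<in>carrier G. \<beta> ((s \<oplus>\<^bsub>?T\<^esub> t) h) (ind h))"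
      using T.a_closed[OF st] by (simp add: F_def)
    also have "\<dots> = (\<Oplus>\<^bsub>W\<^esub>h\<in>carrier G. \<beta> (s h) (ind h) \<oplus>\<^bsub>W\<^esub> \<beta> (t h) (ind h))"
      by (rule W.finsum_cong')
         (use st bc[OF st(1)] bc[OF st(2)] badd tc[OF st(1)] tc[OF st(2)] ic in \<open>auto simp: tens_kG_def Pi_iff\<close>)
    also have "\<dots> = F s \<oplus>\<^bsub>W\<^esub> F t"
      using st bc by (simp add: F_def W.finsum_addf)
    finally show "F (s \<oplus>\<^bsub>?T\<^esub> t) = F s \<oplus>\<^bsub>W\<^esub> F t" .
  next
    fix c t assume t: "t \<in> carrier ?T"
    have "F (c \<odot>\<^bsub>?T\<^esub> t) = (\<Oplus>\<^bsub>W\<^esub>h\<in>carrier G. \<beta> ((c \<odot>\<^bsub>?T\<^esub> t) h) (ind h))"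
      using T.smult_closed[of c t] t by (simp add: F_def)
    also have "\<dots> = (\<Oplus>\<^bsub>W\<^esub>h\<in>carrier G. c \<odot>\<^bsub>W\<^esub> \<beta> (t h) (ind h))"
      by (rule W.finsum_cong')
         (use t bc[OF t] bsc tc[OF t] ic sc in \<open>auto simp: tens_kG_def Pi_iff\<close>)
    also have "\<dots> = c \<odot>\<^bsub>W\<^esub> F t"
      using W.finsum_smult_ldistr[OF fin _ bc[OF t], of c] t by (simp add: F_def)
    finally show "F (c \<odot>\<^bsub>?T\<^esub> t) = c \<odot>\<^bsub>W\<^esub> F t" .
  qed
  have Ftens: "F (tens G V v x) = \<beta> v x" if v: "v \<in> carrier V" and x: "x \<in> carrier (group_alg G)" for v x
  proof -
    have "F (tens G V v x) = (\<Oplus>\<^bsub>W\<^esub>h\<in>carrier G. \<beta> (tens G V v x h) (ind h))"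
      using tens_closed[OF fin V v] by (simp add: F_def)
    also have "\<dots> = (\<Oplus>\<^bsub>W\<^esub>h\<in>carrier G. x h \<odot>\<^bsub>W\<^esub> \<beta> v (ind h))"
      by (rule W.finsum_cong') (use v bsc ic clo sc in \<open>auto simp: tens_def\<close>)
    also have "\<dots> = (\<Oplus>\<^bsub>W\<^esub>h\<in>carrier G. x h \<odot>\<^bsub>W\<^esub> restrict (\<beta> v) (carrier (group_alg G)) (ind h))"
      by (rule W.finsum_cong') (use v ic clo sc in auto)
    also have "\<dots> = restrict (\<beta> v) (carrier (group_alg G)) x"
      by (rule lin_maps_kG_expand[OF W lin2[OF v] fin, symmetric])
         (use x in \<open>auto simp: group_alg_def span_alg_def\<close>)
    finally show ?thesis using x by simp
  qed
  show "F \<in> lin_maps ?T W \<and> (\<forall>v\<in>carrier V. \<forall>x\<in>carrier (group_alg G). F (tens G V v x) = \<beta> v x)"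
    using Flin Ftens by blast
  fix F' assume F': "F' \<in> lin_maps ?T W \<and> (\<forall>v\<in>carrier V. \<forall>x\<in>carrier (group_alg G). F' (tens G V v x) = \<beta> v x)"
  have "F' t = F t" if t: "t \<in> carrier ?T" for t
  proof -
    have "F' t = (\<Oplus>\<^bsub>W\<^esub>h\<in>carrier G. F' (tens G V (t h) (ind h)))"
      by (rule lin_maps_tens_expand[OF fin V W _ fin _ t]) (use F' in auto)
    also have "\<dots> = (\<Oplus>\<^bsub>W\<^esub>h\<in>carrier G. \<beta> (t h) (ind h))"
      by (rule W.finsum_cong') (use bc[OF t] F' tc[OF t] ic in auto)
    finally show ?thesis using t by (simp add: F_def)
  qed
  then show "F' = F"
    using F' Flin
    by (intro extensionalityI[of _ "carrier ?T"]) (auto simp: lin_maps_def PiE_def)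
qed

lemma diag_act_partial_module:
  fixes G (structure)
  assumes "group G" and fin: "finite (carrier G)" and P: "partial_module G V act"
  shows "partial_module G (tens_kG G V) (diag_act G act)"
proof -
  interpret group G by fact
  have V: "module scalars V" using P by (simp add: partial_module_def)
  interpret V: module scalars V by (rule V)
  have lin: "restrict (act g) (carrier V) \<in> lin_maps V V" if "g \<in> carrier G" for g
    using P that unfolding partial_module_def by blast
  have ac: "act g v \<in> carrier V" if "g \<in> carrier G" "v \<in> carrier V" for g v
  proof -
    have "restrict (act g) (carrier V) \<in> carrier V \<rightarrow>\<^sub>E carrier V"
      using lin[OF that(1)] unfolding lin_maps_def by blast
    from PiE_mem[OF this that(2)] show ?thesis using that(2) by simp
  qed
  have sc: "c \<odot>\<^bsub>V\<^esub> v \<in> carrier V" if "v \<in> carrier V" for c v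
    using V.smult_closed[of c v] that by simp
  have aa: "act g (v \<oplus>\<^bsub>V\<^esub> w) = act g v \<oplus>\<^bsub>V\<^esub> act g w"
    if "g \<in> carrier G" "v \<in> carrier V" "w \<in> carrier V" for g v w
    using lin[OF that(1)] that V.a_closed[OF that(2,3)] by (simp add: lin_maps_def)
  have as: "act g (c \<odot>\<^bsub>V\<^esub> v) = c \<odot>\<^bsub>V\<^esub> act g v" if "g \<in> carrier G" "v \<in> carrier V" for g v c
    using lin[OF that(1)] that sc[OF that(2)] by (simp add: lin_maps_def)
  have a1: "act \<one> v = v" if "v \<in> carrier V" for v
    using P that unfolding partial_module_def by blast
  have r1: "act g (act h (act (inv h) v)) = act (g \<otimes> h) (act (inv h) v)"
    and r2: "act (inv g) (act g (act h v)) = act (inv g) (act (g \<otimes> h) v)"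
    if "g \<in> carrier G" "h \<in> carrier G" "v \<in> carrier V" for g h v
    using P that unfolding partial_module_def by blast+
  have e: "inv h \<otimes> (inv g \<otimes> l) = inv (g \<otimes> h) \<otimes> l"
    if "g \<in> carrier G" "h \<in> carrier G" "l \<in> carrier G" for g h l
    using that by (simp add: inv_mult_group m_assoc)
  have tc: "t l \<in> carrier V" if "t \<in> carrier (tens_kG G V)" "l \<in> carrier G" for t l
    using that by (auto simp: tens_kG_def)
  have dc: "diag_act G act g t \<in> carrier (tens_kG G V)"
    if "t \<in> carrier (tens_kG G V)" "g \<in> carrier G" for g t
    using that fin tc[OF that(1)] ac by (auto simp: diag_act_def tens_kG_def)
  have da: "diag_act G act g t l = act g (t (inv g \<otimes> l))" if "l \<in> carrier G" for g t l
    using that by (simp add: diag_act_def)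
  have ext: "s = t" if "s \<in> carrier (tens_kG G V)" "t \<in> carrier (tens_kG G V)"
    "\<And>l. l \<in> carrier G \<Longrightarrow> s l = t l" for s t
    by (rule PiE_ext[of _ "carrier G" "\<lambda>_. carrier V"]) (use that in \<open>auto simp: tens_kG_def\<close>)
  interpret T: module scalars "tens_kG G V" by (rule tens_kG_module[OF fin V])
  have Tsc: "c \<odot>\<^bsub>tens_kG G V\<^esub> t \<in> carrier (tens_kG G V)" if "t \<in> carrier (tens_kG G V)" for c t
    using T.smult_closed[of c t] that by simp
  have Ta: "(s \<oplus>\<^bsub>tens_kG G V\<^esub> t) l = s l \<oplus>\<^bsub>V\<^esub> t l" "(c \<odot>\<^bsub>tens_kG G V\<^esub> t) l = c \<odot>\<^bsub>V\<^esub> t l"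
    if "l \<in> carrier G" for s t c l
    using that by (simp_all add: tens_kG_def)
  show ?thesis
    unfolding partial_module_def
  proof (intro conjI ballI)
    show "module scalars (tens_kG G V)" by (rule tens_kG_module[OF fin V])
  next
    fix g assume g: "g \<in> carrier G"
    show "restrict (diag_act G act g) (carrier (tens_kG G V)) \<in> lin_maps (tens_kG G V) (tens_kG G V)"
      unfolding lin_maps_def
    proof (intro CollectI conjI ballI allI)
      fix s t assume st: "s \<in> carrier (tens_kG G V)" "t \<in> carrier (tens_kG G V)"
      have "diag_act G act g (s \<oplus>\<^bsub>tens_kG G V\<^esub> t) = diag_act G act g s \<oplus>\<^bsub>tens_kG G V\<^esub> diag_act G act g t"
        by (rule ext) (use st g in \<open>simp_all add: dc da Ta aa tc\<close>)
      then show "restrict (diag_act G act g) (carrier (tens_kG G V)) (s \<oplus>\<^bsub>tens_kG G V\<^esub> t) =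
          restrict (diag_act G act g) (carrier (tens_kG G V)) s \<oplus>\<^bsub>tens_kG G V\<^esub>
          restrict (diag_act G act g) (carrier (tens_kG G V)) t"
        using st by simp
    next
      fix c t assume t: "t \<in> carrier (tens_kG G V)"
      have "diag_act G act g (c \<odot>\<^bsub>tens_kG G V\<^esub> t) = c \<odot>\<^bsub>tens_kG G V\<^esub> diag_act G act g t"
        by (rule ext) (use t g in \<open>simp_all add: dc da Ta as tc Tsc\<close>)
      then show "restrict (diag_act G act g) (carrier (tens_kG G V)) (c \<odot>\<^bsub>tens_kG G V\<^esub> t) =
          c \<odot>\<^bsub>tens_kG G V\<^esub> restrict (diag_act G act g) (carrier (tens_kG G V)) t"
        using t Tsc by simp
    qed (use g in \<open>auto simp: dc\<close>)
  next
    fix t assume t: "t \<in> carrier (tens_kG G V)"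
    show "diag_act G act \<one> t = t"
      by (rule ext) (use t in \<open>simp_all add: dc da a1 tc\<close>)
  next
    fix g h t assume gh: "g \<in> carrier G" "h \<in> carrier G" and t: "t \<in> carrier (tens_kG G V)"
    show "diag_act G act g (diag_act G act h (diag_act G act (inv h) t)) =
          diag_act G act (g \<otimes> h) (diag_act G act (inv h) t)"
      by (rule ext) (use gh t in \<open>simp_all add: dc da e r1 tc del: inv_inv\<close>)
    show "diag_act G act (inv g) (diag_act G act g (diag_act G act h t)) =
          diag_act G act (inv g) (diag_act G act (g \<otimes> h) t)"
      by (rule ext) (use gh t in \<open>simp_all add: dc da e r2 tc del: inv_inv\<close>)
  qed
qed

end

theory Submission
  imports Defs
begin

text \<open>
  Each of the three \<open>kG\<close>-module algebras is the algebra of all functions on the set of nonempty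
  subsets of \<open>G\<close>, with \<open>G\<close> acting by translation, and for that algebra \<open>Q\<^sub>X # g \<leftrightarrow> (g, g\<^sup>-\<^sup>1X)\<close>
  identifies the smash product with the groupoid algebra.

  For \<open>\<B>(G)\<close> this is the basis of the \<open>Q\<^sub>X\<close>. The algebra \<open>A\<^sub>p\<^sub>a\<^sub>r\<close> has a basis of
  orthogonal idempotents \<open>P\<^sub>A\<close>, indexed by the subsets \<open>A\<close> containing \<open>e\<close>, with
  \<open>\<epsilon>\<^sub>g P\<^sub>A = [g \<in> A] P\<^sub>A\<close>; in these coordinates \<open>(g \<bullet> c)(A) = [g \<in> A] c(g\<^sup>-\<^sup>1A)\<close>. Both an
  element of the standard globalization, as \<open>u\<^sub>h = f(h)\<close>, and a morphism \<open>f\<close> in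
  \<open>{A\<^sub>p\<^sub>a\<^sub>r, A\<^sub>p\<^sub>a\<^sub>r}\<close>, as \<open>u\<^sub>h = f(1 \<otimes> h)\<close>, amount to a family with
  \<open>g \<bullet> u\<^sub>h = \<epsilon>\<^sub>g u\<^bsub>gh\<^esub>\<close>. In coordinates this says that \<open>u\<^sub>h(A)\<close> depends only on
  \<open>h\<^sup>-\<^sup>1A\<close>, so that \<open>u\<^sub>h(A) = c(h\<^sup>-\<^sup>1A)\<close> for a unique function \<open>c\<close> on the nonempty subsets.
\<close>

section \<open>Algebra isomorphisms, and algebras with a multiplicative basis\<close>

text \<open>The obstacle is that \<open>k_par\<close> is a quotient of a free algebra: its relations
  give identities, but never show that an element is nonzero. Everything about \<open>A_par\<close>
  except the linear independence of the idempotents is therefore derived from the relations in an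
  arbitrary algebra (\<open>partial_rep\<close>); independence comes from a concrete module on which
  each idempotent acts nontrivially.

  The indexing sets contain the neutral element because its idempotent is 1, which forces
  \<open>P\<^sub>A = 0\<close> for all other A. Globalizing drops the condition: a nonempty X
  becomes pointed after translation by the inverse of any of its elements, whereas no translate of
  the empty set is pointed.

  In \<open>Q\<^sub>X # g\<close> the factor \<open>Q\<^sub>X\<close> selects the arrows that end at
  X, and the one with group component g starts at \<open>g\<^sup>-\<^sup>1X\<close>; hence the
  pairing with \<open>(g, g\<^sup>-\<^sup>1X)\<close>.

  The isomorphisms are not built along the chain. Each smash product is compared with
  \<open>k_glob\<close>, so that the product is computed only once, and its algebra axioms are
  inherited along the comparison map.\<close>

definition alg_onto :: "('k::field, 'a) module \<Rightarrow> ('k, 'b) module \<Rightarrow> ('a \<Rightarrow> 'b) \<Rightarrow> bool" where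
  "alg_onto R S h \<longleftrightarrow> h ` carrier R = carrier S \<and> h \<one>\<^bsub>R\<^esub> = \<one>\<^bsub>S\<^esub> \<and> h \<zero>\<^bsub>R\<^esub> = \<zero>\<^bsub>S\<^esub> \<and>
     (\<forall>x\<in>carrier R. \<forall>y\<in>carrier R. h (x \<otimes>\<^bsub>R\<^esub> y) = h x \<otimes>\<^bsub>S\<^esub> h y \<and> h (x \<oplus>\<^bsub>R\<^esub> y) = h x \<oplus>\<^bsub>S\<^esub> h y) \<and>
     (\<forall>c. \<forall>x\<in>carrier R. h (c \<odot>\<^bsub>R\<^esub> x) = c \<odot>\<^bsub>S\<^esub> h x)"

lemma k_algebra_smult:
  assumes "k_algebra A" "x \<in> carrier A"
  shows "c \<odot>\<^bsub>A\<^esub> x \<in> carrier A"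
    and "(c + d) \<odot>\<^bsub>A\<^esub> x = c \<odot>\<^bsub>A\<^esub> x \<oplus>\<^bsub>A\<^esub> d \<odot>\<^bsub>A\<^esub> x"
    and "y \<in> carrier A \<Longrightarrow> c \<odot>\<^bsub>A\<^esub> (x \<oplus>\<^bsub>A\<^esub> y) = c \<odot>\<^bsub>A\<^esub> x \<oplus>\<^bsub>A\<^esub> c \<odot>\<^bsub>A\<^esub> y"
    and "(c * d) \<odot>\<^bsub>A\<^esub> x = c \<odot>\<^bsub>A\<^esub> (d \<odot>\<^bsub>A\<^esub> x)"
    and "1 \<odot>\<^bsub>A\<^esub> x = x"
    and "0 \<odot>\<^bsub>A\<^esub> x = \<zero>\<^bsub>A\<^esub>"
    and "y \<in> carrier A \<Longrightarrow> (c \<odot>\<^bsub>A\<^esub> x) \<otimes>\<^bsub>A\<^esub> y = c \<odot>\<^bsub>A\<^esub> (x \<otimes>\<^bsub>A\<^esub> y)"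
    and "y \<in> carrier A \<Longrightarrow> x \<otimes>\<^bsub>A\<^esub> (c \<odot>\<^bsub>A\<^esub> y) = c \<odot>\<^bsub>A\<^esub> (x \<otimes>\<^bsub>A\<^esub> y)"
    and "c \<odot>\<^bsub>A\<^esub> \<zero>\<^bsub>A\<^esub> = \<zero>\<^bsub>A\<^esub>"
proof -
  interpret module scalars A using assms(1) by (simp add: k_algebra_def)
  show "c \<odot>\<^bsub>A\<^esub> x \<in> carrier A" "(c + d) \<odot>\<^bsub>A\<^esub> x = c \<odot>\<^bsub>A\<^esub> x \<oplus>\<^bsub>A\<^esub> d \<odot>\<^bsub>A\<^esub> x"
    "y \<in> carrier A \<Longrightarrow> c \<odot>\<^bsub>A\<^esub> (x \<oplus>\<^bsub>A\<^esub> y) = c \<odot>\<^bsub>A\<^esub> x \<oplus>\<^bsub>A\<^esub> c \<odot>\<^bsub>A\<^esub> y"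
    "(c * d) \<odot>\<^bsub>A\<^esub> x = c \<odot>\<^bsub>A\<^esub> (d \<odot>\<^bsub>A\<^esub> x)" "1 \<odot>\<^bsub>A\<^esub> x = x" "0 \<odot>\<^bsub>A\<^esub> x = \<zero>\<^bsub>A\<^esub>" "c \<odot>\<^bsub>A\<^esub> \<zero>\<^bsub>A\<^esub> = \<zero>\<^bsub>A\<^esub>"
    using smult_closed[of c x] smult_l_distr[of c d x] smult_r_distr[of c x y] smult_assoc1[of c d x]
      smult_one[of x] smult_l_null[of x] smult_r_null[of c] assms(2) by simp_all
  show "y \<in> carrier A \<Longrightarrow> (c \<odot>\<^bsub>A\<^esub> x) \<otimes>\<^bsub>A\<^esub> y = c \<odot>\<^bsub>A\<^esub> (x \<otimes>\<^bsub>A\<^esub> y)"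
    "y \<in> carrier A \<Longrightarrow> x \<otimes>\<^bsub>A\<^esub> (c \<odot>\<^bsub>A\<^esub> y) = c \<odot>\<^bsub>A\<^esub> (x \<otimes>\<^bsub>A\<^esub> y)"
    using assms by (auto simp: k_algebra_def)
qed

lemma k_algebra_ring: "k_algebra A \<Longrightarrow> ring A"
  and k_algebra_module: "k_algebra A \<Longrightarrow> module scalars A"
  by (simp_all add: k_algebra_def)

lemma k_algebraI:
  fixes A :: "('k::field, 'a) module"
  assumes "ring A"
    and "\<And>c v. v \<in> carrier A \<Longrightarrow> c \<odot>\<^bsub>A\<^esub> v \<in> carrier A"
    and "\<And>c d v. v \<in> carrier A \<Longrightarrow> (c + d) \<odot>\<^bsub>A\<^esub> v = c \<odot>\<^bsub>A\<^esub> v \<oplus>\<^bsub>A\<^esub> d \<odot>\<^bsub>A\<^esub> v"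
    and "\<And>c v w. v \<in> carrier A \<Longrightarrow> w \<in> carrier A \<Longrightarrow> c \<odot>\<^bsub>A\<^esub> (v \<oplus>\<^bsub>A\<^esub> w) = c \<odot>\<^bsub>A\<^esub> v \<oplus>\<^bsub>A\<^esub> c \<odot>\<^bsub>A\<^esub> w"
    and "\<And>c d v. v \<in> carrier A \<Longrightarrow> (c * d) \<odot>\<^bsub>A\<^esub> v = c \<odot>\<^bsub>A\<^esub> (d \<odot>\<^bsub>A\<^esub> v)"
    and "\<And>v. v \<in> carrier A \<Longrightarrow> 1 \<odot>\<^bsub>A\<^esub> v = v"
    and "\<And>c v w. v \<in> carrier A \<Longrightarrow> w \<in> carrier A \<Longrightarrow> (c \<odot>\<^bsub>A\<^esub> v) \<otimes>\<^bsub>A\<^esub> w = c \<odot>\<^bsub>A\<^esub> (v \<otimes>\<^bsub>A\<^esub> w)"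
    and "\<And>c v w. v \<in> carrier A \<Longrightarrow> w \<in> carrier A \<Longrightarrow> v \<otimes>\<^bsub>A\<^esub> (c \<odot>\<^bsub>A\<^esub> w) = c \<odot>\<^bsub>A\<^esub> (v \<otimes>\<^bsub>A\<^esub> w)"
  shows "k_algebra A"
proof -
  interpret ring A by fact
  have "module scalars A" by (rule module_scalarsI) (use assms is_abelian_group in auto)
  then show ?thesis using assms by (auto simp: k_algebra_def)
qed

text \<open>All axioms except the existence of negatives are equations between elements, so they
  pass to any surjective image.\<close>

lemma k_algebra_image:
  assumes R: "k_algebra R" and h: "alg_onto R S h"
  shows "k_algebra S"
proof -
  interpret R: ring R by (rule k_algebra_ring[OF R])
  note h' = h[unfolded alg_onto_def]
  have im: "\<exists>x\<in>carrier R. y = h x" if "y \<in> carrier S" for y using h' that by blast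
  have hc: "h x \<in> carrier S" if "x \<in> carrier R" for x using h' that by blast
  have hm: "h x \<otimes>\<^bsub>S\<^esub> h y = h (x \<otimes>\<^bsub>R\<^esub> y)" and ha: "h x \<oplus>\<^bsub>S\<^esub> h y = h (x \<oplus>\<^bsub>R\<^esub> y)"
    if "x \<in> carrier R" "y \<in> carrier R" for x y using h' that by metis+
  have hs: "c \<odot>\<^bsub>S\<^esub> h x = h (c \<odot>\<^bsub>R\<^esub> x)" if "x \<in> carrier R" for c x using h' that by metis
  have h1: "\<one>\<^bsub>S\<^esub> = h \<one>\<^bsub>R\<^esub>" and h0: "\<zero>\<^bsub>S\<^esub> = h \<zero>\<^bsub>R\<^esub>" using h' by metis+
  note eqs = hm ha hs h1 h0 hc k_algebra_smult[OF R] R.ring_simprules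
  have "abelian_group S"
  proof (rule abelian_groupI)
    fix y assume "y \<in> carrier S"
    then obtain x where "x \<in> carrier R" "y = h x" using im by blast
    then show "\<exists>z\<in>carrier S. z \<oplus>\<^bsub>S\<^esub> y = \<zero>\<^bsub>S\<^esub>"
      by (intro bexI[of _ "h (\<ominus>\<^bsub>R\<^esub> x)"]) (auto simp: eqs)
  qed (auto dest!: im simp: eqs)
  moreover have "monoid S"
    by (rule monoidI) (auto dest!: im simp: eqs)
  ultimately have "ring S"
    by (rule ringI) (auto dest!: im simp: eqs)
  then show ?thesis
    by (rule k_algebraI) (auto dest!: im simp: eqs)
qed

text \<open>\<open>\<cong>\<^sub>k\<close> asks for both algebra structures. That of the target is
  inherited along the surjection, so no smash product has to be checked for associativity.\<close>

lemma alg_onto_isomorphic: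
  assumes R: "k_algebra R" and h: "alg_onto R S h" and inj: "inj_on h (carrier R)"
  shows "R \<cong>\<^sub>k S"
proof -
  have "h \<in> alg_iso R S"
    using h inj by (auto simp: alg_onto_def alg_iso_def ring_iso_def ring_hom_def bij_betw_def)
  then show ?thesis using R k_algebra_image[OF R h] by (auto simp: alg_isomorphic_def)
qed

lemma alg_isomorphic_refl: "k_algebra R \<Longrightarrow> R \<cong>\<^sub>k R"
  by (rule alg_onto_isomorphic[of _ _ id]) (auto simp: alg_onto_def)

lemma alg_isomorphic_sym:
  assumes "R \<cong>\<^sub>k S" shows "S \<cong>\<^sub>k R"
proof -
  have R: "k_algebra R" and S: "k_algebra S" using assms by (auto simp: alg_isomorphic_def)
  obtain h where h: "h \<in> alg_iso R S" using assms by (auto simp: alg_isomorphic_def)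
  let ?h = "inv_into (carrier R) h"
  have hr: "h \<in> ring_iso R S" and hs: "\<And>c x. x \<in> carrier R \<Longrightarrow> h (c \<odot>\<^bsub>R\<^esub> x) = c \<odot>\<^bsub>S\<^esub> h x"
    using h by (auto simp: alg_iso_def)
  have bij: "bij_betw h (carrier R) (carrier S)" using hr by (simp add: ring_iso_def)
  have "?h \<in> ring_iso S R" by (rule ring_iso_set_sym[OF k_algebra_ring[OF R] hr])
  moreover have "?h (c \<odot>\<^bsub>S\<^esub> y) = c \<odot>\<^bsub>R\<^esub> ?h y" if "y \<in> carrier S" for c y
  proof -
    have "y \<in> h ` carrier R" using that bij by (simp add: bij_betw_imp_surj_on)
    then obtain x where x: "x \<in> carrier R" "y = h x" by blast
    have inj: "inj_on h (carrier R)" using bij by (simp add: bij_betw_def)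
    have "?h (h (c \<odot>\<^bsub>R\<^esub> x)) = c \<odot>\<^bsub>R\<^esub> ?h (h x)"
      by (simp only: inv_into_f_f[OF inj] x(1) k_algebra_smult(1)[OF R x(1)])
    then show ?thesis unfolding hs[OF x(1)] x(2) .
  qed
  ultimately show ?thesis using R S by (auto simp: alg_isomorphic_def alg_iso_def)
qed

lemma alg_isomorphic_trans:
  assumes "R \<cong>\<^sub>k S" "S \<cong>\<^sub>k T" shows "R \<cong>\<^sub>k T"
proof -
  obtain h k where "h \<in> alg_iso R S" "k \<in> alg_iso S T" using assms by (auto simp: alg_isomorphic_def)
  then have "k \<circ> h \<in> alg_iso R T"
    using ring_iso_set_trans[of h R S k T] ring_iso_memE(1)[of h R S]
    by (simp add: alg_iso_def)
  then show ?thesis using assms by (auto simp: alg_isomorphic_def)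
qed

section \<open>Sums over supports and the algebra axioms for a multiplicative basis\<close>

lemma span_alg_carrierI:
  "finite {x. f x \<noteq> 0} \<Longrightarrow> (\<And>x. f x \<noteq> 0 \<Longrightarrow> x \<in> X) \<Longrightarrow> f \<in> carrier (span_alg X m u)"
  by (auto simp: span_alg_def)

text \<open>Exact supports change under addition and scaling. Over arbitrary finite supersets, all
  elements occurring in an identity can share one index set.\<close>

lemma span_alg_mult_apply:
  assumes f: "f \<in> carrier (span_alg X m u)" and f': "f' \<in> carrier (span_alg X m u)"
    and S: "finite S" "{x. f x \<noteq> 0} \<subseteq> S" and S': "finite S'" "{x. f' x \<noteq> 0} \<subseteq> S'"
  shows "(f \<otimes>\<^bsub>span_alg X m u\<^esub> f') z = (\<Sum>x\<in>S. \<Sum>y\<in>S'. if m x y = Some z then f x * f' y else 0)"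
proof -
  have "(f \<otimes>\<^bsub>span_alg X m u\<^esub> f') z = (\<Sum>(x, y)\<in>S \<times> S'. if m x y = Some z then f x * f' y else 0)"
    unfolding span_alg_def
    by simp (rule sum.mono_neutral_cong_left, use S S' in \<open>auto split: if_splits\<close>)
  then show ?thesis by (simp add: sum.cartesian_product)
qed

text \<open>\<open>\<psi>\<close> prescribes a linear functional on the basis, and its value at a
  product is a double sum to which undefined products contribute 0. This serves for associativity,
  for the coordinates with respect to the \<open>Q_idem\<close>, for the action of words, and for
  right multiplication by group elements.\<close>

lemma span_alg_pairing:
  assumes f: "f \<in> carrier (span_alg X m u)" and f': "f' \<in> carrier (span_alg X m u)"
    and S: "finite S" "{x. f x \<noteq> 0} \<subseteq> S" and S': "finite S'" "{x. f' x \<noteq> 0} \<subseteq> S'"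
    and Z: "finite Z" "{z. (f \<otimes>\<^bsub>span_alg X m u\<^esub> f') z \<noteq> 0} \<subseteq> Z"
  shows "(\<Sum>z\<in>Z. (f \<otimes>\<^bsub>span_alg X m u\<^esub> f') z * \<psi> z)
       = (\<Sum>x\<in>S. \<Sum>y\<in>S'. f x * f' y * (case m x y of None \<Rightarrow> 0 | Some z \<Rightarrow> \<psi> z))"
proof -
  let ?p = "f \<otimes>\<^bsub>span_alg X m u\<^esub> f'"
  have p: "?p z = (\<Sum>x\<in>S. \<Sum>y\<in>S'. if m x y = Some z then f x * f' y else 0)" for z
    by (rule span_alg_mult_apply[OF f f' S S'])
  \<comment> \<open>\<open>V\<close> adds to \<open>Z\<close> every product of the two index sets,
    so that the sum over \<open>V\<close> always meets the one \<open>z\<close> with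
    \<open>m x y = Some z\<close>.\<close>
  define V where "V = Z \<union> {z. \<exists>x\<in>S. \<exists>y\<in>S'. m x y = Some z}"
  have "{z. \<exists>x\<in>S. \<exists>y\<in>S'. m x y = Some z} \<subseteq> (\<lambda>(x, y). the (m x y)) ` (S \<times> S')"
    by force
  then have V: "finite V" unfolding V_def using Z(1) S(1) S'(1) by (auto intro: finite_subset)
  have "(\<Sum>z\<in>Z. ?p z * \<psi> z) = (\<Sum>z\<in>V. ?p z * \<psi> z)"
    by (rule sum.mono_neutral_left) (use Z V in \<open>auto simp: V_def\<close>)
  also have "\<dots> = (\<Sum>z\<in>V. \<Sum>x\<in>S. \<Sum>y\<in>S'. if m x y = Some z then f x * f' y * \<psi> z else 0)"
    by (simp add: p sum_distrib_right if_distrib[where f="\<lambda>a. a * _"] cong: if_cong)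
  also have "\<dots> = (\<Sum>x\<in>S. \<Sum>z\<in>V. \<Sum>y\<in>S'. if m x y = Some z then f x * f' y * \<psi> z else 0)"
    by (rule sum.swap)
  also have "\<dots> = (\<Sum>x\<in>S. \<Sum>y\<in>S'. \<Sum>z\<in>V. if m x y = Some z then f x * f' y * \<psi> z else 0)"
    by (intro sum.cong refl sum.swap)
  also have "\<dots> = (\<Sum>x\<in>S. \<Sum>y\<in>S'. f x * f' y * (case m x y of None \<Rightarrow> 0 | Some z \<Rightarrow> \<psi> z))"
  proof (intro sum.cong refl)
    fix x y assume xy: "x \<in> S" "y \<in> S'"
    show "(\<Sum>z\<in>V. if m x y = Some z then f x * f' y * \<psi> z else 0)
        = f x * f' y * (case m x y of None \<Rightarrow> 0 | Some z \<Rightarrow> \<psi> z)"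
    proof (cases "m x y")
      case (Some w)
      then have "w \<in> V" using xy by (auto simp: V_def)
      then show ?thesis using Some V by (simp add: eq_commute[of w])
    qed simp
  qed
  finally show ?thesis .
qed

lemma span_alg_mult_closed:
  assumes m: "\<And>x y z. x \<in> X \<Longrightarrow> y \<in> X \<Longrightarrow> m x y = Some z \<Longrightarrow> z \<in> X"
    and f: "f \<in> carrier (span_alg X m u)" and f': "f' \<in> carrier (span_alg X m u)"
  shows "f \<otimes>\<^bsub>span_alg X m u\<^esub> f' \<in> carrier (span_alg X m u)"
proof -
  let ?S = "{x. f x \<noteq> 0}" and ?S' = "{x. f' x \<noteq> 0}"
  have fin: "finite ?S" "finite ?S'" "?S \<subseteq> X" "?S' \<subseteq> X" using f f' by (auto simp: span_alg_def)
  have "\<exists>x\<in>?S. \<exists>y\<in>?S'. m x y = Some z" if "(f \<otimes>\<^bsub>span_alg X m u\<^esub> f') z \<noteq> 0" for z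
  proof (rule ccontr)
    assume none: "\<not> ?thesis"
    then have none': "m x y \<noteq> Some z" if "f x \<noteq> 0" "f' y \<noteq> 0" for x y using that by blast
    have "(f \<otimes>\<^bsub>span_alg X m u\<^esub> f') z = 0"
      by (subst span_alg_mult_apply[OF f f' fin(1) _ fin(2)]) (auto intro!: sum.neutral dest: none')
    with that show False by simp
  qed
  then have *: "{z. (f \<otimes>\<^bsub>span_alg X m u\<^esub> f') z \<noteq> 0} \<subseteq> {z. \<exists>x\<in>?S. \<exists>y\<in>?S'. m x y = Some z}" by blast
  have "{z. \<exists>x\<in>?S. \<exists>y\<in>?S'. m x y = Some z} \<subseteq> (\<lambda>(x, y). the (m x y)) ` (?S \<times> ?S')" by force
  then have "finite {z. \<exists>x\<in>?S. \<exists>y\<in>?S'. m x y = Some z}" using fin by (auto intro: finite_subset)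
  then show ?thesis using * fin(3,4) m by (intro span_alg_carrierI) (blast intro: finite_subset)+
qed

text \<open>For a partial product, associativity on the basis means that the two bracketings are
  undefined together or equal, hence \<open>Option.bind\<close>. The unit laws are hypotheses
  because the unit need not be a basis element: in a groupoid algebra it is the sum of the
  identities.\<close>

lemma span_alg_k_algebra:
  fixes X :: "'x set" and u :: "'x \<Rightarrow> 'k::field"
  assumes m: "\<And>x y z. x \<in> X \<Longrightarrow> y \<in> X \<Longrightarrow> m x y = Some z \<Longrightarrow> z \<in> X"
    and assoc: "\<And>x y z. x \<in> X \<Longrightarrow> y \<in> X \<Longrightarrow> z \<in> X \<Longrightarrow>
      Option.bind (m x y) (\<lambda>w. m w z) = Option.bind (m y z) (m x)"
    and u: "u \<in> carrier (span_alg X m u)"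
    and unit: "\<And>f. f \<in> carrier (span_alg X m u) \<Longrightarrow> u \<otimes>\<^bsub>span_alg X m u\<^esub> f = f"
      "\<And>f. f \<in> carrier (span_alg X m u) \<Longrightarrow> f \<otimes>\<^bsub>span_alg X m u\<^esub> u = f"
  shows "k_algebra (span_alg X m u)"
proof -
  let ?A = "span_alg X m u"
  let ?s = "\<lambda>f. {x. f x \<noteq> (0::'k)}"
  have mc: "f \<otimes>\<^bsub>?A\<^esub> g \<in> carrier ?A" if "f \<in> carrier ?A" "g \<in> carrier ?A" for f g
    by (rule span_alg_mult_closed[OF _ that]) (rule m)
  have fin: "finite (?s f)" "?s f \<subseteq> X" if "f \<in> carrier ?A" for f using that by (auto simp: span_alg_def)
  have add: "(f \<oplus>\<^bsub>?A\<^esub> g) x = f x + g x" and sm: "(c \<odot>\<^bsub>?A\<^esub> f) x = c * f x" for f g c x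
    by (simp_all add: span_alg_def)
  have ac: "f \<oplus>\<^bsub>?A\<^esub> g \<in> carrier ?A" if "f \<in> carrier ?A" "g \<in> carrier ?A" for f g
  proof (rule span_alg_carrierI)
    have "?s (f \<oplus>\<^bsub>?A\<^esub> g) \<subseteq> ?s f \<union> ?s g" by (auto simp: add)
    then show "finite (?s (f \<oplus>\<^bsub>?A\<^esub> g))" using fin that by (meson finite_UnI finite_subset)
    show "x \<in> X" if "(f \<oplus>\<^bsub>?A\<^esub> g) x \<noteq> 0" for x
      using that fin(2)[OF \<open>f \<in> carrier ?A\<close>] fin(2)[OF \<open>g \<in> carrier ?A\<close>]
      by (cases "f x = 0") (auto simp: add subset_iff)
  qed
  have sc: "c \<odot>\<^bsub>?A\<^esub> f \<in> carrier ?A" if "f \<in> carrier ?A" for c f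
    using fin[OF that] by (intro span_alg_carrierI) (auto simp: sm subset_iff elim: rev_finite_subset)
  have mult: "(f \<otimes>\<^bsub>?A\<^esub> g) z = (\<Sum>x\<in>S. \<Sum>y\<in>T. if m x y = Some z then f x * g y else 0)"
    if "f \<in> carrier ?A" "g \<in> carrier ?A" "finite S" "?s f \<subseteq> S" "finite T" "?s g \<subseteq> T" for f g z S T
    using that by (rule span_alg_mult_apply)
  have z0: "\<zero>\<^bsub>?A\<^esub> x = 0" for x by (simp add: span_alg_def)
  have zc: "\<zero>\<^bsub>?A\<^esub> \<in> carrier ?A" by (simp add: span_alg_def)
  have grp: "abelian_group ?A"
  proof (rule abelian_groupI)
    fix f assume f: "f \<in> carrier ?A"
    have "(\<lambda>x. - f x) \<in> carrier ?A" using fin[OF f] by (intro span_alg_carrierI) auto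
    then show "\<exists>g\<in>carrier ?A. g \<oplus>\<^bsub>?A\<^esub> f = \<zero>\<^bsub>?A\<^esub>"
      by (rule bexI[rotated]) (simp add: span_alg_def)
  qed (auto simp: ac z0 zc fun_eq_iff add algebra_simps)
  have assoc': "(f \<otimes>\<^bsub>?A\<^esub> g) \<otimes>\<^bsub>?A\<^esub> h = f \<otimes>\<^bsub>?A\<^esub> (g \<otimes>\<^bsub>?A\<^esub> h)"
    if c: "f \<in> carrier ?A" "g \<in> carrier ?A" "h \<in> carrier ?A" for f g h
  proof
    fix z :: 'x
    \<comment> \<open>Evaluation at \<open>z\<close> as a functional on the basis, with value 0 at
      \<open>None\<close>. With it both bracketings become pairings and reduce to the same triple
      sum.\<close>
    define o2 where "o2 = (\<lambda>o'. case o' of None \<Rightarrow> 0 | Some w \<Rightarrow> if w = z then 1 else (0::'k))"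
    let ?fg = "f \<otimes>\<^bsub>?A\<^esub> g" and ?gh = "g \<otimes>\<^bsub>?A\<^esub> h"
    note S = fin(1)[OF c(1)] fin(1)[OF c(2)] fin(1)[OF c(3)]
    note fg = mc[OF c(1,2)] and gh = mc[OF c(2,3)]
    have o: "(if m x y = Some z then a else 0) = a * o2 (m x y)" for x y a
      by (auto simp: o2_def split: option.splits)
    have "(?fg \<otimes>\<^bsub>?A\<^esub> h) z = (\<Sum>w\<in>?s ?fg. \<Sum>y\<in>?s h. ?fg w * h y * o2 (m w y))"
      by (subst mult[OF fg c(3) fin(1)[OF fg] subset_refl S(3) subset_refl]) (simp add: o)
    also have "\<dots> = (\<Sum>w\<in>?s ?fg. ?fg w * (\<Sum>y\<in>?s h. h y * o2 (m w y)))"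
      by (simp add: sum_distrib_left mult.assoc)
    also have "\<dots> = (\<Sum>x\<in>?s f. \<Sum>y\<in>?s g. f x * g y *
        (case m x y of None \<Rightarrow> 0 | Some w \<Rightarrow> \<Sum>v\<in>?s h. h v * o2 (m w v)))"
      by (rule span_alg_pairing[OF c(1,2)]) (use S fin[OF fg] in auto)
    also have "\<dots> = (\<Sum>x\<in>?s f. \<Sum>y\<in>?s g. \<Sum>v\<in>?s h. f x * (g y * (h v * o2 (Option.bind (m x y) (\<lambda>w. m w v)))))"
      by (intro sum.cong refl) (auto simp: sum_distrib_left mult.assoc o2_def split: option.split)
    also have "\<dots> = (\<Sum>x\<in>?s f. \<Sum>y\<in>?s g. \<Sum>v\<in>?s h. f x * (g y * (h v * o2 (Option.bind (m y v) (m x)))))"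
      by (intro sum.cong refl, subst assoc) (use fin c in auto)
    also have "\<dots> = (\<Sum>x\<in>?s f. f x * (\<Sum>y\<in>?s g. \<Sum>v\<in>?s h. g y * h v *
        (case m y v of None \<Rightarrow> 0 | Some w \<Rightarrow> o2 (m x w))))"
      by (intro sum.cong refl)
         (auto simp: sum_distrib_left mult.assoc o2_def intro!: sum.cong split: option.split)
    also have "\<dots> = (\<Sum>x\<in>?s f. f x * (\<Sum>w\<in>?s ?gh. ?gh w * o2 (m x w)))"
      by (intro sum.cong refl arg_cong2[where f="(*)"] span_alg_pairing[OF c(2,3), symmetric])
         (use S fin[OF gh] in auto)
    also have "\<dots> = (\<Sum>x\<in>?s f. \<Sum>w\<in>?s ?gh. f x * ?gh w * o2 (m x w))"
      by (simp add: sum_distrib_left mult.assoc)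
    also have "\<dots> = (f \<otimes>\<^bsub>?A\<^esub> ?gh) z"
      by (subst mult[OF c(1) gh S(1) subset_refl fin(1)[OF gh] subset_refl]) (simp add: o)
    finally show "(?fg \<otimes>\<^bsub>?A\<^esub> h) z = (f \<otimes>\<^bsub>?A\<^esub> ?gh) z" .
  qed
  have one: "\<one>\<^bsub>?A\<^esub> = u" by (simp add: span_alg_def)
  have mon: "monoid ?A"
    by (rule monoidI) (use mc assoc' unit u one in auto)
  have dist: "(f \<oplus>\<^bsub>?A\<^esub> g) \<otimes>\<^bsub>?A\<^esub> h = f \<otimes>\<^bsub>?A\<^esub> h \<oplus>\<^bsub>?A\<^esub> g \<otimes>\<^bsub>?A\<^esub> h"
    "h \<otimes>\<^bsub>?A\<^esub> (f \<oplus>\<^bsub>?A\<^esub> g) = h \<otimes>\<^bsub>?A\<^esub> f \<oplus>\<^bsub>?A\<^esub> h \<otimes>\<^bsub>?A\<^esub> g"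
    if c: "f \<in> carrier ?A" "g \<in> carrier ?A" "h \<in> carrier ?A" for f g h
  proof -
    let ?S = "?s f \<union> ?s g"
    have S: "finite ?S" "?s (f \<oplus>\<^bsub>?A\<^esub> g) \<subseteq> ?S" "?s f \<subseteq> ?S" "?s g \<subseteq> ?S" "finite (?s h)" "?s h \<subseteq> ?s h"
      using fin c by (auto simp: add)
    note m1 = mult[OF _ c(3) S(1) _ S(5,6)] and m2 = mult[OF c(3) _ S(5,6,1)]
    show "(f \<oplus>\<^bsub>?A\<^esub> g) \<otimes>\<^bsub>?A\<^esub> h = f \<otimes>\<^bsub>?A\<^esub> h \<oplus>\<^bsub>?A\<^esub> g \<otimes>\<^bsub>?A\<^esub> h"
      unfolding fun_eq_iff add m1[OF ac[OF c(1,2)] S(2)] m1[OF c(1) S(3)] m1[OF c(2) S(4)] sum.distrib[symmetric]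
      by (auto simp: algebra_simps intro!: sum.cong)
    show "h \<otimes>\<^bsub>?A\<^esub> (f \<oplus>\<^bsub>?A\<^esub> g) = h \<otimes>\<^bsub>?A\<^esub> f \<oplus>\<^bsub>?A\<^esub> h \<otimes>\<^bsub>?A\<^esub> g"
      unfolding fun_eq_iff add m2[OF ac[OF c(1,2)] S(2)] m2[OF c(1) S(3)] m2[OF c(2) S(4)] sum.distrib[symmetric]
      by (auto simp: algebra_simps intro!: sum.cong)
  qed
  have smm: "(c \<odot>\<^bsub>?A\<^esub> f) \<otimes>\<^bsub>?A\<^esub> g = c \<odot>\<^bsub>?A\<^esub> (f \<otimes>\<^bsub>?A\<^esub> g)"
    "f \<otimes>\<^bsub>?A\<^esub> (c \<odot>\<^bsub>?A\<^esub> g) = c \<odot>\<^bsub>?A\<^esub> (f \<otimes>\<^bsub>?A\<^esub> g)"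
    if fg: "f \<in> carrier ?A" "g \<in> carrier ?A" for c f g
  proof -
    have S: "finite (?s f)" "?s f \<subseteq> ?s f" "finite (?s g)" "?s g \<subseteq> ?s g"
      "?s (c \<odot>\<^bsub>?A\<^esub> f) \<subseteq> ?s f" "?s (c \<odot>\<^bsub>?A\<^esub> g) \<subseteq> ?s g"
      using fin fg by (auto simp: sm)
    show "(c \<odot>\<^bsub>?A\<^esub> f) \<otimes>\<^bsub>?A\<^esub> g = c \<odot>\<^bsub>?A\<^esub> (f \<otimes>\<^bsub>?A\<^esub> g)"
      unfolding fun_eq_iff sm mult[OF fg S(1-4)] mult[OF sc[OF fg(1)] fg(2) S(1,5,3,4)] sum_distrib_left
      by (auto simp: algebra_simps intro!: sum.cong)
    show "f \<otimes>\<^bsub>?A\<^esub> (c \<odot>\<^bsub>?A\<^esub> g) = c \<odot>\<^bsub>?A\<^esub> (f \<otimes>\<^bsub>?A\<^esub> g)"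
      unfolding fun_eq_iff sm mult[OF fg S(1-4)] mult[OF fg(1) sc[OF fg(2)] S(1,2,3,6)] sum_distrib_left
      by (auto simp: algebra_simps intro!: sum.cong)
  qed
  show ?thesis
  proof (rule k_algebraI)
    show "ring ?A" by (rule ringI[OF grp mon dist])
  qed ((rule sc smm; assumption) | simp add: fun_eq_iff add sm algebra_simps)+
qed

section \<open>Smash products with the algebra of functions on nonempty subsets\<close>

text \<open>Distinct basis elements multiply to \<open>None\<close>, so the basis consists of
  orthogonal idempotents and the product is pointwise. In this form
  \<open>span_alg_k_algebra\<close> applies.\<close>

definition fun_alg :: "'x set \<Rightarrow> ('k::field, 'x \<Rightarrow> 'k) module" where
  "fun_alg X = span_alg X (\<lambda>x y. if x = y then Some x else None) (\<lambda>x. if x \<in> X then 1 else 0)"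

context
  fixes X :: "'x set"
  assumes X: "finite X"
begin

lemma fun_alg_carrier: "carrier (fun_alg X) = {c :: 'x \<Rightarrow> 'k::field. \<forall>x. x \<notin> X \<longrightarrow> c x = 0}"
  using X by (auto simp: fun_alg_def span_alg_def elim: rev_finite_subset)

lemma fun_alg_simps:
  "(c \<oplus>\<^bsub>fun_alg X\<^esub> d) = (\<lambda>x. c x + d x)" "\<zero>\<^bsub>fun_alg X\<^esub> = (\<lambda>_. 0)"
  "\<one>\<^bsub>fun_alg X\<^esub> = (\<lambda>x. if x \<in> X then 1 else 0)" "r \<odot>\<^bsub>fun_alg X\<^esub> c = (\<lambda>x. r * c x)"
  by (simp_all add: fun_alg_def span_alg_def)

lemma fun_alg_mult:
  fixes c d :: "'x \<Rightarrow> 'k::field"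
  assumes "c \<in> carrier (fun_alg X)" "d \<in> carrier (fun_alg X)"
  shows "c \<otimes>\<^bsub>fun_alg X\<^esub> d = (\<lambda>x. c x * d x)"
proof
  fix z
  have "(c \<otimes>\<^bsub>fun_alg X\<^esub> d) z
      = (\<Sum>x\<in>X. \<Sum>y\<in>X. if (if x = y then Some x else None) = Some z then c x * d y else 0)"
    unfolding fun_alg_def
    by (rule span_alg_mult_apply) (use assms X in \<open>auto simp: fun_alg_def span_alg_def\<close>)
  also have "\<dots> = (\<Sum>x\<in>X. \<Sum>y\<in>X. if y = x then (if x = z then c x * d x else 0) else 0)"
    by (intro sum.cong refl) auto
  also have "\<dots> = c z * d z"
    using X assms by (auto simp: fun_alg_carrier)
  finally show "(c \<otimes>\<^bsub>fun_alg X\<^esub> d) z = c z * d z" .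
qed

lemma fun_alg_k_algebra: "k_algebra (fun_alg X :: ('k::field, _) module)"
proof -
  let ?u = "\<lambda>x. if x \<in> X then 1 else (0::'k)"
  have u: "?u \<in> carrier (fun_alg X)" by (simp add: fun_alg_carrier)
  have "?u \<otimes>\<^bsub>fun_alg X\<^esub> f = f" "f \<otimes>\<^bsub>fun_alg X\<^esub> ?u = f" if "f \<in> carrier (fun_alg X)" for f
    using that by (auto simp: fun_alg_mult u) (auto simp: fun_alg_carrier)
  then show ?thesis
    using u unfolding fun_alg_def
    by (intro span_alg_k_algebra) (auto split: if_splits)
qed

lemma fun_alg_finsum:
  assumes "finite I" "\<And>i. i \<in> I \<Longrightarrow> f i \<in> carrier (fun_alg X :: ('k::field, _) module)"
  shows "(\<Oplus>\<^bsub>fun_alg X\<^esub>i\<in>I. f i) = (\<lambda>x. \<Sum>i\<in>I. f i x)"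
proof -
  interpret ring "fun_alg X :: ('k, _) module" by (rule k_algebra_ring[OF fun_alg_k_algebra])
  show ?thesis using assms
  proof (induction I rule: finite_induct)
    case (insert i I)
    then have "(\<Oplus>\<^bsub>fun_alg X\<^esub>i\<in>insert i I. f i) = f i \<oplus>\<^bsub>fun_alg X\<^esub> (\<Oplus>\<^bsub>fun_alg X\<^esub>i\<in>I. f i)"
      by (intro finsum_insert) auto
    then show ?case using insert by (simp add: fun_alg_simps)
  qed (simp add: fun_alg_simps)
qed

end

lemma alg_onto_finsum:
  assumes R: "k_algebra R" and h: "alg_onto R S h" and I: "finite I" "\<And>i. i \<in> I \<Longrightarrow> f i \<in> carrier R"
  shows "h (\<Oplus>\<^bsub>R\<^esub>i\<in>I. f i) = (\<Oplus>\<^bsub>S\<^esub>i\<in>I. h (f i))"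
proof -
  interpret R: ring R by (rule k_algebra_ring[OF R])
  interpret S: ring S by (rule k_algebra_ring[OF k_algebra_image[OF R h]])
  have hc: "h x \<in> carrier S" if "x \<in> carrier R" for x using h that by (auto simp: alg_onto_def)
  show ?thesis using I
  proof (induction I rule: finite_induct)
    case (insert i I)
    then show ?case using h
      by (subst R.finsum_insert S.finsum_insert, auto simp: hc)+ (auto simp: alg_onto_def)
  qed (use h in \<open>simp add: alg_onto_def\<close>)
qed

section \<open>Left translates of nonempty subsets\<close>

context group
begin

lemma l_coset_mem: "g \<in> carrier G \<Longrightarrow> x \<in> carrier G \<Longrightarrow> A \<subseteq> carrier G \<Longrightarrow> x \<in> g <# A \<longleftrightarrow> inv g \<otimes> x \<in> A"
  by (auto simp: l_coset_def m_assoc[symmetric] subset_iff intro!: bexI[of _ "inv g \<otimes> x"])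

lemma nesubsets_subset: "A \<in> nesubsets G \<Longrightarrow> A \<subseteq> carrier G"
  by (auto simp: nesubsets_def)

lemma l_coset_nesubsets: "g \<in> carrier G \<Longrightarrow> A \<in> nesubsets G \<Longrightarrow> g <# A \<in> nesubsets G"
  by (auto simp: l_coset_def nesubsets_def)

lemma l_coset_nesubsets_assoc:
  "g \<in> carrier G \<Longrightarrow> h \<in> carrier G \<Longrightarrow> A \<in> nesubsets G \<Longrightarrow> g <# (h <# A) = (g \<otimes> h) <# A"
  by (rule lcos_m_assoc) (auto simp: nesubsets_def)

lemma l_coset_nesubsets_one: "A \<in> nesubsets G \<Longrightarrow> \<one> <# A = A"
  by (rule lcos_mult_one) (auto simp: nesubsets_def)

lemmas l_coset_nesubsets_simps =
  l_coset_nesubsets l_coset_nesubsets_assoc l_coset_nesubsets_one m_assoc[symmetric]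

lemma inv_cancel_left: "g \<in> carrier G \<Longrightarrow> h \<in> carrier G \<Longrightarrow> inv g \<otimes> (g \<otimes> h) = h"
  "g \<in> carrier G \<Longrightarrow> h \<in> carrier G \<Longrightarrow> g \<otimes> (inv g \<otimes> h) = h"
  by (simp_all add: m_assoc[symmetric])

end

section \<open>The groupoid algebra and its unit\<close>

lemma k_glob_k_algebra:
  fixes G (structure)
  assumes "group G" and fin: "finite (carrier G)"
  shows "k_algebra (k_glob G :: ('k::field, _) module)"
proof -
  interpret group G by fact
  let ?X = "carrier G \<times> nesubsets G"
  let ?m = "\<lambda>(g, A) (h, B). if A = h <# B then Some (g \<otimes> h, B) else None"
  let ?u = "\<lambda>x. \<Sum>A\<in>nesubsets G. ind (\<one>, A) x :: 'k"
  let ?A = "span_alg ?X ?m ?u"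
  have finX: "finite ?X" using fin finite_nesubsets[OF fin] by simp
  have u: "?u x = (if fst x = \<one> \<and> snd x \<in> nesubsets G then 1 else 0)" for x
    using finite_nesubsets[OF fin] by (cases x) (auto simp: ind_def intro!: sum.neutral)
  have uc: "?u \<in> carrier ?A"
    unfolding u by (rule span_alg_carrierI) (auto intro: finite_subset[OF _ finX] split: if_splits)
  have m: "z \<in> ?X" if "x \<in> ?X" "y \<in> ?X" "?m x y = Some z" for x y z
    using that by (auto split: if_splits)
  have val: "f z = 0" if "f \<in> carrier ?A" "z \<notin> ?X" for f z
    using that unfolding span_alg_def by auto
  have mult: "(f \<otimes>\<^bsub>?A\<^esub> f') z = (\<Sum>p\<in>?X \<times> ?X. if ?m (fst p) (snd p) = Some z then f (fst p) * f' (snd p) else 0)"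
    if "f \<in> carrier ?A" "f' \<in> carrier ?A" for f f' z
  proof -
    have s: "{x. f x \<noteq> 0} \<subseteq> ?X" "{x. f' x \<noteq> 0} \<subseteq> ?X" using val that by blast+
    show ?thesis
      unfolding span_alg_mult_apply[OF that finX s(1) finX s(2), of z]
      by (simp add: sum.cartesian_product case_prod_unfold)
  qed
  \<comment> \<open>Each unit law is a double sum with one surviving term: (g, A) factors through an
    identity only as (1, gA)(g, A) on the left and as (g, A)(1, A) on the right.\<close>
  have sing: "sum t (?X \<times> ?X) = t p" if "p \<in> ?X \<times> ?X" "\<And>q. q \<in> ?X \<times> ?X \<Longrightarrow> q \<noteq> p \<Longrightarrow> t q = 0"
    for t :: "_ \<Rightarrow> 'k" and p
    using that finX by (subst sum.remove[of _ p]) (auto intro!: sum.neutral)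
  have unit: "?u \<otimes>\<^bsub>?A\<^esub> f = f" "f \<otimes>\<^bsub>?A\<^esub> ?u = f" if f: "f \<in> carrier ?A" for f
  proof -
    have "a \<otimes>\<^bsub>?A\<^esub> b \<in> carrier ?A" if "a \<in> carrier ?A" "b \<in> carrier ?A" for a b
      by (rule span_alg_mult_closed[OF _ that]) (rule m)
    note cl = this[OF uc f] this[OF f uc]
    show "?u \<otimes>\<^bsub>?A\<^esub> f = f"
    proof
      fix z
      show "(?u \<otimes>\<^bsub>?A\<^esub> f) z = f z"
      proof (cases "z \<in> ?X")
        case True
        then obtain g A where z: "z = (g, A)" "g \<in> carrier G" "A \<in> nesubsets G" by blast
        show ?thesis
          unfolding mult[OF uc f]
          by (subst sing[of "((\<one>, g <# A), (g, A))"]) (use z in \<open>auto simp: u l_coset_nesubsets split: if_splits\<close>)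
      next
        case False
        show ?thesis unfolding val[OF cl(1) False] val[OF f False] ..
      qed
    qed
    show "f \<otimes>\<^bsub>?A\<^esub> ?u = f"
    proof
      fix z
      show "(f \<otimes>\<^bsub>?A\<^esub> ?u) z = f z"
      proof (cases "z \<in> ?X")
        case True
        then obtain g A where z: "z = (g, A)" "g \<in> carrier G" "A \<in> nesubsets G" by blast
        show ?thesis
          unfolding mult[OF f uc]
          by (subst sing[of "((g, A), (\<one>, A))"]) (use z in \<open>auto simp: u l_coset_nesubsets_one split: if_splits\<close>)
      next
        case False
        show ?thesis unfolding val[OF cl(2) False] val[OF f False] ..
      qed
    qed
  qed
  show ?thesis
    unfolding k_glob_def
    by (rule span_alg_k_algebra[OF m _ uc unit])
       (auto simp: l_coset_nesubsets_assoc m_assoc l_coset_nesubsets)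
qed

lemma groupoid_alg_Gamma_glob: "groupoid_alg (Gamma_glob G) = k_glob G"
proof -
  have "(\<lambda>x y. if Dom (Gamma_glob G) x = Cod (Gamma_glob G) y then Some (Comp (Gamma_glob G) x y) else None)
      = (\<lambda>(g, A) (h, B). if A = h <#\<^bsub>G\<^esub> B then Some (g \<otimes>\<^bsub>G\<^esub> h, B) else None)"
    by (auto simp: Gamma_glob_def fun_eq_iff)
  then show ?thesis by (simp add: groupoid_alg_def k_glob_def) (simp add: Gamma_glob_def)
qed

text \<open>The inverse makes this a left action that takes the indicator of X to that of gX, as the
  action on the \<open>Q\<^sub>X\<close> requires. The value 0 off the nonempty subsets keeps the
  result in the carrier of \<open>fun_alg\<close>.\<close>

definition translate :: "('g, 'm) monoid_scheme \<Rightarrow> 'g \<Rightarrow> ('g set \<Rightarrow> 'k::field) \<Rightarrow> 'g set \<Rightarrow> 'k" where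
  "translate G g c = (\<lambda>X. if X \<in> nesubsets G then c (inv\<^bsub>G\<^esub> g <#\<^bsub>G\<^esub> X) else 0)"

text \<open>A basis of orthogonal idempotents \<open>\<Psi> (ind X)\<close>, indexed by the nonempty subsets \<open>X\<close> and
  permuted by \<open>G\<close>, phrased as an isomorphism with the algebra of functions.\<close>

definition glob_model ::
    "('g, 'm) monoid_scheme \<Rightarrow> ('k::field, 'b) module \<Rightarrow> ('g \<Rightarrow> 'b \<Rightarrow> 'b) \<Rightarrow> (('g set \<Rightarrow> 'k) \<Rightarrow> 'b) \<Rightarrow> bool" where
  "glob_model G B act \<Psi> \<longleftrightarrow> alg_onto (fun_alg (nesubsets G)) B \<Psi> \<and>
     inj_on \<Psi> (carrier (fun_alg (nesubsets G))) \<and>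
     (\<forall>g\<in>carrier G. \<forall>c\<in>carrier (fun_alg (nesubsets G)). act g (\<Psi> c) = \<Psi> (translate G g c))"

text \<open>The product of \<open>Q\<^sub>X # g\<close> and \<open>Q\<^sub>Y # h\<close> is nonzero
  exactly if X = gY, and is then \<open>Q\<^sub>X # gh\<close>. For the corresponding arrows this is
  composability: the domain \<open>g\<^sup>-\<^sup>1X\<close> of the first is the codomain Y of the
  second. Only coordinates enter, so one argument covers all three module algebras.\<close>

lemma smash_glob_model:
  fixes G :: "('g, 'm) monoid_scheme" (structure) and B :: "('k::field, 'b) module"
  assumes "group G" and fin: "finite (carrier G)" and \<Psi>: "glob_model G B act \<Psi>"
  shows "(k_glob G :: ('k, _) module) \<cong>\<^sub>k smash G B act"
proof -
  interpret group G by fact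
  let ?N = "nesubsets G"
  let ?F = "fun_alg ?N :: ('k, _) module"
  let ?K = "k_glob G :: ('k, _) module"
  let ?X = "carrier G \<times> ?N"
  note N = finite_nesubsets[OF fin]
  have F: "k_algebra ?F" by (rule fun_alg_k_algebra[OF N])
  interpret F: ring ?F by (rule k_algebra_ring[OF F])
  have onto: "alg_onto ?F B \<Psi>" and inj: "inj_on \<Psi> (carrier ?F)"
    and eqv: "\<And>g c. g \<in> carrier G \<Longrightarrow> c \<in> carrier ?F \<Longrightarrow> act g (\<Psi> c) = \<Psi> (translate G g c)"
    using \<Psi> by (auto simp: glob_model_def)
  note onto' = onto[unfolded alg_onto_def]
  have im: "\<Psi> ` carrier ?F = carrier B" using onto' by blast
  have mult: "\<Psi> (c \<otimes>\<^bsub>?F\<^esub> d) = \<Psi> c \<otimes>\<^bsub>B\<^esub> \<Psi> d" and add: "\<Psi> (c \<oplus>\<^bsub>?F\<^esub> d) = \<Psi> c \<oplus>\<^bsub>B\<^esub> \<Psi> d"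
    if "c \<in> carrier ?F" "d \<in> carrier ?F" for c d using onto' that by metis+
  have sm: "\<Psi> (r \<odot>\<^bsub>?F\<^esub> c) = r \<odot>\<^bsub>B\<^esub> \<Psi> c" if "c \<in> carrier ?F" for r c using onto' that by metis
  have one: "\<Psi> \<one>\<^bsub>?F\<^esub> = \<one>\<^bsub>B\<^esub>" and zero: "\<Psi> \<zero>\<^bsub>?F\<^esub> = \<zero>\<^bsub>B\<^esub>" using onto' by metis+
  have Fc: "c \<in> carrier ?F \<longleftrightarrow> (\<forall>x. x \<notin> ?N \<longrightarrow> c x = 0)" for c by (simp add: fun_alg_carrier[OF N])
  have Kc: "f \<in> carrier ?K \<longleftrightarrow> (\<forall>x. x \<notin> ?X \<longrightarrow> f x = 0)" for f
  proof -
    have "finite ?X" using fin N by simp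
    then have "finite {x. f x \<noteq> 0}" if "\<forall>x. x \<notin> ?X \<longrightarrow> f x = 0"
      by (rule rev_finite_subset) (use that in auto)
    then show ?thesis by (auto simp: k_glob_def span_alg_def)
  qed
  \<comment> \<open>\<open>sl f g X\<close> is the coefficient of \<open>Q\<^sub>X # g\<close> in
    the image of \<open>f\<close>; the value 0 off \<open>?N\<close> puts each slice into the
    function algebra.\<close>
  define sl where "sl = (\<lambda>f g X. if X \<in> ?N then f (g, inv g <# X) else (0::'k))"
  have slc: "sl f g \<in> carrier ?F" for f g by (simp add: Fc sl_def)
  have slx: "sl f g X = f (g, inv g <# X)" if "X \<in> ?N" for f g X using that by (simp add: sl_def)
  have Feq: "c = d" if "c \<in> carrier ?F" "d \<in> carrier ?F" "\<And>X. X \<in> ?N \<Longrightarrow> c X = d X" for c d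
    using that unfolding Fc by (metis ext)
  have trc: "translate G g c \<in> carrier ?F" for g c by (simp add: Fc translate_def)
  define H where "H = (\<lambda>f. \<lambda>g\<in>carrier G. \<Psi> (sl f g))"
  have Sc: "carrier (smash G B act) = carrier G \<rightarrow>\<^sub>E carrier B"
    using fin by (auto simp: smash_def tens_kG_def)
  have \<Psi>c: "\<Psi> c \<in> carrier B" if "c \<in> carrier ?F" for c using im that by blast
  have Hc: "H f \<in> carrier (smash G B act)" for f using slc \<Psi>c by (auto simp: H_def Sc)
  have "H ` carrier ?K = carrier (smash G B act)"
  proof (intro equalityI subsetI)
    fix s assume s: "s \<in> carrier (smash G B act)"
    have "\<exists>c. c \<in> carrier ?F \<and> s g = \<Psi> c" if "g \<in> carrier G" for g
      using s that im by (auto simp: Sc PiE_iff image_iff)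
    then obtain c where c: "\<And>g. g \<in> carrier G \<Longrightarrow> c g \<in> carrier ?F \<and> s g = \<Psi> (c g)" by metis
    \<comment> \<open>This inverts the slicing: the coefficient of the arrow \<open>(g, A)\<close>
      is read off at its codomain \<open>g <# A\<close>.\<close>
    let ?f = "\<lambda>(g, A). if (g, A) \<in> ?X then c g (g <# A) else 0"
    have "?f \<in> carrier ?K" unfolding Kc by auto
    moreover have "H ?f = s"
    proof (rule extensionalityI[of _ "carrier G"])
      fix g assume g: "g \<in> carrier G"
      have "sl ?f g = c g"
        by (rule Feq[OF slc]) (use c g in \<open>auto simp: slx l_coset_nesubsets_simps\<close>)
      then show "H ?f g = s g" using c g by (simp add: H_def)
    qed (use s in \<open>auto simp: H_def Sc PiE_iff\<close>)
    ultimately show "s \<in> H ` carrier ?K" by blast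
  qed (use Hc in auto)
  moreover have "H \<one>\<^bsub>?K\<^esub> = \<one>\<^bsub>smash G B act\<^esub>"
  proof -
    have "sl \<one>\<^bsub>?K\<^esub> g = ind \<one> g \<odot>\<^bsub>?F\<^esub> \<one>\<^bsub>?F\<^esub>" if "g \<in> carrier G" for g
      by (rule ext) (use that N in \<open>auto simp: sl_def fun_alg_simps[OF N] k_glob_def span_alg_def ind_def l_coset_nesubsets\<close>)
    then show ?thesis by (auto simp: H_def smash_def tens_def sm one)
  qed
  moreover have "H \<zero>\<^bsub>?K\<^esub> = \<zero>\<^bsub>smash G B act\<^esub>"
  proof -
    have "sl \<zero>\<^bsub>?K\<^esub> g = \<zero>\<^bsub>?F\<^esub>" for g by (auto simp: sl_def fun_alg_simps[OF N] k_glob_def span_alg_def)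
    then show ?thesis by (auto simp: H_def smash_def tens_kG_def zero)
  qed
  moreover have "H (f \<oplus>\<^bsub>?K\<^esub> f') = H f \<oplus>\<^bsub>smash G B act\<^esub> H f'" for f f'
  proof -
    have "sl (f \<oplus>\<^bsub>?K\<^esub> f') g = sl f g \<oplus>\<^bsub>?F\<^esub> sl f' g" for g
      by (auto simp: sl_def fun_alg_simps[OF N] k_glob_def span_alg_def)
    then show ?thesis by (auto simp: H_def smash_def tens_kG_def add slc)
  qed
  moreover have "H (r \<odot>\<^bsub>?K\<^esub> f) = r \<odot>\<^bsub>smash G B act\<^esub> H f" for r f
  proof -
    have "sl (r \<odot>\<^bsub>?K\<^esub> f) g = r \<odot>\<^bsub>?F\<^esub> sl f g" for g
      by (auto simp: sl_def fun_alg_simps[OF N] k_glob_def span_alg_def)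
    then show ?thesis by (auto simp: H_def smash_def tens_kG_def sm slc)
  qed
  moreover have "H (f \<otimes>\<^bsub>?K\<^esub> f') = H f \<otimes>\<^bsub>smash G B act\<^esub> H f'"
    if f: "f \<in> carrier ?K" "f' \<in> carrier ?K" for f f'
  proof -
    have K: "(f \<otimes>\<^bsub>?K\<^esub> f') (l, A) = (\<Sum>g\<in>carrier G. f (g, inv g <# (l <# A)) * f' (inv g \<otimes> l, A))"
      if l: "l \<in> carrier G" "A \<in> ?N" for l A
    proof -
      let ?m = "\<lambda>(g, A) (h, B). if A = h <# B then Some (g \<otimes> h, B) else None"
      have fX: "finite ?X" using fin N by simp
      have "(f \<otimes>\<^bsub>?K\<^esub> f') (l, A) = (\<Sum>x\<in>?X. \<Sum>y\<in>?X. if ?m x y = Some (l, A) then f x * f' y else 0)"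
        unfolding k_glob_def
        by (rule span_alg_mult_apply[OF _ _ fX _ fX])
           (use f in \<open>auto simp: Kc simp flip: k_glob_def\<close>)
      also have "\<dots> = (\<Sum>p\<in>?X \<times> ?X. if ?m (fst p) (snd p) = Some (l, A) then f (fst p) * f' (snd p) else 0)"
        by (simp add: sum.cartesian_product case_prod_unfold)
      also have "\<dots> = (\<Sum>p\<in>{p \<in> ?X \<times> ?X. ?m (fst p) (snd p) = Some (l, A)}. f (fst p) * f' (snd p))"
        by (rule sum.mono_neutral_cong_right) (use fX in auto)
      \<comment> \<open>The arrow \<open>(l, A)\<close> has exactly one factorization for each
        \<open>g\<close>, with second factor \<open>(inv g \<otimes> l, A)\<close>; the first factor
        must start where that one ends.\<close>
      also have "\<dots> = (\<Sum>g\<in>carrier G. f (g, inv g <# (l <# A)) * f' (inv g \<otimes> l, A))"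
        by (rule sum.reindex_bij_witness[of _ "\<lambda>g. ((g, inv g <# (l <# A)), (inv g \<otimes> l, A))" "\<lambda>p. fst (fst p)"])
           (use l in \<open>auto simp: l_coset_nesubsets_simps inv_cancel_left split: if_splits\<close>)
      finally show ?thesis .
    qed
    have "\<Psi> (sl (f \<otimes>\<^bsub>?K\<^esub> f') l) = (\<Oplus>\<^bsub>B\<^esub>g\<in>carrier G. H f g \<otimes>\<^bsub>B\<^esub> act g (H f' (inv g \<otimes> l)))"
      if l: "l \<in> carrier G" for l
    proof -
      have "sl (f \<otimes>\<^bsub>?K\<^esub> f') l = (\<Oplus>\<^bsub>?F\<^esub>g\<in>carrier G. sl f g \<otimes>\<^bsub>?F\<^esub> translate G g (sl f' (inv g \<otimes> l)))"
      proof (rule Feq[OF slc])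
        fix X assume X: "X \<in> ?N"
        have "sl (f \<otimes>\<^bsub>?K\<^esub> f') l X = (\<Sum>g\<in>carrier G. f (g, inv g <# X) * f' (inv g \<otimes> l, inv l <# X))"
          using X l by (simp add: slx K l_coset_nesubsets_simps)
        also have "\<dots> = (\<Sum>g\<in>carrier G. sl f g X * translate G g (sl f' (inv g \<otimes> l)) X)"
          using X l by (intro sum.cong refl)
            (simp add: slx translate_def l_coset_nesubsets l_coset_nesubsets_assoc inv_mult_group m_assoc)
        finally show "sl (f \<otimes>\<^bsub>?K\<^esub> f') l X
            = (\<Oplus>\<^bsub>?F\<^esub>g\<in>carrier G. sl f g \<otimes>\<^bsub>?F\<^esub> translate G g (sl f' (inv g \<otimes> l))) X"
          by (subst fun_alg_finsum[OF N fin F.m_closed[OF slc trc]]) (simp add: fun_alg_mult[OF N slc trc])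
      qed (use slc trc in auto)
      then have "\<Psi> (sl (f \<otimes>\<^bsub>?K\<^esub> f') l) = \<Psi> (\<Oplus>\<^bsub>?F\<^esub>g\<in>carrier G. sl f g \<otimes>\<^bsub>?F\<^esub> translate G g (sl f' (inv g \<otimes> l)))"
        by simp
      also have "\<dots> = (\<Oplus>\<^bsub>B\<^esub>g\<in>carrier G. \<Psi> (sl f g \<otimes>\<^bsub>?F\<^esub> translate G g (sl f' (inv g \<otimes> l))))"
        by (rule alg_onto_finsum[OF F onto fin]) (use slc trc in auto)
      also have "\<dots> = (\<Oplus>\<^bsub>B\<^esub>g\<in>carrier G. H f g \<otimes>\<^bsub>B\<^esub> act g (H f' (inv g \<otimes> l)))"
      proof -
        interpret B: ring B by (rule k_algebra_ring[OF k_algebra_image[OF F onto]])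
        show ?thesis
          by (rule B.finsum_cong') (use slc trc \<Psi>c in \<open>auto simp: mult eqv H_def l\<close>)
      qed
      finally show ?thesis .
    qed
    then show ?thesis by (simp add: smash_def cong: restrict_cong) (simp add: H_def cong: restrict_cong)
  qed
  ultimately have "alg_onto ?K (smash G B act) H" by (simp add: alg_onto_def)
  moreover have "inj_on H (carrier ?K)"
  proof (rule inj_onI)
    fix f f' assume f: "f \<in> carrier ?K" "f' \<in> carrier ?K" and eq: "H f = H f'"
    have "f (g, A) = f' (g, A)" if gA: "g \<in> carrier G" "A \<in> ?N" for g A
    proof -
      have "\<Psi> (sl f g) = \<Psi> (sl f' g)" using eq gA by (auto simp: H_def dest: fun_cong[of _ _ g])
      then have "sl f g = sl f' g" by (rule inj_onD[OF inj _ slc slc])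
      then have "sl f g (g <# A) = sl f' g (g <# A)" by simp
      then show ?thesis using gA by (simp add: slx l_coset_nesubsets_simps)
    qed
    then show "f = f'" using f unfolding Kc fun_eq_iff by (metis mem_Sigma_iff surj_pair)
  qed
  ultimately show ?thesis using k_glob_k_algebra[OF assms(1) fin] by (rule alg_onto_isomorphic[rotated])
qed

text \<open>The coefficient of \<open>Q\<^sub>Z\<close> is the pairing with the indicator of the
  subsets of Z. A union lies in Z exactly if both members do, so this functional is
  multiplicative.\<close>

lemma Q_coord_mult:
  fixes a b :: "'g set \<Rightarrow> 'k::field"
  assumes fin: "finite (carrier G)" and ab: "a \<in> carrier (B_alg G)" "b \<in> carrier (B_alg G)"
  shows "Q_coord G (a \<otimes>\<^bsub>B_alg G\<^esub> b) Z = Q_coord G a Z * Q_coord G b Z"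
proof -
  let ?N = "nesubsets G"
  note N = finite_nesubsets[OF fin]
  have coord: "Q_coord G f Z = (\<Sum>Y\<in>?N. f Y * (if Y \<subseteq> Z then 1 else 0))" for f :: "'g set \<Rightarrow> 'k"
    unfolding Q_coord_def by (rule sum.mono_neutral_cong_left) (use N in auto)
  have supp: "{Y. f Y \<noteq> 0} \<subseteq> ?N" if "f \<in> carrier (B_alg G)" for f :: "'g set \<Rightarrow> 'k"
    using that by (auto simp: B_alg_def span_alg_def)
  have "a \<otimes>\<^bsub>B_alg G\<^esub> b \<in> carrier (B_alg G)"
    unfolding B_alg_def
    by (rule span_alg_mult_closed) (use ab in \<open>auto simp: B_alg_def nesubsets_def\<close>)
  then have "Q_coord G (a \<otimes>\<^bsub>B_alg G\<^esub> b) Z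
      = (\<Sum>X\<in>?N. \<Sum>Y\<in>?N. a X * b Y * (case Some (X \<union> Y) of None \<Rightarrow> 0 | Some W \<Rightarrow> if W \<subseteq> Z then 1 else 0))"
    using ab N supp unfolding coord B_alg_def by (intro span_alg_pairing) auto
  also have "\<dots> = Q_coord G a Z * Q_coord G b Z"
    by (auto simp: coord sum_product intro!: sum.cong)
  finally show ?thesis .
qed

text \<open>By the Moebius inversion in \<open>Q_coord_expansion\<close>, the inverse of the
  coordinate map is \<open>Q_coord\<close>. Identities in the semilattice algebra are therefore
  verified on coordinates, where \<open>Q_coord_mult\<close> makes the product pointwise.\<close>

lemma B_alg_glob_model:
  fixes G :: "('g, 'm) monoid_scheme" (structure)
  assumes "group G" and fin: "finite (carrier G)"
  shows "glob_model G (B_alg G :: ('k::field, _) module) (B_act G) (\<lambda>c Y. \<Sum>X\<in>nesubsets G. c X * Q_idem G X Y)"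
    (is "glob_model G ?B _ ?\<Psi>")
proof -
  interpret group G by fact
  let ?N = "nesubsets G"
  let ?F = "fun_alg ?N :: ('k, _) module"
  note N = finite_nesubsets[OF fin]
  have Fc: "c \<in> carrier ?F \<longleftrightarrow> (\<forall>x. x \<notin> ?N \<longrightarrow> c x = 0)" for c by (simp add: fun_alg_carrier[OF N])
  have Bc: "a \<in> carrier ?B \<longleftrightarrow> (\<forall>x. x \<notin> ?N \<longrightarrow> a x = 0)" for a
    using N by (auto simp: B_alg_def span_alg_def elim: rev_finite_subset)
  have \<Psi>c: "?\<Psi> c \<in> carrier ?B" for c by (simp add: Bc Q_idem_def)
  have coord: "Q_coord G (?\<Psi> c) Z = c Z" if "Z \<in> ?N" for c :: "'g set \<Rightarrow> 'k" and Z
  proof -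
    have "Q_coord G (?\<Psi> c) Z = (\<Sum>X\<in>?N. c X * Q_coord G (Q_idem G X) Z)"
      unfolding Q_coord_def by (subst sum.swap) (simp add: sum_distrib_left)
    also have "\<dots> = (\<Sum>X\<in>?N. if X = Z then c Z else 0)"
      by (rule sum.cong) (use that fin in \<open>auto simp: Q_coord_Q_idem\<close>)
    finally show ?thesis using that N by simp
  qed
  have expand: "?\<Psi> c = a" if "a \<in> carrier ?B" "\<And>Z. Z \<in> ?N \<Longrightarrow> Q_coord G a Z = c Z" for a c
    using Q_coord_expansion[OF fin that(1)] that(2) by (simp cong: sum.cong)
  have im: "?\<Psi> ` carrier ?F = carrier ?B"
  proof (intro equalityI subsetI)
    fix a assume a: "a \<in> carrier ?B"
    let ?c = "\<lambda>X. if X \<in> ?N then Q_coord G a X else 0"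
    have "a = ?\<Psi> ?c" by (rule expand[OF a, symmetric]) simp
    moreover have "?c \<in> carrier ?F" by (simp add: Fc)
    ultimately show "a \<in> ?\<Psi> ` carrier ?F" by (rule image_eqI)
  qed (use \<Psi>c in auto)
  have mult: "?\<Psi> (c \<otimes>\<^bsub>?F\<^esub> d) = ?\<Psi> c \<otimes>\<^bsub>?B\<^esub> ?\<Psi> d" if "c \<in> carrier ?F" "d \<in> carrier ?F" for c d
  proof (rule expand)
    show "?\<Psi> c \<otimes>\<^bsub>?B\<^esub> ?\<Psi> d \<in> carrier ?B"
      using \<Psi>c[of c] \<Psi>c[of d] unfolding B_alg_def by (rule span_alg_mult_closed[rotated]) (auto simp: nesubsets_def)
    show "Q_coord G (?\<Psi> c \<otimes>\<^bsub>?B\<^esub> ?\<Psi> d) Z = (c \<otimes>\<^bsub>?F\<^esub> d) Z" if "Z \<in> ?N" for Z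
      using that \<open>c \<in> _\<close> \<open>d \<in> _\<close> by (simp add: Q_coord_mult[OF fin \<Psi>c \<Psi>c] coord fun_alg_mult[OF N])
  qed
  have "alg_onto ?F ?B ?\<Psi>"
    unfolding alg_onto_def
  proof (intro conjI ballI allI im mult)
    show "?\<Psi> \<one>\<^bsub>?F\<^esub> = \<one>\<^bsub>?B\<^esub>" "?\<Psi> \<zero>\<^bsub>?F\<^esub> = \<zero>\<^bsub>?B\<^esub>"
      by (simp_all add: fun_alg_simps[OF N] B_alg_def span_alg_def)
    show "?\<Psi> (c \<oplus>\<^bsub>?F\<^esub> d) = ?\<Psi> c \<oplus>\<^bsub>?B\<^esub> ?\<Psi> d" for c d
      by (simp add: fun_alg_simps[OF N] B_alg_def span_alg_def distrib_right sum.distrib)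
    show "?\<Psi> (r \<odot>\<^bsub>?F\<^esub> c) = r \<odot>\<^bsub>?B\<^esub> ?\<Psi> c" for r c
      by (simp add: fun_alg_simps[OF N] B_alg_def span_alg_def mult.assoc sum_distrib_left)
  qed
  moreover have "inj_on ?\<Psi> (carrier ?F)"
  proof (rule inj_onI, rule ext)
    fix c d Z assume "c \<in> carrier ?F" "d \<in> carrier ?F" and eq: "?\<Psi> c = ?\<Psi> d"
    then show "c Z = d Z"
      using coord[of Z c, unfolded eq] coord[of Z d] by (cases "Z \<in> ?N") (simp_all add: Fc)
  qed
  moreover have "B_act G g (?\<Psi> c) = ?\<Psi> (translate G g c)" if g: "g \<in> carrier G" for g c
  proof
    fix Y
    have "B_act G g (?\<Psi> c) Y = (\<Sum>X\<in>?N. c X * Q_idem G (g <# X) Y)"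
      unfolding B_act_def by (rule sum.cong) (auto simp: coord)
    \<comment> \<open>Substituting gX for X moves the translation from the idempotents to the
      coefficients.\<close>
    also have "\<dots> = ?\<Psi> (translate G g c) Y"
      by (rule sum.reindex_bij_witness[of _ "\<lambda>X. inv g <# X" "\<lambda>X. g <# X"])
         (use g in \<open>auto simp: translate_def l_coset_nesubsets_simps\<close>)
    finally show "B_act G g (?\<Psi> c) Y = ?\<Psi> (translate G g c) Y" .
  qed
  ultimately show ?thesis by (simp add: glob_model_def)
qed

section \<open>A representation of the partial group algebra\<close>

text \<open>The point is that all members of the union defining scalar multiplication on
  \<open>quot_alg\<close> coincide. They do because an ideal absorbs scalars: c times i is the
  product of c times 1 with i.\<close>

lemma quot_alg_onto:
  fixes A :: "('k::field, 'a) module"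
  assumes A: "k_algebra A" and I: "ideal I A"
  shows "alg_onto A (quot_alg A I) (\<lambda>a. I +>\<^bsub>A\<^esub> a)"
proof -
  interpret ideal I A by (rule I)
  have hom: "(+>\<^bsub>A\<^esub>) I \<in> ring_hom A (A Quot I)" by (rule rcos_ring_hom)
  have smult: "I +>\<^bsub>A\<^esub> (c \<odot>\<^bsub>A\<^esub> x) = (\<Union>y\<in>I +>\<^bsub>A\<^esub> x. I +>\<^bsub>A\<^esub> (c \<odot>\<^bsub>A\<^esub> y))" if x: "x \<in> carrier A" for c x
  proof -
    have "I +>\<^bsub>A\<^esub> (c \<odot>\<^bsub>A\<^esub> y) = I +>\<^bsub>A\<^esub> (c \<odot>\<^bsub>A\<^esub> x)" if y: "y \<in> I +>\<^bsub>A\<^esub> x" for y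
    proof -
      obtain i where i: "i \<in> I" "y = i \<oplus>\<^bsub>A\<^esub> x" using y by (auto simp: a_r_coset_def')
      have ic: "i \<in> carrier A" using i(1) a_subset by blast
      have "(c \<odot>\<^bsub>A\<^esub> \<one>\<^bsub>A\<^esub>) \<otimes>\<^bsub>A\<^esub> i \<in> I"
        by (rule I_l_closed[OF i(1)]) (simp add: k_algebra_smult[OF A])
      then have ci: "c \<odot>\<^bsub>A\<^esub> i \<in> I" using ic by (simp add: k_algebra_smult[OF A])
      have "c \<odot>\<^bsub>A\<^esub> y = c \<odot>\<^bsub>A\<^esub> i \<oplus>\<^bsub>A\<^esub> c \<odot>\<^bsub>A\<^esub> x" using i ic x by (simp add: k_algebra_smult[OF A])
      then have "c \<odot>\<^bsub>A\<^esub> y \<in> I +>\<^bsub>A\<^esub> (c \<odot>\<^bsub>A\<^esub> x)" using ci by (auto simp: a_r_coset_def')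
      then show ?thesis using x by (intro a_repr_independence[symmetric]) (simp_all add: k_algebra_smult[OF A] a_subgroup)
    qed
    then have "(\<Union>y\<in>I +>\<^bsub>A\<^esub> x. I +>\<^bsub>A\<^esub> (c \<odot>\<^bsub>A\<^esub> y)) = (\<Union>y\<in>I +>\<^bsub>A\<^esub> x. I +>\<^bsub>A\<^esub> (c \<odot>\<^bsub>A\<^esub> x))"
      by (rule SUP_cong[OF refl])
    moreover have "I +>\<^bsub>A\<^esub> x \<noteq> {}" using a_rcos_self[OF x] by blast
    ultimately show ?thesis by simp
  qed
  have carr: "carrier (quot_alg A I) = (+>\<^bsub>A\<^esub>) I ` carrier A"
    by (auto simp: quot_alg_def FactRing_def A_RCOSETS_def')
  have zero: "I +>\<^bsub>A\<^esub> \<zero>\<^bsub>A\<^esub> = I" by (rule a_coset_add_zero[OF a_subset])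
  show ?thesis
    unfolding alg_onto_def
  proof (intro conjI ballI allI)
    show "I +>\<^bsub>A\<^esub> \<zero>\<^bsub>A\<^esub> = \<zero>\<^bsub>quot_alg A I\<^esub>"
      using zero by (simp add: quot_alg_def FactRing_def)
    show "I +>\<^bsub>A\<^esub> (c \<odot>\<^bsub>A\<^esub> x) = c \<odot>\<^bsub>quot_alg A I\<^esub> (I +>\<^bsub>A\<^esub> x)" if "x \<in> carrier A" for c x
      using smult[OF that] by (simp add: quot_alg_def)
  qed (use carr ring_hom_mult[OF hom] ring_hom_add[OF hom] ring_hom_one[OF hom] in \<open>simp_all add: quot_alg_def\<close>)
qed

section \<open>The free algebra on words and its relators\<close>

lemma ind_span_alg: "x \<in> X \<Longrightarrow> ind x \<in> carrier (span_alg X m u)"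
  by (rule span_alg_carrierI) (auto simp: ind_def split: if_splits)

lemma free_alg_ind_mult:
  assumes "u \<in> lists (carrier G)" "v \<in> lists (carrier G)"
  shows "ind u \<otimes>\<^bsub>free_alg G\<^esub> ind v = (ind (u @ v) :: _ \<Rightarrow> 'k::field)"
proof
  fix z
  have "(ind u \<otimes>\<^bsub>free_alg G\<^esub> ind v) z
      = (\<Sum>x\<in>{u}. \<Sum>y\<in>{v}. if Some (x @ y) = Some z then ind u x * (ind v y :: 'k) else 0)"
    unfolding free_alg_def
    by (rule span_alg_mult_apply[OF ind_span_alg[OF assms(1)] ind_span_alg[OF assms(2)]])
       (auto simp: ind_def split: if_splits)
  then show "(ind u \<otimes>\<^bsub>free_alg G\<^esub> ind v) z = (ind (u @ v) z :: 'k)" by (auto simp: ind_def)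
qed

lemma free_alg_k_algebra: "k_algebra (free_alg G :: ('k::field, 'g list \<Rightarrow> 'k) module)"
proof -
  let ?A = "free_alg G :: ('k, 'g list \<Rightarrow> 'k) module"
  let ?s = "\<lambda>f. {w. f w \<noteq> (0::'k)}"
  have u: "ind [] \<in> carrier ?A" unfolding free_alg_def by (rule ind_span_alg) simp
  have fin: "finite (?s f)" if "f \<in> carrier ?A" for f using that by (auto simp: free_alg_def span_alg_def)
  have l: "ind [] \<otimes>\<^bsub>?A\<^esub> f = f" if f: "f \<in> carrier ?A" for f
  proof
    fix z
    have "(ind [] \<otimes>\<^bsub>?A\<^esub> f) z = (\<Sum>x\<in>{[]}. \<Sum>y\<in>?s f. if Some (x @ y) = Some z then ind [] x * f y else 0)"
      unfolding free_alg_def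
      by (rule span_alg_mult_apply) (use f u fin in \<open>auto simp: ind_def free_alg_def split: if_splits\<close>)
    then show "(ind [] \<otimes>\<^bsub>?A\<^esub> f) z = f z" using fin[OF f] by (simp add: ind_def)
  qed
  have r: "f \<otimes>\<^bsub>?A\<^esub> ind [] = f" if f: "f \<in> carrier ?A" for f
  proof
    fix z
    have "(f \<otimes>\<^bsub>?A\<^esub> ind []) z = (\<Sum>x\<in>?s f. \<Sum>y\<in>{[]}. if Some (x @ y) = Some z then f x * ind [] y else 0)"
      unfolding free_alg_def
      by (rule span_alg_mult_apply) (use f u fin in \<open>auto simp: ind_def free_alg_def split: if_splits\<close>)
    then show "(f \<otimes>\<^bsub>?A\<^esub> ind []) z = f z" using fin[OF f] by (simp add: ind_def)
  qed
  show ?thesis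
    using u l r unfolding free_alg_def by (intro span_alg_k_algebra) auto
qed

lemma par_rels_carrier:
  fixes G (structure)
  assumes "group G"
  shows "(par_rels G :: ('g list \<Rightarrow> 'k::field) set) \<subseteq> carrier (free_alg G)"
proof -
  interpret group G by fact
  interpret F: ring "free_alg G :: ('k, 'g list \<Rightarrow> 'k) module"
    by (rule k_algebra_ring[OF free_alg_k_algebra])
  have "ind w \<in> carrier (free_alg G :: ('k, 'g list \<Rightarrow> 'k) module)" if "w \<in> lists (carrier G)" for w
    unfolding free_alg_def by (rule ind_span_alg[OF that])
  then show ?thesis by (auto simp: par_rels_def intro!: F.minus_closed)
qed

text \<open>The partial representation of \<open>G\<close> on the functions on the subsets containing \<open>e\<close>,
  coming from the partial action of \<open>G\<close> by left translation; it shows that \<open>A\<^sub>p\<^sub>a\<^sub>r\<close> does not collapse.\<close>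

fun word_act :: "('g, 'm) monoid_scheme \<Rightarrow> 'g list \<Rightarrow> ('g set \<Rightarrow> 'k::field) \<Rightarrow> 'g set \<Rightarrow> 'k" where
  "word_act G [] \<phi> = \<phi>"
| "word_act G (g # w) \<phi> =
     (\<lambda>A. if A \<subseteq> carrier G \<and> \<one>\<^bsub>G\<^esub> \<in> A \<and> g \<in> A then word_act G w \<phi> (inv\<^bsub>G\<^esub> g <#\<^bsub>G\<^esub> A) else 0)"

definition free_act ::
    "('g, 'm) monoid_scheme \<Rightarrow> ('g list \<Rightarrow> 'k::field) \<Rightarrow> ('g set \<Rightarrow> 'k) \<Rightarrow> 'g set \<Rightarrow> 'k" where
  "free_act G f \<phi> = (\<lambda>A. \<Sum>w | f w \<noteq> 0. f w * word_act G w \<phi> A)"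

definition pointed_funs :: "('g, 'm) monoid_scheme \<Rightarrow> ('g set \<Rightarrow> 'k::field) set" where
  "pointed_funs G = {\<phi>. \<forall>A. \<not> (A \<subseteq> carrier G \<and> \<one>\<^bsub>G\<^esub> \<in> A) \<longrightarrow> \<phi> A = 0}"

lemma word_act_append: "word_act G (u @ v) \<phi> = word_act G u (word_act G v \<phi>)"
  by (induction u) auto

lemma word_act_sum:
  "word_act G u (\<lambda>A. \<Sum>i\<in>I. r i * \<psi> i A) A = (\<Sum>i\<in>I. r i * word_act G u (\<psi> i) A)"
proof (induction u arbitrary: A)
  case (Cons g u)
  define C where "C \<longleftrightarrow> A \<subseteq> carrier G \<and> \<one>\<^bsub>G\<^esub> \<in> A \<and> g \<in> A"
  show ?case by (cases C) (simp_all add: Cons C_def[symmetric])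
qed simp

lemma word_act_zero: "word_act G u (\<lambda>_. 0) = (\<lambda>_. 0)"
  by (induction u) auto

lemma word_act_pointed: "\<phi> \<in> pointed_funs G \<Longrightarrow> word_act G u \<phi> \<in> pointed_funs G"
  by (induction u) (auto simp: pointed_funs_def)

lemma free_act_superset:
  "finite S \<Longrightarrow> {w. f w \<noteq> 0} \<subseteq> S \<Longrightarrow> free_act G f \<phi> A = (\<Sum>w\<in>S. f w * word_act G w \<phi> A)"
  unfolding free_act_def by (rule sum.mono_neutral_left) auto

lemma free_act_ind: "free_act G (ind w) \<phi> = word_act G w \<phi>"
  by (rule ext, subst free_act_superset[of "{w}"]) (auto simp: ind_def split: if_splits)

lemma free_act_pointed: "\<phi> \<in> pointed_funs G \<Longrightarrow> free_act G f \<phi> \<in> pointed_funs G"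
  using word_act_pointed[of \<phi> G] by (auto simp: pointed_funs_def free_act_def)

lemma free_act_zero: "free_act G f (\<lambda>_. 0) = (\<lambda>_. 0)"
  by (auto simp: free_act_def word_act_zero)

lemma free_act_add:
  assumes "f \<in> carrier (free_alg G)" "f' \<in> carrier (free_alg G)"
  shows "free_act G (f \<oplus>\<^bsub>free_alg G\<^esub> f') \<phi> A = free_act G f \<phi> A + free_act G f' \<phi> A"
proof -
  let ?S = "{w. f w \<noteq> 0} \<union> {w. f' w \<noteq> 0}"
  have S: "finite ?S" using assms by (auto simp: free_alg_def span_alg_def)
  show ?thesis
    by (subst (1 2 3) free_act_superset[OF S])
       (auto simp: free_alg_def span_alg_def sum.distrib distrib_right)
qed

text \<open>At a fixed set A, \<open>free_act\<close> is the linear functional with value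
  \<open>word_act G w \<phi> A\<close> at the word \<open>w\<close>. So
  \<open>span_alg_pairing\<close> applies, and concatenation of words composes their
  actions.\<close>

lemma free_act_mult:
  fixes f f' :: "'g list \<Rightarrow> 'k::field"
  assumes "f \<in> carrier (free_alg G)" "f' \<in> carrier (free_alg G)"
  shows "free_act G (f \<otimes>\<^bsub>free_alg G\<^esub> f') \<phi> = free_act G f (free_act G f' \<phi>)"
proof
  fix A
  let ?p = "f \<otimes>\<^bsub>free_alg G\<^esub> f'"
  have fin: "finite {w. f w \<noteq> 0}" if "f \<in> carrier (free_alg G)" for f :: "'g list \<Rightarrow> 'k"
    using that by (auto simp: free_alg_def span_alg_def)
  have p: "?p \<in> carrier (free_alg G)"
    using k_algebra_ring[OF free_alg_k_algebra] assms by (intro monoid.m_closed) (auto simp: ring_def)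
  have "free_act G ?p \<phi> A
      = (\<Sum>u | f u \<noteq> 0. \<Sum>v | f' v \<noteq> 0. f u * f' v * (case Some (u @ v) of None \<Rightarrow> 0 | Some w \<Rightarrow> word_act G w \<phi> A))"
    unfolding free_act_def
    using assms fin p unfolding free_alg_def by (intro span_alg_pairing) auto
  also have "\<dots> = free_act G f (free_act G f' \<phi>) A"
    by (simp add: free_act_def word_act_append word_act_sum sum_distrib_left mult.assoc)
  finally show "free_act G ?p \<phi> A = free_act G f (free_act G f' \<phi>) A" .
qed

text \<open>All conditions can be read off at the initial pointed set A. In the second relation both
  words require g and gh to lie in A and evaluate \<open>\<phi>\<close> at
  \<open>inv g <# A\<close>. In the third both require \<open>inv g\<close> and h to lie in A and
  evaluate at \<open>inv h <# A\<close>. The first holds because \<open>\<phi>\<close> vanishes off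
  the pointed sets.\<close>

lemma par_rels_act:
  fixes G (structure) and \<phi> :: "'g set \<Rightarrow> 'k::field"
  assumes "group G" and \<phi>: "\<phi> \<in> pointed_funs G"
  shows "word_act G [\<one>] \<phi> = \<phi>"
    and "g \<in> carrier G \<Longrightarrow> h \<in> carrier G \<Longrightarrow> word_act G [g, h, inv h] \<phi> = word_act G [g \<otimes> h, inv h] \<phi>"
    and "g \<in> carrier G \<Longrightarrow> h \<in> carrier G \<Longrightarrow> word_act G [inv g, g, h] \<phi> = word_act G [inv g, g \<otimes> h] \<phi>"
proof -
  interpret group G by fact
  have sub: "g <# A \<subseteq> carrier G" if "g \<in> carrier G" "A \<subseteq> carrier G" for g A
    using that by (rule l_coset_subset_G[rotated])
  have assoc: "g <# (h <# A) = (g \<otimes> h) <# A" if "g \<in> carrier G" "h \<in> carrier G" "A \<subseteq> carrier G" for g h A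
    using that by (intro lcos_m_assoc)
  show "word_act G [\<one>] \<phi> = \<phi>"
    using \<phi> by (auto simp: pointed_funs_def lcos_mult_one)
  show "word_act G [g, h, inv h] \<phi> = word_act G [g \<otimes> h, inv h] \<phi>"
    if "g \<in> carrier G" "h \<in> carrier G"
    using that by (auto simp: fun_eq_iff sub assoc l_coset_mem inv_mult_group m_assoc inv_cancel_left)
  show "word_act G [inv g, g, h] \<phi> = word_act G [inv g, g \<otimes> h] \<phi>"
    if "g \<in> carrier G" "h \<in> carrier G"
    using that by (auto simp: fun_eq_iff sub assoc l_coset_mem inv_mult_group m_assoc inv_cancel_left)
qed

text \<open>The elements that annihilate every pointed function form a two-sided ideal; right
  multiples stay in it because \<open>free_act\<close> preserves \<open>pointed_funs\<close>. It
  contains the relators, hence the ideal that they generate.\<close>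

lemma par_ideal_act:
  fixes G (structure) and \<phi> :: "'g set \<Rightarrow> 'k::field"
  assumes "group G" and f: "f \<in> Idl\<^bsub>free_alg G\<^esub> (par_rels G)" and \<phi>: "\<phi> \<in> pointed_funs G"
  shows "free_act G f \<phi> = (\<lambda>_. 0)"
proof -
  interpret group G by fact
  let ?A = "free_alg G :: ('k, 'g list \<Rightarrow> 'k) module"
  interpret F: ring ?A by (rule k_algebra_ring[OF free_alg_k_algebra])
  let ?J = "{f \<in> carrier ?A. \<forall>\<phi>\<in>pointed_funs G. free_act G f \<phi> = (\<lambda>_. 0)}"
  have z: "free_act G \<zero>\<^bsub>?A\<^esub> \<phi> = (\<lambda>_. 0)" for \<phi>
    by (simp add: free_act_def free_alg_def span_alg_def)
  have minus: "free_act G (a \<ominus>\<^bsub>?A\<^esub> b) \<phi> A = free_act G a \<phi> A - free_act G b \<phi> A"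
    if "a \<in> carrier ?A" "b \<in> carrier ?A" for a b \<phi> A
  proof -
    have "(a \<ominus>\<^bsub>?A\<^esub> b) \<oplus>\<^bsub>?A\<^esub> b = a" using that by (simp add: F.minus_eq F.a_assoc F.l_neg)
    then show ?thesis using free_act_add[of "a \<ominus>\<^bsub>?A\<^esub> b" G b \<phi> A] that by simp
  qed
  have neg: "\<ominus>\<^bsub>?A\<^esub> a = \<zero>\<^bsub>?A\<^esub> \<ominus>\<^bsub>?A\<^esub> a" if "a \<in> carrier ?A" for a
    using that by (simp add: F.minus_eq)
  have "ideal ?J ?A"
  proof (rule idealI[OF F.ring_axioms])
    show "subgroup ?J (add_monoid ?A)"
    proof (rule F.add.subgroupI)
      show "\<ominus>\<^bsub>?A\<^esub> a \<in> ?J" if "a \<in> ?J" for a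
        using that by (auto simp: neg minus z)
      show "a \<oplus>\<^bsub>?A\<^esub> b \<in> ?J" if "a \<in> ?J" "b \<in> ?J" for a b
        using that by (auto simp: free_act_add fun_eq_iff)
    qed (use z in auto)
    show "x \<otimes>\<^bsub>?A\<^esub> a \<in> ?J" "a \<otimes>\<^bsub>?A\<^esub> x \<in> ?J" if "a \<in> ?J" "x \<in> carrier ?A" for a x
      using that by (auto simp: free_act_mult free_act_zero free_act_pointed)
  qed
  moreover have "par_rels G \<subseteq> ?J"
  proof -
    have ic: "ind w \<in> carrier ?A" if "w \<in> lists (carrier G)" for w
      unfolding free_alg_def by (rule ind_span_alg[OF that])
    have J: "ind u \<ominus>\<^bsub>?A\<^esub> ind v \<in> ?J" if "u \<in> lists (carrier G)" "v \<in> lists (carrier G)"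
      "\<And>\<phi> :: 'g set \<Rightarrow> 'k. \<phi> \<in> pointed_funs G \<Longrightarrow> word_act G u \<phi> = word_act G v \<phi>" for u v
    proof -
      have "free_act G (ind u \<ominus>\<^bsub>?A\<^esub> ind v) \<phi> = (\<lambda>_. 0)" if "\<phi> \<in> pointed_funs G" for \<phi> :: "'g set \<Rightarrow> 'k"
        by (rule ext) (simp add: minus ic \<open>u \<in> _\<close> \<open>v \<in> _\<close> free_act_ind \<open>\<And>\<phi>. _ \<Longrightarrow> word_act G u \<phi> = word_act G v \<phi>\<close> that)
      then show ?thesis using ic that(1,2) by simp
    qed
    have "ind [\<one>] \<ominus>\<^bsub>?A\<^esub> ind [] \<in> ?J"
      by (rule J) (simp_all only: par_rels_act[OF assms(1)] word_act.simps(1), simp_all)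
    moreover have "ind [g, h, inv h] \<ominus>\<^bsub>?A\<^esub> ind [g \<otimes> h, inv h] \<in> ?J"
 if "g \<in> carrier G" "h \<in> carrier G" for g h
      by (rule J) (simp_all only: par_rels_act(2)[OF assms(1) _ that], simp_all add: that)
    moreover have "ind [inv g, g, h] \<ominus>\<^bsub>?A\<^esub> ind [inv g, g \<otimes> h] \<in> ?J" if "g \<in> carrier G" "h \<in> carrier G" for g h
      by (rule J) (simp_all only: par_rels_act(3)[OF assms(1) _ that], simp_all add: that)
    ultimately show ?thesis unfolding par_rels_def by blast
  qed
  ultimately have "Idl\<^bsub>?A\<^esub> (par_rels G) \<subseteq> ?J" by (rule F.genideal_minimal)
  then show ?thesis using f \<phi> by blast
qed

section \<open>Descent of the representation to the partial group algebra\<close>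

definition par_class :: "('g, 'm) monoid_scheme \<Rightarrow> ('g list \<Rightarrow> 'k::field) \<Rightarrow> ('g list \<Rightarrow> 'k) set" where
  "par_class G f = (Idl\<^bsub>free_alg G\<^esub> (par_rels G)) +>\<^bsub>free_alg G\<^esub> f"

lemma par_class_onto:
  fixes G :: "('g, 'm) monoid_scheme" (structure)
  assumes "group G"
  shows "alg_onto (free_alg G) (k_par G :: ('k::field, _) module) (par_class G)"
proof -
  interpret F: ring "free_alg G :: ('k, 'g list \<Rightarrow> 'k) module"
    by (rule k_algebra_ring[OF free_alg_k_algebra])
  show ?thesis
    unfolding k_par_def par_class_def
    by (rule quot_alg_onto[OF free_alg_k_algebra F.genideal_ideal[OF par_rels_carrier[OF assms]]])
qed

lemma k_par_k_algebra: "group G \<Longrightarrow> k_algebra (k_par G :: ('k::field, _) module)"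
  by (rule k_algebra_image[OF free_alg_k_algebra par_class_onto])

text \<open>A coset acts through a chosen representative. Independence of the choice is available on
  \<open>pointed_funs\<close>, where the ideal of relators acts by zero; hence the assumption on
  \<open>\<phi>\<close> in the laws below.\<close>

definition par_rep ::
    "('g, 'm) monoid_scheme \<Rightarrow> ('g list \<Rightarrow> 'k::field) set \<Rightarrow> ('g set \<Rightarrow> 'k) \<Rightarrow> 'g set \<Rightarrow> 'k" where
  "par_rep G a = free_act G (SOME f. f \<in> carrier (free_alg G) \<and> par_class G f = a)"

context
  fixes G :: "('g, 'm) monoid_scheme" (structure)
  assumes G: "group G"
begin

lemma par_class_eq:
  fixes f f' :: "'g list \<Rightarrow> 'k::field"
  assumes "f \<in> carrier (free_alg G)" "f' \<in> carrier (free_alg G)"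
  shows "par_class G f = par_class G f' \<longleftrightarrow> f \<ominus>\<^bsub>free_alg G\<^esub> f' \<in> Idl\<^bsub>free_alg G\<^esub> (par_rels G)"
proof -
  interpret F: ring "free_alg G :: ('k, 'g list \<Rightarrow> 'k) module"
    by (rule k_algebra_ring[OF free_alg_k_algebra])
  show ?thesis
    unfolding par_class_def
    using F.quotient_eq_iff_same_a_r_cos[OF F.genideal_ideal[OF par_rels_carrier[OF G]]] assms by blast
qed

lemma par_rep_class:
  fixes \<phi> :: "'g set \<Rightarrow> 'k::field"
  assumes f: "f \<in> carrier (free_alg G)" and \<phi>: "\<phi> \<in> pointed_funs G"
  shows "par_rep G (par_class G f) \<phi> = free_act G f \<phi>"
proof -
  interpret F: ring "free_alg G :: ('k, 'g list \<Rightarrow> 'k) module"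
    by (rule k_algebra_ring[OF free_alg_k_algebra])
  define f' where "f' = (SOME f'. f' \<in> carrier (free_alg G) \<and> par_class G f' = par_class G f)"
  have f': "f' \<in> carrier (free_alg G)" "par_class G f' = par_class G f"
    unfolding f'_def using someI[of "\<lambda>f'. f' \<in> carrier (free_alg G) \<and> par_class G f' = par_class G f" f] f by auto
  let ?d = "f' \<ominus>\<^bsub>free_alg G\<^esub> f"
  have d: "free_act G ?d \<phi> = (\<lambda>_. 0)"
    by (rule par_ideal_act[OF G _ \<phi>]) (use par_class_eq[OF f'(1) f] f' in blast)
  have "?d \<oplus>\<^bsub>free_alg G\<^esub> f = f'" using f f' by (simp add: F.minus_eq F.a_assoc F.l_neg)
  then have "free_act G f' \<phi> A = free_act G f \<phi> A" for A
    using free_act_add[of ?d G f \<phi> A] f f' d by simp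
  then show ?thesis by (simp add: par_rep_def f'_def fun_eq_iff)
qed

lemma par_gen_class: "par_gen G g = par_class G (ind [g])"
  by (simp add: par_gen_def par_class_def)

lemma par_class_surj:
  assumes "a \<in> carrier (k_par G :: ('k::field, _) module)"
  obtains f where "f \<in> carrier (free_alg G)" "a = par_class G f"
proof -
  have "a \<in> par_class G ` carrier (free_alg G)"
    using par_class_onto[OF G, where 'k = 'k] assms by (simp add: alg_onto_def)
  then show thesis using that by blast
qed

lemma par_rep_zero_fun: "par_rep G a (\<lambda>_. 0) = (\<lambda>_. 0)"
  by (simp add: par_rep_def free_act_zero)

lemma par_rep_mult:
  fixes \<phi> :: "'g set \<Rightarrow> 'k::field"
  assumes "a \<in> carrier (k_par G)" "b \<in> carrier (k_par G)" and \<phi>: "\<phi> \<in> pointed_funs G"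
  shows "par_rep G (a \<otimes>\<^bsub>k_par G\<^esub> b) \<phi> = par_rep G a (par_rep G b \<phi>)"
proof -
  interpret F: ring "free_alg G :: ('k, 'g list \<Rightarrow> 'k) module"
    by (rule k_algebra_ring[OF free_alg_k_algebra])
  obtain f f' where f: "f \<in> carrier (free_alg G)" "a = par_class G f" "f' \<in> carrier (free_alg G)" "b = par_class G f'"
    using par_class_surj assms by metis
  have "a \<otimes>\<^bsub>k_par G\<^esub> b = par_class G (f \<otimes>\<^bsub>free_alg G\<^esub> f')"
    using par_class_onto[OF G, where 'k = 'k] f by (simp add: alg_onto_def)
  then show ?thesis
    using f \<phi> by (simp add: par_rep_class free_act_mult free_act_pointed)
qed

lemma par_rep_add:
  fixes \<phi> :: "'g set \<Rightarrow> 'k::field"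
  assumes "a \<in> carrier (k_par G)" "b \<in> carrier (k_par G)" and \<phi>: "\<phi> \<in> pointed_funs G"
  shows "par_rep G (a \<oplus>\<^bsub>k_par G\<^esub> b) \<phi> A = par_rep G a \<phi> A + par_rep G b \<phi> A"
proof -
  interpret F: ring "free_alg G :: ('k, 'g list \<Rightarrow> 'k) module"
    by (rule k_algebra_ring[OF free_alg_k_algebra])
  obtain f f' where f: "f \<in> carrier (free_alg G)" "a = par_class G f" "f' \<in> carrier (free_alg G)" "b = par_class G f'"
    using par_class_surj assms by metis
  have "a \<oplus>\<^bsub>k_par G\<^esub> b = par_class G (f \<oplus>\<^bsub>free_alg G\<^esub> f')"
    using par_class_onto[OF G, where 'k = 'k] f by (simp add: alg_onto_def)
  then show ?thesis
    using f \<phi> by (simp add: par_rep_class free_act_add)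
qed

lemma par_rep_zero_one:
  fixes \<phi> :: "'g set \<Rightarrow> 'k::field"
  assumes \<phi>: "\<phi> \<in> pointed_funs G"
  shows "par_rep G \<zero>\<^bsub>k_par G\<^esub> \<phi> = (\<lambda>_. 0)" "par_rep G \<one>\<^bsub>k_par G\<^esub> \<phi> = \<phi>"
proof -
  interpret F: ring "free_alg G :: ('k, 'g list \<Rightarrow> 'k) module"
    by (rule k_algebra_ring[OF free_alg_k_algebra])
  note onto = par_class_onto[OF G, where 'k = 'k, unfolded alg_onto_def]
  have z: "\<zero>\<^bsub>k_par G\<^esub> = par_class G (\<zero>\<^bsub>free_alg G :: ('k, 'g list \<Rightarrow> 'k) module\<^esub>)"
    and o: "\<one>\<^bsub>k_par G\<^esub> = par_class G (\<one>\<^bsub>free_alg G :: ('k, 'g list \<Rightarrow> 'k) module\<^esub>)"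
    using onto by simp_all
  show "par_rep G \<zero>\<^bsub>k_par G\<^esub> \<phi> = (\<lambda>_. 0)"
    unfolding z par_rep_class[OF F.zero_closed \<phi>] by (simp add: free_act_def free_alg_def span_alg_def)
  have "free_act G \<one>\<^bsub>free_alg G\<^esub> \<phi> = \<phi>"
    using free_act_ind[of G "[]" \<phi>] by (simp add: free_alg_def span_alg_def)
  then show "par_rep G \<one>\<^bsub>k_par G\<^esub> \<phi> = \<phi>"
    unfolding o par_rep_class[OF F.one_closed \<phi>] .
qed

lemma par_gen_closed: "g \<in> carrier G \<Longrightarrow> par_gen G g \<in> carrier (k_par G :: ('k::field, _) module)"
  using par_class_onto[OF G, where 'k = 'k] ind_span_alg[of "[g]" "lists (carrier G)"]
  by (auto simp: par_gen_class alg_onto_def free_alg_def)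

lemma par_rep_gen:
  fixes \<phi> :: "'g set \<Rightarrow> 'k::field"
  assumes "\<phi> \<in> pointed_funs G" "g \<in> carrier G"
  shows "par_rep G (par_gen G g) \<phi> = word_act G [g] \<phi>"
proof -
  have "ind [g] \<in> carrier (free_alg G :: ('k, _) module)"
    unfolding free_alg_def using assms by (intro ind_span_alg) simp
  then show ?thesis using assms by (simp only: par_gen_class par_rep_class free_act_ind)
qed

lemma par_gen_relations:
  shows "par_gen G \<one> = \<one>\<^bsub>k_par G :: ('k::field, _) module\<^esub>"
    and "g \<in> carrier G \<Longrightarrow> h \<in> carrier G \<Longrightarrow>
      par_gen G g \<otimes>\<^bsub>k_par G\<^esub> par_gen G h \<otimes>\<^bsub>k_par G\<^esub> par_gen G (inv h)
      = (par_gen G (g \<otimes> h) \<otimes>\<^bsub>k_par G\<^esub> par_gen G (inv h) :: ('g list \<Rightarrow> 'k) set)"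
    and "g \<in> carrier G \<Longrightarrow> h \<in> carrier G \<Longrightarrow>
      par_gen G (inv g) \<otimes>\<^bsub>k_par G\<^esub> par_gen G g \<otimes>\<^bsub>k_par G\<^esub> par_gen G h
      = (par_gen G (inv g) \<otimes>\<^bsub>k_par G\<^esub> par_gen G (g \<otimes> h) :: ('g list \<Rightarrow> 'k) set)"
proof -
  interpret group G by (rule G)
  let ?A = "free_alg G :: ('k, 'g list \<Rightarrow> 'k) module"
  interpret F: ring ?A by (rule k_algebra_ring[OF free_alg_k_algebra])
  note onto = par_class_onto[OF G, where 'k = 'k, unfolded alg_onto_def]
  have ic: "ind w \<in> carrier ?A" if "w \<in> lists (carrier G)" for w
    unfolding free_alg_def by (rule ind_span_alg[OF that])
  have mult: "par_class G (ind u) \<otimes>\<^bsub>k_par G\<^esub> par_class G (ind v) = par_class G (ind (u @ v) :: _ \<Rightarrow> 'k)"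
    if "u \<in> lists (carrier G)" "v \<in> lists (carrier G)" for u v
    using onto ic[OF that(1)] ic[OF that(2)] by (simp add: free_alg_ind_mult[OF that, symmetric])
  have rel: "par_class G (ind u) = par_class G (ind v :: _ \<Rightarrow> 'k)"
    if "u \<in> lists (carrier G)" "v \<in> lists (carrier G)" "ind u \<ominus>\<^bsub>?A\<^esub> ind v \<in> par_rels G" for u v
    using that F.genideal_self[OF par_rels_carrier[OF G]] by (subst par_class_eq[OF ic ic]) auto
  have one: "\<one>\<^bsub>k_par G\<^esub> = par_class G (ind [] :: _ \<Rightarrow> 'k)"
    using onto by (simp add: free_alg_def span_alg_def)
  show "par_gen G \<one> = \<one>\<^bsub>k_par G :: ('k, _) module\<^esub>"
    unfolding one par_gen_class by (rule rel) (auto simp: par_rels_def)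
  show "par_gen G g \<otimes>\<^bsub>k_par G\<^esub> par_gen G h \<otimes>\<^bsub>k_par G\<^esub> par_gen G (inv h)
      = (par_gen G (g \<otimes> h) \<otimes>\<^bsub>k_par G\<^esub> par_gen G (inv h) :: ('g list \<Rightarrow> 'k) set)"
    if gh: "g \<in> carrier G" "h \<in> carrier G"
  proof -
    have "par_class G (ind [g, h, inv h]) = par_class G (ind [g \<otimes> h, inv h] :: _ \<Rightarrow> 'k)"
      by (rule rel) (use gh in \<open>auto simp: par_rels_def\<close>)
    then show ?thesis using gh by (simp add: par_gen_class mult)
  qed
  show "par_gen G (inv g) \<otimes>\<^bsub>k_par G\<^esub> par_gen G g \<otimes>\<^bsub>k_par G\<^esub> par_gen G h
      = (par_gen G (inv g) \<otimes>\<^bsub>k_par G\<^esub> par_gen G (g \<otimes> h) :: ('g list \<Rightarrow> 'k) set)"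
    if gh: "g \<in> carrier G" "h \<in> carrier G"
  proof -
    have "par_class G (ind [inv g, g, h]) = par_class G (ind [inv g, g \<otimes> h] :: _ \<Rightarrow> 'k)"
      by (rule rel) (use gh in \<open>auto simp: par_rels_def\<close>)
    then show ?thesis using gh by (simp add: par_gen_class mult)
  qed
qed

end

section \<open>The idempotent basis of \<open>A\<^sub>p\<^sub>a\<^sub>r\<close>\<close>

lemma subalgebra_of_carrier:
  assumes "k_algebra K" shows "subalgebra_of K (carrier K)"
proof -
  interpret ring K by (rule k_algebra_ring[OF assms])
  show ?thesis by (simp add: subalgebra_of_def subspace_of_def k_algebra_smult(1)[OF assms])
qed

lemma subalgebra_of_hull:
  assumes "k_algebra K" "S \<subseteq> carrier K"
  shows "subalgebra_of K (subalgebra_of K hull S)"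
proof -
  let ?H = "subalgebra_of K hull S"
  have D: "x \<in> T" if "x \<in> ?H" "subalgebra_of K T" "S \<subseteq> T" for x T
    using that by (auto simp: hull_def)
  have I: "x \<in> ?H" if "\<And>T. subalgebra_of K T \<Longrightarrow> S \<subseteq> T \<Longrightarrow> x \<in> T" for x
    using that by (auto simp: hull_def)
  have cl: "\<zero>\<^bsub>K\<^esub> \<in> T" "\<one>\<^bsub>K\<^esub> \<in> T" "x \<in> T \<Longrightarrow> y \<in> T \<Longrightarrow> x \<oplus>\<^bsub>K\<^esub> y \<in> T"
    "x \<in> T \<Longrightarrow> y \<in> T \<Longrightarrow> x \<otimes>\<^bsub>K\<^esub> y \<in> T" "x \<in> T \<Longrightarrow> c \<odot>\<^bsub>K\<^esub> x \<in> T"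
    if "subalgebra_of K T" for T x y c
    using that by (simp_all add: subalgebra_of_def subspace_of_def)
  show ?thesis
    unfolding subalgebra_of_def[of K ?H] subspace_of_def[of K ?H]
  proof (intro conjI subsetI ballI allI)
    show "x \<in> carrier K" if "x \<in> ?H" for x
      using D[OF that subalgebra_of_carrier[OF assms(1)] assms(2)] .
    show "\<zero>\<^bsub>K\<^esub> \<in> ?H" "\<one>\<^bsub>K\<^esub> \<in> ?H" by (rule I; rule cl; assumption)+
    show "x \<oplus>\<^bsub>K\<^esub> y \<in> ?H" "x \<otimes>\<^bsub>K\<^esub> y \<in> ?H" if "x \<in> ?H" "y \<in> ?H" for x y
      by (rule I, rule cl, assumption, rule D[OF that(1)], assumption+, rule D[OF that(2)], assumption+)+
    show "c \<odot>\<^bsub>K\<^esub> x \<in> ?H" if "x \<in> ?H" for c x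
      by (rule I, rule cl, assumption, rule D[OF that], assumption+)
  qed
qed

lemma subspace_of_finsum:
  assumes K: "k_algebra K" and S: "subspace_of K S" and I: "finite I" "\<And>i. i \<in> I \<Longrightarrow> f i \<in> S"
  shows "(\<Oplus>\<^bsub>K\<^esub>i\<in>I. f i) \<in> S"
proof -
  interpret ring K by (rule k_algebra_ring[OF K])
  have sub: "S \<subseteq> carrier K" using S by (simp add: subspace_of_def)
  show ?thesis using I
  proof (induction I rule: finite_induct)
    case (insert i I)
    then show ?case using S sub by (subst finsum_insert) (auto simp: subspace_of_def Pi_iff)
  qed (use S in \<open>simp add: subspace_of_def\<close>)
qed

definition pointed_sets :: "('g, 'm) monoid_scheme \<Rightarrow> 'g set set" where
  "pointed_sets G = {A. A \<subseteq> carrier G \<and> \<one>\<^bsub>G\<^esub> \<in> A}"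

lemma pointed_sets_nesubsets: "pointed_sets G \<subseteq> nesubsets G"
  by (auto simp: pointed_sets_def nesubsets_def)

text \<open>Isolates what follows from the relations alone. No idempotent can be shown to be nonzero
  in this generality: if every \<open>p g\<close> is the unit, then \<open>idem A\<close> vanishes
  for every proper subset A of the group.\<close>

locale partial_rep = group G for G :: "('g, 'm) monoid_scheme" (structure) +
  fixes K :: "('k::field, 'a) module" and p :: "'g \<Rightarrow> 'a"
  assumes fin: "finite (carrier G)"
    and K: "k_algebra K"
    and p_closed [simp]: "g \<in> carrier G \<Longrightarrow> p g \<in> carrier K"
    and p_one: "p \<one> = \<one>\<^bsub>K\<^esub>"
    and p_right: "g \<in> carrier G \<Longrightarrow> h \<in> carrier G \<Longrightarrow>
      p g \<otimes>\<^bsub>K\<^esub> p h \<otimes>\<^bsub>K\<^esub> p (inv h) = p (g \<otimes> h) \<otimes>\<^bsub>K\<^esub> p (inv h)"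
    and p_left: "g \<in> carrier G \<Longrightarrow> h \<in> carrier G \<Longrightarrow>
      p (inv g) \<otimes>\<^bsub>K\<^esub> p g \<otimes>\<^bsub>K\<^esub> p h = p (inv g) \<otimes>\<^bsub>K\<^esub> p (g \<otimes> h)"
begin

sublocale K: ring K by (rule k_algebra_ring[OF K])

definition e :: "'g \<Rightarrow> 'a" where
  "e g = p g \<otimes>\<^bsub>K\<^esub> p (inv g)"

definition idem_alg :: "'a set" where
  "idem_alg = subalgebra_of K hull {e g | g. g \<in> carrier G}"

lemma e_closed [simp]: "g \<in> carrier G \<Longrightarrow> e g \<in> carrier K"
  by (simp add: e_def)

text \<open>Both sides equal p(gh) p(inv h), one by \<open>p_right\<close> and the other by
  \<open>p_left\<close>. This is the rule for moving idempotents across generators.\<close>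

lemma p_e:
  assumes "g \<in> carrier G" "h \<in> carrier G"
  shows "p g \<otimes>\<^bsub>K\<^esub> e h = e (g \<otimes> h) \<otimes>\<^bsub>K\<^esub> p g"
proof -
  have "inv (g \<otimes> h) \<otimes> g = inv h" using assms by (simp add: inv_mult_group m_assoc)
  then have "e (g \<otimes> h) \<otimes>\<^bsub>K\<^esub> p g = p (g \<otimes> h) \<otimes>\<^bsub>K\<^esub> p (inv h)"
    using p_left[of "inv (g \<otimes> h)" g] assms by (simp add: e_def)
  also have "\<dots> = p g \<otimes>\<^bsub>K\<^esub> e h"
    using p_right[of g h] assms by (simp add: e_def K.m_assoc)
  finally show ?thesis by simp
qed

lemma e_p: "g \<in> carrier G \<Longrightarrow> e g \<otimes>\<^bsub>K\<^esub> p g = p g"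
  using p_left[of "inv g" g] by (simp add: e_def p_one)

lemma p_e_inv: "g \<in> carrier G \<Longrightarrow> p g \<otimes>\<^bsub>K\<^esub> e (inv g) = p g"
  using e_p[of g] by (simp add: e_def K.m_assoc)

lemma e_one: "e \<one> = \<one>\<^bsub>K\<^esub>"
  by (simp add: e_def p_one)

lemma e_idem: "g \<in> carrier G \<Longrightarrow> e g \<otimes>\<^bsub>K\<^esub> e g = e g"
  using e_p[of g] by (simp add: e_def K.m_assoc[symmetric])

text \<open>With \<open>e g\<close> written as p(g) p(inv g), \<open>p_e\<close> moves
  \<open>e h\<close> across both factors; its index changes from h to
  \<open>inv g \<otimes> h\<close> and back.\<close>

lemma e_comm:
  assumes "g \<in> carrier G" "h \<in> carrier G"
  shows "e g \<otimes>\<^bsub>K\<^esub> e h = e h \<otimes>\<^bsub>K\<^esub> e g"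
proof -
  have "e g \<otimes>\<^bsub>K\<^esub> e h = p g \<otimes>\<^bsub>K\<^esub> (p (inv g) \<otimes>\<^bsub>K\<^esub> e h)" using assms by (simp add: e_def K.m_assoc)
  also have "\<dots> = p g \<otimes>\<^bsub>K\<^esub> e (inv g \<otimes> h) \<otimes>\<^bsub>K\<^esub> p (inv g)" using assms p_e[of "inv g" h] by (simp add: K.m_assoc)
  also have "\<dots> = e h \<otimes>\<^bsub>K\<^esub> p g \<otimes>\<^bsub>K\<^esub> p (inv g)" using assms p_e[of g "inv g \<otimes> h"] by (simp add: inv_cancel_left)
  also have "\<dots> = e h \<otimes>\<^bsub>K\<^esub> e g" using assms by (simp add: e_def K.m_assoc)
  finally show ?thesis .
qed

lemma idem_alg_subalgebra: "subalgebra_of K idem_alg"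
  unfolding idem_alg_def by (rule subalgebra_of_hull[OF K]) auto

lemma e_idem_alg: "g \<in> carrier G \<Longrightarrow> e g \<in> idem_alg"
  unfolding idem_alg_def by (rule hull_inc) blast

lemma idem_alg_closed:
  shows "idem_alg \<subseteq> carrier K" "\<one>\<^bsub>K\<^esub> \<in> idem_alg" "\<zero>\<^bsub>K\<^esub> \<in> idem_alg"
    and "a \<in> idem_alg \<Longrightarrow> b \<in> idem_alg \<Longrightarrow> a \<otimes>\<^bsub>K\<^esub> b \<in> idem_alg"
    and "a \<in> idem_alg \<Longrightarrow> b \<in> idem_alg \<Longrightarrow> a \<oplus>\<^bsub>K\<^esub> b \<in> idem_alg"
    and "a \<in> idem_alg \<Longrightarrow> c \<odot>\<^bsub>K\<^esub> a \<in> idem_alg"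
  using idem_alg_subalgebra by (auto simp: subalgebra_of_def subspace_of_def)

text \<open>\<open>P A\<close> is the product of the \<open>e h\<close> for h in A and of the
  complements 1 - \<open>e h\<close> for h in S outside A, built one factor at a time. Commutation
  with every \<open>e h\<close> is carried along so that the eigenvalue equations also hold on the
  right.\<close>

lemma idem_family:
  assumes "finite S" "S \<subseteq> carrier G"
  shows "\<exists>P. (\<forall>A\<in>Pow S. P A \<in> idem_alg \<and> (\<forall>h\<in>carrier G. e h \<otimes>\<^bsub>K\<^esub> P A = P A \<otimes>\<^bsub>K\<^esub> e h) \<and>
      (\<forall>h\<in>S. e h \<otimes>\<^bsub>K\<^esub> P A = (if h \<in> A then P A else \<zero>\<^bsub>K\<^esub>))) \<and> (\<Oplus>\<^bsub>K\<^esub>A\<in>Pow S. P A) = \<one>\<^bsub>K\<^esub>"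
  using assms
proof (induction S rule: finite_induct)
  case empty
  show ?case
    by (rule exI[of _ "\<lambda>_. \<one>\<^bsub>K\<^esub>"]) (use idem_alg_closed in simp)
next
  case (insert x S)
  have "S \<subseteq> carrier G" using insert.prems by auto
  then obtain P where P0: "\<forall>A\<in>Pow S. P A \<in> idem_alg \<and> (\<forall>h\<in>carrier G. e h \<otimes>\<^bsub>K\<^esub> P A = P A \<otimes>\<^bsub>K\<^esub> e h) \<and>
      (\<forall>h\<in>S. e h \<otimes>\<^bsub>K\<^esub> P A = (if h \<in> A then P A else \<zero>\<^bsub>K\<^esub>))"
    and P1: "(\<Oplus>\<^bsub>K\<^esub>A\<in>Pow S. P A) = \<one>\<^bsub>K\<^esub>"
    using insert.IH by blast
  have P: "\<And>A. A \<subseteq> S \<Longrightarrow> P A \<in> idem_alg"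
    "\<And>A h. A \<subseteq> S \<Longrightarrow> h \<in> carrier G \<Longrightarrow> e h \<otimes>\<^bsub>K\<^esub> P A = P A \<otimes>\<^bsub>K\<^esub> e h"
    "\<And>A h. A \<subseteq> S \<Longrightarrow> h \<in> S \<Longrightarrow> e h \<otimes>\<^bsub>K\<^esub> P A = (if h \<in> A then P A else \<zero>\<^bsub>K\<^esub>)"
    using P0 by blast+
  have x: "x \<in> carrier G" "x \<notin> S" and S: "S \<subseteq> carrier G" using insert by auto
  \<comment> \<open>The idempotent complementary to \<open>e x\<close>, written with the scalar -1
    because \<open>subalgebra_of\<close> provides closure under scalars rather than under
    negatives.\<close>
  define f where "f = \<one>\<^bsub>K\<^esub> \<oplus>\<^bsub>K\<^esub> (- 1) \<odot>\<^bsub>K\<^esub> e x"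
  have ex: "e x \<in> carrier K" using x by simp
  have mx: "(- 1) \<odot>\<^bsub>K\<^esub> e x \<in> carrier K" by (rule k_algebra_smult(1)[OF K ex])
  have cancel: "e x \<oplus>\<^bsub>K\<^esub> (- 1) \<odot>\<^bsub>K\<^esub> e x = \<zero>\<^bsub>K\<^esub>"
    using k_algebra_smult(2)[OF K ex, of 1 "- 1"] k_algebra_smult(5,6)[OF K ex] by simp
  have fA: "f \<in> idem_alg" unfolding f_def using x by (intro idem_alg_closed e_idem_alg)
  then have fc: "f \<in> carrier K" using idem_alg_closed(1) by blast
  have ef: "e x \<oplus>\<^bsub>K\<^esub> f = \<one>\<^bsub>K\<^esub>"
    using cancel ex mx by (simp add: f_def K.add.m_lcomm)
  have exf: "e x \<otimes>\<^bsub>K\<^esub> f = \<zero>\<^bsub>K\<^esub>"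
    using cancel ex mx x by (simp add: f_def K.r_distr k_algebra_smult[OF K] e_idem)
  have fcomm: "e h \<otimes>\<^bsub>K\<^esub> f = f \<otimes>\<^bsub>K\<^esub> e h" if "h \<in> carrier G" for h
    using that ex mx x by (simp add: f_def K.r_distr K.l_distr k_algebra_smult[OF K] e_comm)
  have Pc: "P A \<in> carrier K" if "A \<subseteq> S" for A using P(1)[OF that] idem_alg_closed(1) by blast
  define Q where "Q = (\<lambda>A. if x \<in> A then e x \<otimes>\<^bsub>K\<^esub> P (A - {x}) else f \<otimes>\<^bsub>K\<^esub> P A)"
  have comm: "e h \<otimes>\<^bsub>K\<^esub> (b \<otimes>\<^bsub>K\<^esub> P A) = b \<otimes>\<^bsub>K\<^esub> (e h \<otimes>\<^bsub>K\<^esub> P A)"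
    if "h \<in> carrier G" "A \<subseteq> S" "b \<in> carrier K" "e h \<otimes>\<^bsub>K\<^esub> b = b \<otimes>\<^bsub>K\<^esub> e h" for h A b
    using that Pc[OF that(2)] by (simp add: K.m_assoc[symmetric])
  show ?case
  proof (rule exI[of _ Q], intro conjI ballI)
    fix A assume "A \<in> Pow (insert x S)"
    then have A: "A - {x} \<subseteq> S" "x \<notin> A \<Longrightarrow> A \<subseteq> S" by auto
    \<comment> \<open>Treats both cases of \<open>Q\<close> at once: \<open>b\<close> is the new
      factor and \<open>B\<close> is the part of \<open>A\<close> inside \<open>S\<close>.\<close>
    obtain b B where b: "Q A = b \<otimes>\<^bsub>K\<^esub> P B" "B \<subseteq> S" "b = e x \<and> B = A - {x} \<and> x \<in> A \<or> b = f \<and> B = A \<and> x \<notin> A"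
      by (cases "x \<in> A") (use A in \<open>auto simp: Q_def\<close>)
    have bA: "b \<in> idem_alg" using b(3) fA e_idem_alg x by auto
    have bc: "b \<in> carrier K" using bA idem_alg_closed(1) by blast
    have bcomm: "e h \<otimes>\<^bsub>K\<^esub> b = b \<otimes>\<^bsub>K\<^esub> e h" if "h \<in> carrier G" for h
      using b(3) fcomm e_comm that x by auto
    show "Q A \<in> idem_alg" unfolding b(1) by (intro idem_alg_closed bA P b)
    show "e h \<otimes>\<^bsub>K\<^esub> Q A = Q A \<otimes>\<^bsub>K\<^esub> e h" if "h \<in> carrier G" for h
      unfolding b(1) using comm[OF that b(2) bc bcomm[OF that]] that b(2) bc Pc
      by (simp add: P(2) K.m_assoc)
    show "e h \<otimes>\<^bsub>K\<^esub> Q A = (if h \<in> A then Q A else \<zero>\<^bsub>K\<^esub>)" if "h \<in> insert x S" for h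
    proof (cases "h = x")
      case True
      have "e x \<otimes>\<^bsub>K\<^esub> (b \<otimes>\<^bsub>K\<^esub> P B) = (e x \<otimes>\<^bsub>K\<^esub> b) \<otimes>\<^bsub>K\<^esub> P B"
        using ex bc Pc[OF b(2)] by (simp add: K.m_assoc)
      then show ?thesis using b Pc[OF b(2)] exf e_idem x True by auto
    next
      case False
      then have h: "h \<in> S" "h \<in> carrier G" using that S by auto
      have "e h \<otimes>\<^bsub>K\<^esub> Q A = b \<otimes>\<^bsub>K\<^esub> (if h \<in> B then P B else \<zero>\<^bsub>K\<^esub>)"
        unfolding b(1) comm[OF h(2) b(2) bc bcomm[OF h(2)]] P(3)[OF b(2) h(1)] ..
      then show ?thesis using b False bc by auto
    qed
  next
    have Qc: "Q A \<in> carrier K" if "A \<subseteq> insert x S" for A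
      using that fc ex Pc[of "A - {x}"] Pc[of A] by (auto simp: Q_def subset_insert_iff split: if_splits)
    have inj: "inj_on (insert x) (Pow S)" using x by (auto simp: inj_on_def)
    \<comment> \<open>The subsets without x sum to \<open>f\<close> and those with x to
      \<open>e x\<close>, and these two add up to 1.\<close>
    have "(\<Oplus>\<^bsub>K\<^esub>A\<in>Pow (insert x S). Q A) = (\<Oplus>\<^bsub>K\<^esub>A\<in>Pow S. Q A) \<oplus>\<^bsub>K\<^esub> (\<Oplus>\<^bsub>K\<^esub>A\<in>insert x ` Pow S. Q A)"
      unfolding Pow_insert
      by (rule K.finsum_Un_disjoint) (use insert.hyps Qc in \<open>auto intro!: Qc\<close>)
    also have "(\<Oplus>\<^bsub>K\<^esub>A\<in>insert x ` Pow S. Q A) = (\<Oplus>\<^bsub>K\<^esub>A\<in>Pow S. Q (insert x A))"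
      by (rule K.finsum_reindex[OF _ inj]) (auto intro!: Qc)
    also have "\<dots> = (\<Oplus>\<^bsub>K\<^esub>A\<in>Pow S. e x \<otimes>\<^bsub>K\<^esub> P A)"
    proof (rule K.finsum_cong')
      fix A assume "A \<in> Pow S"
      then have "A - {x} = A" using x by auto
      then show "Q (insert x A) = e x \<otimes>\<^bsub>K\<^esub> P A" by (simp add: Q_def)
    qed (use x Pc in auto)
    also have "\<dots> = e x"
      using insert.hyps x Pc P1 by (subst K.finsum_rdistr[symmetric]) auto
    also have "(\<Oplus>\<^bsub>K\<^esub>A\<in>Pow S. Q A) = (\<Oplus>\<^bsub>K\<^esub>A\<in>Pow S. f \<otimes>\<^bsub>K\<^esub> P A)"
      by (rule K.finsum_cong') (use x Pc fc in \<open>auto simp: Q_def\<close>)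
    also have "\<dots> = f"
      using insert.hyps fc Pc P1 by (subst K.finsum_rdistr[symmetric]) auto
    finally show "(\<Oplus>\<^bsub>K\<^esub>A\<in>Pow (insert x S). Q A) = \<one>\<^bsub>K\<^esub>"
      using ef ex fc by (simp add: K.a_comm)
  qed
qed

text \<open>The \<open>P\<^sub>A\<close> of the overview, chosen from \<open>idem_family\<close>;
  later arguments rely only on \<open>idem_spec\<close>.\<close>

definition idem :: "'g set \<Rightarrow> 'a" where
  "idem = (SOME P. (\<forall>A\<in>Pow (carrier G). P A \<in> idem_alg \<and>
      (\<forall>h\<in>carrier G. e h \<otimes>\<^bsub>K\<^esub> P A = P A \<otimes>\<^bsub>K\<^esub> e h) \<and>
      (\<forall>h\<in>carrier G. e h \<otimes>\<^bsub>K\<^esub> P A = (if h \<in> A then P A else \<zero>\<^bsub>K\<^esub>))) \<and>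
      (\<Oplus>\<^bsub>K\<^esub>A\<in>Pow (carrier G). P A) = \<one>\<^bsub>K\<^esub>)"

lemma idem_spec:
  shows "A \<subseteq> carrier G \<Longrightarrow> idem A \<in> idem_alg"
    and "A \<subseteq> carrier G \<Longrightarrow> h \<in> carrier G \<Longrightarrow> e h \<otimes>\<^bsub>K\<^esub> idem A = (if h \<in> A then idem A else \<zero>\<^bsub>K\<^esub>)"
    and "A \<subseteq> carrier G \<Longrightarrow> h \<in> carrier G \<Longrightarrow> idem A \<otimes>\<^bsub>K\<^esub> e h = (if h \<in> A then idem A else \<zero>\<^bsub>K\<^esub>)"
    and "(\<Oplus>\<^bsub>K\<^esub>A\<in>Pow (carrier G). idem A) = \<one>\<^bsub>K\<^esub>"
proof -
  note * = someI_ex[OF idem_family[OF fin subset_refl], folded idem_def]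
  show "A \<subseteq> carrier G \<Longrightarrow> idem A \<in> idem_alg" "(\<Oplus>\<^bsub>K\<^esub>A\<in>Pow (carrier G). idem A) = \<one>\<^bsub>K\<^esub>"
    "A \<subseteq> carrier G \<Longrightarrow> h \<in> carrier G \<Longrightarrow> e h \<otimes>\<^bsub>K\<^esub> idem A = (if h \<in> A then idem A else \<zero>\<^bsub>K\<^esub>)"
    using * by blast+
  moreover have "A \<subseteq> carrier G \<Longrightarrow> h \<in> carrier G \<Longrightarrow> e h \<otimes>\<^bsub>K\<^esub> idem A = idem A \<otimes>\<^bsub>K\<^esub> e h"
    using * by blast
  ultimately show "A \<subseteq> carrier G \<Longrightarrow> h \<in> carrier G \<Longrightarrow> idem A \<otimes>\<^bsub>K\<^esub> e h = (if h \<in> A then idem A else \<zero>\<^bsub>K\<^esub>)"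
    by simp
qed

lemma idem_closed: "A \<in> pointed_sets G \<Longrightarrow> idem A \<in> carrier K"
  using idem_spec(1) idem_alg_closed(1) by (auto simp: pointed_sets_def)

lemma pointed_sets_finite: "finite (pointed_sets G)"
  using finite_subset[OF pointed_sets_nesubsets finite_nesubsets[OF fin]] .

text \<open>Sets without the neutral element contribute nothing: the idempotent of such a set is
  annihilated by \<open>e \<one>\<close>, which is the unit.\<close>

lemma idem_sum: "(\<Oplus>\<^bsub>K\<^esub>A\<in>pointed_sets G. idem A) = \<one>\<^bsub>K\<^esub>"
proof -
  have "idem A = \<zero>\<^bsub>K\<^esub>" if "A \<in> Pow (carrier G) - pointed_sets G" for A
    using idem_spec(2)[of A \<one>] idem_spec(1)[of A] idem_alg_closed(1) that
    by (auto simp: pointed_sets_def e_one)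
  then have "(\<Oplus>\<^bsub>K\<^esub>A\<in>pointed_sets G. idem A) = (\<Oplus>\<^bsub>K\<^esub>A\<in>Pow (carrier G). idem A)"
    using idem_spec(1) idem_alg_closed(1) fin
    by (intro K.add.finprod_mono_neutral_cong_left) (auto simp: pointed_sets_def)
  then show ?thesis using idem_spec(4) by simp
qed

lemma idem_e:
  assumes "A \<in> pointed_sets G" "h \<in> carrier G"
  shows "e h \<otimes>\<^bsub>K\<^esub> idem A = (if h \<in> A then idem A else \<zero>\<^bsub>K\<^esub>)"
    and "idem A \<otimes>\<^bsub>K\<^esub> e h = (if h \<in> A then idem A else \<zero>\<^bsub>K\<^esub>)"
  using idem_spec assms by (auto simp: pointed_sets_def)

text \<open>For B different from A some h lies in exactly one of the two sets, and its two
  eigenvalues force \<open>P\<^sub>B b = 0\<close>. As the idempotents sum to 1, only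
  \<open>P\<^sub>A b\<close> is left. Both sides are treated because the generators do not commute
  with the idempotents.\<close>

lemma idem_fix:
  assumes A: "A \<in> pointed_sets G" and b: "b \<in> carrier K"
  shows "(\<And>h. h \<in> carrier G \<Longrightarrow> e h \<otimes>\<^bsub>K\<^esub> b = (if h \<in> A then b else \<zero>\<^bsub>K\<^esub>)) \<Longrightarrow> idem A \<otimes>\<^bsub>K\<^esub> b = b"
    and "(\<And>h. h \<in> carrier G \<Longrightarrow> b \<otimes>\<^bsub>K\<^esub> e h = (if h \<in> A then b else \<zero>\<^bsub>K\<^esub>)) \<Longrightarrow> b \<otimes>\<^bsub>K\<^esub> idem A = b"
proof -
  show "idem A \<otimes>\<^bsub>K\<^esub> b = b" if *: "\<And>h. h \<in> carrier G \<Longrightarrow> e h \<otimes>\<^bsub>K\<^esub> b = (if h \<in> A then b else \<zero>\<^bsub>K\<^esub>)"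
  proof -
    have z: "idem B \<otimes>\<^bsub>K\<^esub> b = \<zero>\<^bsub>K\<^esub>" if B: "B \<in> pointed_sets G" "B \<noteq> A" for B
    proof -
      obtain h where h: "h \<in> carrier G" "h \<in> A \<longleftrightarrow> h \<notin> B" using A B by (auto simp: pointed_sets_def)
      have "(idem B \<otimes>\<^bsub>K\<^esub> e h) \<otimes>\<^bsub>K\<^esub> b = idem B \<otimes>\<^bsub>K\<^esub> (e h \<otimes>\<^bsub>K\<^esub> b)"
        using h b idem_closed[OF B(1)] by (simp add: K.m_assoc)
      then show ?thesis using h b idem_closed[OF B(1)] by (simp add: * idem_e[OF B(1)] split: if_splits)
    qed
    have "b = (\<Oplus>\<^bsub>K\<^esub>B\<in>pointed_sets G. idem B) \<otimes>\<^bsub>K\<^esub> b" using b by (simp add: idem_sum)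
    also have "\<dots> = (\<Oplus>\<^bsub>K\<^esub>B\<in>pointed_sets G. idem B \<otimes>\<^bsub>K\<^esub> b)"
      using b idem_closed pointed_sets_finite by (subst K.finsum_ldistr) auto
    also have "\<dots> = (\<Oplus>\<^bsub>K\<^esub>B\<in>pointed_sets G. if A = B then idem B \<otimes>\<^bsub>K\<^esub> b else \<zero>\<^bsub>K\<^esub>)"
      by (rule K.finsum_cong') (use b idem_closed z in auto)
    also have "\<dots> = idem A \<otimes>\<^bsub>K\<^esub> b"
      by (rule K.finsum_singleton) (use A b idem_closed pointed_sets_finite in auto)
    finally show ?thesis by simp
  qed
  show "b \<otimes>\<^bsub>K\<^esub> idem A = b" if *: "\<And>h. h \<in> carrier G \<Longrightarrow> b \<otimes>\<^bsub>K\<^esub> e h = (if h \<in> A then b else \<zero>\<^bsub>K\<^esub>)"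
  proof -
    have z: "b \<otimes>\<^bsub>K\<^esub> idem B = \<zero>\<^bsub>K\<^esub>" if B: "B \<in> pointed_sets G" "B \<noteq> A" for B
    proof -
      obtain h where h: "h \<in> carrier G" "h \<in> A \<longleftrightarrow> h \<notin> B" using A B by (auto simp: pointed_sets_def)
      have "(b \<otimes>\<^bsub>K\<^esub> e h) \<otimes>\<^bsub>K\<^esub> idem B = b \<otimes>\<^bsub>K\<^esub> (e h \<otimes>\<^bsub>K\<^esub> idem B)"
        using h b idem_closed[OF B(1)] by (simp add: K.m_assoc)
      then show ?thesis using h b idem_closed[OF B(1)] by (simp add: * idem_e[OF B(1)] split: if_splits)
    qed
    have "b = b \<otimes>\<^bsub>K\<^esub> (\<Oplus>\<^bsub>K\<^esub>B\<in>pointed_sets G. idem B)" using b by (simp add: idem_sum)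
    also have "\<dots> = (\<Oplus>\<^bsub>K\<^esub>B\<in>pointed_sets G. b \<otimes>\<^bsub>K\<^esub> idem B)"
      using b idem_closed pointed_sets_finite by (subst K.finsum_rdistr) auto
    also have "\<dots> = (\<Oplus>\<^bsub>K\<^esub>B\<in>pointed_sets G. if A = B then b \<otimes>\<^bsub>K\<^esub> idem B else \<zero>\<^bsub>K\<^esub>)"
      by (rule K.finsum_cong') (use b idem_closed z in auto)
    also have "\<dots> = b \<otimes>\<^bsub>K\<^esub> idem A"
      by (rule K.finsum_singleton) (use A b idem_closed pointed_sets_finite in auto)
    finally show ?thesis by simp
  qed
qed

lemma idem_orthogonal:
  assumes A: "A \<in> pointed_sets G" and B: "B \<in> pointed_sets G"
  shows "idem A \<otimes>\<^bsub>K\<^esub> idem B = (if A = B then idem A else \<zero>\<^bsub>K\<^esub>)"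
proof (cases "A = B")
  case True
  then show ?thesis using idem_fix(1)[OF A idem_closed[OF A]] idem_e[OF A] by auto
next
  case False
  then obtain h where h: "h \<in> carrier G" "h \<in> A \<longleftrightarrow> h \<notin> B" using A B by (auto simp: pointed_sets_def)
  have "(idem A \<otimes>\<^bsub>K\<^esub> e h) \<otimes>\<^bsub>K\<^esub> idem B = idem A \<otimes>\<^bsub>K\<^esub> (e h \<otimes>\<^bsub>K\<^esub> idem B)"
    using h idem_closed A B by (simp add: K.m_assoc)
  then show ?thesis
    using h idem_closed[OF A] idem_closed[OF B] False by (simp add: idem_e[OF A] idem_e[OF B] split: if_splits)
qed

text \<open>By \<open>p_e\<close>, p(g) \<open>P\<^sub>A\<close> has the left eigenvalues belonging
  to gA, while the product of the idempotent of gA with p(g) has the right eigenvalues belonging to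
  A. By \<open>idem_fix\<close> both equal the product with an idempotent on either side. If
  \<open>inv g\<close> is not in A, the factor \<open>e (inv g)\<close> absorbed by
  \<open>p g\<close> kills \<open>P\<^sub>A\<close>.\<close>

lemma p_idem:
  assumes g: "g \<in> carrier G" and A: "A \<in> pointed_sets G"
  shows "p g \<otimes>\<^bsub>K\<^esub> idem A = (if inv g \<in> A then idem (g <# A) \<otimes>\<^bsub>K\<^esub> p g else \<zero>\<^bsub>K\<^esub>)"
proof (cases "inv g \<in> A")
  case False
  have "p g \<otimes>\<^bsub>K\<^esub> idem A = p g \<otimes>\<^bsub>K\<^esub> (e (inv g) \<otimes>\<^bsub>K\<^esub> idem A)"
    using g p_e_inv[OF g] idem_closed[OF A] by (simp add: K.m_assoc[symmetric])
  then show ?thesis using False g by (simp add: idem_e[OF A])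
next
  case True
  let ?B = "g <# A"
  have As: "A \<subseteq> carrier G" "\<one> \<in> A" using A by (auto simp: pointed_sets_def)
  have B: "?B \<in> pointed_sets G"
    using g True As l_coset_subset_G[of A g] by (auto simp: pointed_sets_def l_coset_mem)
  note c = idem_closed[OF A] idem_closed[OF B] p_closed[OF g]
  have "idem ?B \<otimes>\<^bsub>K\<^esub> (p g \<otimes>\<^bsub>K\<^esub> idem A) = p g \<otimes>\<^bsub>K\<^esub> idem A"
  proof (rule idem_fix(1)[OF B])
    fix h assume h: "h \<in> carrier G"
    have "e h \<otimes>\<^bsub>K\<^esub> (p g \<otimes>\<^bsub>K\<^esub> idem A) = (e (g \<otimes> (inv g \<otimes> h)) \<otimes>\<^bsub>K\<^esub> p g) \<otimes>\<^bsub>K\<^esub> idem A"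
      using c g h by (simp add: K.m_assoc inv_cancel_left)
    also have "\<dots> = p g \<otimes>\<^bsub>K\<^esub> (e (inv g \<otimes> h) \<otimes>\<^bsub>K\<^esub> idem A)"
      using c g h by (simp add: p_e[symmetric] K.m_assoc)
    finally show "e h \<otimes>\<^bsub>K\<^esub> (p g \<otimes>\<^bsub>K\<^esub> idem A) = (if h \<in> ?B then p g \<otimes>\<^bsub>K\<^esub> idem A else \<zero>\<^bsub>K\<^esub>)"
      using c g h As by (simp add: idem_e[OF A] l_coset_mem)
  qed (use c in simp)
  moreover have "(idem ?B \<otimes>\<^bsub>K\<^esub> p g) \<otimes>\<^bsub>K\<^esub> idem A = idem ?B \<otimes>\<^bsub>K\<^esub> p g"
  proof (rule idem_fix(2)[OF A])
    fix h assume h: "h \<in> carrier G"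
    have "(idem ?B \<otimes>\<^bsub>K\<^esub> p g) \<otimes>\<^bsub>K\<^esub> e h = (idem ?B \<otimes>\<^bsub>K\<^esub> e (g \<otimes> h)) \<otimes>\<^bsub>K\<^esub> p g"
      using c g h by (simp add: p_e K.m_assoc)
    then show "(idem ?B \<otimes>\<^bsub>K\<^esub> p g) \<otimes>\<^bsub>K\<^esub> e h = (if h \<in> A then idem ?B \<otimes>\<^bsub>K\<^esub> p g else \<zero>\<^bsub>K\<^esub>)"
      using c g h As by (simp add: idem_e[OF B] l_coset_mem inv_cancel_left)
  qed (use c in simp)
  ultimately show ?thesis using True c by (simp add: K.m_assoc)
qed

section \<open>Coordinates with respect to the idempotents\<close>

definition comb :: "('g set \<Rightarrow> 'k) \<Rightarrow> 'a" where
  "comb c = (\<Oplus>\<^bsub>K\<^esub>A\<in>pointed_sets G. c A \<odot>\<^bsub>K\<^esub> idem A)"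

lemma smult_idem_closed: "A \<in> pointed_sets G \<Longrightarrow> c \<odot>\<^bsub>K\<^esub> idem A \<in> carrier K"
  by (rule k_algebra_smult(1)[OF K idem_closed])

lemma comb_idem_alg: "comb c \<in> idem_alg"
  unfolding comb_def
  by (rule subspace_of_finsum[OF K _ pointed_sets_finite])
     (use idem_alg_subalgebra idem_alg_closed(6) idem_spec(1) in \<open>auto simp: subalgebra_of_def pointed_sets_def\<close>)

lemma comb_closed: "comb c \<in> carrier K"
  using comb_idem_alg idem_alg_closed(1) by blast

lemma comb_cong: "(\<And>A. A \<in> pointed_sets G \<Longrightarrow> c A = d A) \<Longrightarrow> comb c = comb d"
  unfolding comb_def by (rule K.finsum_cong') (auto simp: smult_idem_closed)

lemma comb_idem:
  assumes B: "B \<in> pointed_sets G"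
  shows "comb c \<otimes>\<^bsub>K\<^esub> idem B = c B \<odot>\<^bsub>K\<^esub> idem B"
proof -
  have "comb c \<otimes>\<^bsub>K\<^esub> idem B = (\<Oplus>\<^bsub>K\<^esub>A\<in>pointed_sets G. (c A \<odot>\<^bsub>K\<^esub> idem A) \<otimes>\<^bsub>K\<^esub> idem B)"
    unfolding comb_def
    by (rule K.finsum_ldistr) (use pointed_sets_finite idem_closed[OF B] smult_idem_closed in auto)
  also have "\<dots> = (\<Oplus>\<^bsub>K\<^esub>A\<in>pointed_sets G. if B = A then c A \<odot>\<^bsub>K\<^esub> idem A else \<zero>\<^bsub>K\<^esub>)"
    by (rule K.finsum_cong')
       (use B smult_idem_closed in \<open>auto simp: k_algebra_smult[OF K] k_algebra_smult(9)[OF K K.zero_closed] idem_closed idem_orthogonal\<close>)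
  also have "\<dots> = c B \<odot>\<^bsub>K\<^esub> idem B"
    by (rule K.finsum_singleton) (use B pointed_sets_finite smult_idem_closed in auto)
  finally show ?thesis .
qed

text \<open>As the idempotents sum to 1, an element is recovered from its products with them. An
  equation between combinations thus reduces to one scalar identity for each pointed set.\<close>

lemma combI:
  assumes b: "b \<in> carrier K" and *: "\<And>B. B \<in> pointed_sets G \<Longrightarrow> b \<otimes>\<^bsub>K\<^esub> idem B = c B \<odot>\<^bsub>K\<^esub> idem B"
  shows "b = comb c"
proof -
  have "b = b \<otimes>\<^bsub>K\<^esub> (\<Oplus>\<^bsub>K\<^esub>B\<in>pointed_sets G. idem B)" using b by (simp add: idem_sum)
  also have "\<dots> = (\<Oplus>\<^bsub>K\<^esub>B\<in>pointed_sets G. b \<otimes>\<^bsub>K\<^esub> idem B)"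
    using b idem_closed pointed_sets_finite by (subst K.finsum_rdistr) auto
  also have "\<dots> = comb c"
    unfolding comb_def by (rule K.finsum_cong') (auto simp: * smult_idem_closed)
  finally show ?thesis .
qed

lemma comb_e: "h \<in> carrier G \<Longrightarrow> e h = comb (\<lambda>A. if h \<in> A then 1 else 0)"
  by (rule combI) (auto simp: idem_e k_algebra_smult[OF K] idem_closed)

lemma comb_one: "\<one>\<^bsub>K\<^esub> = comb (\<lambda>_. 1)"
  by (rule combI) (auto simp: k_algebra_smult[OF K] idem_closed)

lemma comb_zero: "\<zero>\<^bsub>K\<^esub> = comb (\<lambda>_. 0)"
  by (rule combI) (auto simp: k_algebra_smult[OF K] idem_closed)

lemma comb_add: "comb c \<oplus>\<^bsub>K\<^esub> comb d = comb (\<lambda>A. c A + d A)"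
  by (rule combI) (auto simp: comb_closed K.l_distr comb_idem k_algebra_smult[OF K] idem_closed)

lemma comb_smult: "r \<odot>\<^bsub>K\<^esub> comb c = comb (\<lambda>A. r * c A)"
  by (rule combI) (auto simp: comb_closed comb_idem k_algebra_smult[OF K] idem_closed)

lemma comb_mult: "comb c \<otimes>\<^bsub>K\<^esub> comb d = comb (\<lambda>A. c A * d A)"
proof (rule combI)
  fix B assume B: "B \<in> pointed_sets G"
  have "comb c \<otimes>\<^bsub>K\<^esub> comb d \<otimes>\<^bsub>K\<^esub> idem B = d B \<odot>\<^bsub>K\<^esub> (comb c \<otimes>\<^bsub>K\<^esub> idem B)"
    using B by (simp add: comb_closed K.m_assoc idem_closed comb_idem[OF B] k_algebra_smult[OF K])
  also have "\<dots> = (d B * c B) \<odot>\<^bsub>K\<^esub> idem B"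
    unfolding comb_idem[OF B] k_algebra_smult(4)[OF K idem_closed[OF B]] ..
  finally show "comb c \<otimes>\<^bsub>K\<^esub> comb d \<otimes>\<^bsub>K\<^esub> idem B = (c B * d B) \<odot>\<^bsub>K\<^esub> idem B" by (simp add: mult.commute)
qed (simp add: comb_closed)

text \<open>Multiplication by \<open>idem A\<close> isolates the coefficient at A, and a nonzero
  vector over a field determines its scalar.\<close>

lemma comb_eqD:
  assumes eq: "comb c = comb d" and A: "A \<in> pointed_sets G" "idem A \<noteq> \<zero>\<^bsub>K\<^esub>"
  shows "c A = d A"
proof (rule ccontr)
  let ?r = "c A - d A"
  assume ne: "c A \<noteq> d A"
  have "c A \<odot>\<^bsub>K\<^esub> idem A = d A \<odot>\<^bsub>K\<^esub> idem A" using comb_idem[OF A(1)] eq by metis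
  moreover have "c A \<odot>\<^bsub>K\<^esub> idem A = ?r \<odot>\<^bsub>K\<^esub> idem A \<oplus>\<^bsub>K\<^esub> d A \<odot>\<^bsub>K\<^esub> idem A"
    using k_algebra_smult(2)[OF K idem_closed[OF A(1)], of ?r "d A"] by simp
  ultimately have "?r \<odot>\<^bsub>K\<^esub> idem A = \<zero>\<^bsub>K\<^esub>"
    using smult_idem_closed[OF A(1)] by (metis K.add.l_cancel_one' K.add.r_cancel_one')
  then have "(inverse ?r * ?r) \<odot>\<^bsub>K\<^esub> idem A = \<zero>\<^bsub>K\<^esub>"
    by (simp only: k_algebra_smult[OF K idem_closed[OF A(1)]])
  then show False using ne A by (simp add: k_algebra_smult[OF K idem_closed[OF A(1)]])
qed

lemma idem_alg_comb: "idem_alg = range comb"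
proof
  show "idem_alg \<subseteq> range comb"
    unfolding idem_alg_def
  proof (rule hull_minimal)
    show "subalgebra_of K (range comb)"
      unfolding subalgebra_of_def subspace_of_def
      using comb_closed comb_zero comb_one by (auto simp: comb_add comb_mult comb_smult)
  qed (auto simp: comb_e)
qed (use comb_idem_alg in blast)

text \<open>Moving \<open>P\<^sub>B\<close> to the left past \<open>p (inv g)\<close> turns it into
  \<open>P\<^sub>C\<close> with \<open>C = inv g <# B\<close>, where the coefficient is read off.
  Moving it back leaves \<open>e g\<close>, which fixes \<open>P\<^sub>B\<close>. If g is not in B,
  the first move already gives zero.\<close>

lemma comb_act:
  assumes g: "g \<in> carrier G"
  shows "p g \<otimes>\<^bsub>K\<^esub> comb c \<otimes>\<^bsub>K\<^esub> p (inv g) = comb (\<lambda>A. if g \<in> A then c (inv g <# A) else 0)"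
proof (rule combI)
  fix B assume B: "B \<in> pointed_sets G"
  have Bs: "B \<subseteq> carrier G" "\<one> \<in> B" using B by (auto simp: pointed_sets_def)
  have ig: "inv g \<in> carrier G" using g by simp
  have assoc: "p g \<otimes>\<^bsub>K\<^esub> comb c \<otimes>\<^bsub>K\<^esub> p (inv g) \<otimes>\<^bsub>K\<^esub> idem B = p g \<otimes>\<^bsub>K\<^esub> (comb c \<otimes>\<^bsub>K\<^esub> (p (inv g) \<otimes>\<^bsub>K\<^esub> idem B))"
    using g B by (simp add: comb_closed idem_closed K.m_assoc)
  show "p g \<otimes>\<^bsub>K\<^esub> comb c \<otimes>\<^bsub>K\<^esub> p (inv g) \<otimes>\<^bsub>K\<^esub> idem B = (if g \<in> B then c (inv g <# B) else 0) \<odot>\<^bsub>K\<^esub> idem B"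
  proof (cases "g \<in> B")
    case False
    then show ?thesis
      unfolding assoc using g B comb_closed by (simp add: p_idem idem_closed k_algebra_smult[OF K])
  next
    case True
    let ?C = "inv g <# B"
    have C: "?C \<in> pointed_sets G"
      using g True Bs l_coset_subset_G[of B "inv g"] by (auto simp: pointed_sets_def l_coset_mem)
    have gC: "g <# ?C = B" "inv g \<in> ?C"
      using g Bs by (simp_all add: lcos_m_assoc lcos_mult_one l_coset_mem)
    have "comb c \<otimes>\<^bsub>K\<^esub> (p (inv g) \<otimes>\<^bsub>K\<^esub> idem B) = c ?C \<odot>\<^bsub>K\<^esub> (idem ?C \<otimes>\<^bsub>K\<^esub> p (inv g))"
    proof -
      have "comb c \<otimes>\<^bsub>K\<^esub> (p (inv g) \<otimes>\<^bsub>K\<^esub> idem B) = (comb c \<otimes>\<^bsub>K\<^esub> idem ?C) \<otimes>\<^bsub>K\<^esub> p (inv g)"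
        using True g comb_closed idem_closed[OF C] by (simp add: p_idem[OF ig B] K.m_assoc)
      then show ?thesis unfolding comb_idem[OF C] using k_algebra_smult(7)[OF K idem_closed[OF C]] g by simp
    qed
    also have "\<dots> = c ?C \<odot>\<^bsub>K\<^esub> (p (inv g) \<otimes>\<^bsub>K\<^esub> idem B)"
      using True g by (simp add: p_idem[OF ig B])
    finally have "p g \<otimes>\<^bsub>K\<^esub> (comb c \<otimes>\<^bsub>K\<^esub> (p (inv g) \<otimes>\<^bsub>K\<^esub> idem B)) = c ?C \<odot>\<^bsub>K\<^esub> (e g \<otimes>\<^bsub>K\<^esub> idem B)"
      using g idem_closed[OF B] k_algebra_smult(8)[OF K, of "p g" "p (inv g) \<otimes>\<^bsub>K\<^esub> idem B"]
      by (simp add: e_def K.m_assoc)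
    then show ?thesis unfolding assoc using True g by (simp add: idem_e[OF B])
  qed
qed (use g comb_closed in simp)

end

section \<open>Linear independence of the idempotents in the partial group algebra\<close>

lemma k_par_partial_rep:
  fixes G :: "('g, 'm) monoid_scheme" (structure)
  assumes G: "group G" and fin: "finite (carrier G)"
  shows "partial_rep G (k_par G :: ('k::field, _) module) (par_gen G)"
proof -
  interpret group G by (rule G)
  show ?thesis
    by unfold_locales
       (simp_all add: fin k_par_k_algebra[OF G] par_gen_closed[OF G] par_gen_relations[OF G])
qed

text \<open>Each \<open>e h\<close> acts on the indicator of A by the scalar 1 or 0 according to
  whether h is in A. Hence \<open>P\<^sub>B\<close> kills this indicator for B different from A; if
  \<open>P\<^sub>A\<close> were zero too, the unit, being the sum of all idempotents, would kill it
  as well.\<close>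

lemma k_par_idem_nonzero:
  fixes G :: "('g, 'm) monoid_scheme" (structure)
  assumes G: "group G" and fin: "finite (carrier G)" and A: "A \<in> pointed_sets G"
  shows "partial_rep.idem G (k_par G :: ('k::field, _) module) (par_gen G) A \<noteq> \<zero>\<^bsub>k_par G\<^esub>"
proof
  let ?K = "k_par G :: ('k, _) module"
  interpret partial_rep G ?K "par_gen G" by (rule k_par_partial_rep[OF G fin])
  assume zero: "idem A = \<zero>\<^bsub>?K\<^esub>"
  define \<delta> where "\<delta> = (ind A :: _ \<Rightarrow> 'k)"
  have \<delta>: "\<delta> \<in> pointed_funs G" using A by (auto simp: \<delta>_def ind_def pointed_funs_def pointed_sets_def)
  have As: "A \<subseteq> carrier G" "\<one> \<in> A" using A by (auto simp: pointed_sets_def)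
  have rep_e: "par_rep G (e h) \<delta> = (if h \<in> A then \<delta> else (\<lambda>_. 0))" if h: "h \<in> carrier G" for h
  proof -
    have "par_rep G (e h) \<delta> = word_act G [h] (word_act G [inv h] \<delta>)"
      unfolding e_def using h \<delta>
      by (simp only: par_rep_mult[OF G] par_gen_closed[OF G] par_rep_gen[OF G] word_act_pointed inv_closed)
    moreover have "h <# (inv h <# C) = C" if "C \<subseteq> carrier G" for C
      using h that by (simp add: lcos_m_assoc lcos_mult_one)
    moreover have "inv h <# C \<subseteq> carrier G" if "C \<subseteq> carrier G" for C
      using h that by (simp add: l_coset_subset_G)
    ultimately show ?thesis
      using h As by (auto simp: fun_eq_iff l_coset_mem \<delta>_def ind_def)
  qed
  have kill: "par_rep G (idem B) \<delta> = (\<lambda>_. 0)" if B: "B \<in> pointed_sets G" for B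
  proof (cases "B = A")
    case False
    then obtain h where h: "h \<in> carrier G" "h \<in> A \<longleftrightarrow> h \<notin> B" using A B by (auto simp: pointed_sets_def)
    \<comment> \<open>The separating \<open>h\<close> gives two evaluations: \<open>e h\<close> acts
      by a scalar on \<open>\<delta>\<close>, and by the opposite scalar on
      \<open>idem B\<close>.\<close>
    have "par_rep G (idem B \<otimes>\<^bsub>?K\<^esub> e h) \<delta> = par_rep G (idem B) (par_rep G (e h) \<delta>)"
      by (rule par_rep_mult[OF G idem_closed[OF B] e_closed[OF h(1)] \<delta>])
    then show ?thesis
      using h by (auto simp: rep_e idem_e[OF B] par_rep_zero_fun par_rep_zero_one[OF G \<delta>] split: if_splits)
  qed (simp add: zero par_rep_zero_one[OF G \<delta>])
  have "par_rep G (\<Oplus>\<^bsub>?K\<^esub>B\<in>S. idem B) \<delta> = (\<lambda>_. 0)" if "finite S" "S \<subseteq> pointed_sets G" for S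
    using that
  proof (induction S rule: finite_induct)
    case (insert B S)
    have "(\<Oplus>\<^bsub>?K\<^esub>B\<in>insert B S. idem B) = idem B \<oplus>\<^bsub>?K\<^esub> (\<Oplus>\<^bsub>?K\<^esub>B\<in>S. idem B)"
      using insert idem_closed by (intro K.finsum_insert) auto
    moreover have "(\<Oplus>\<^bsub>?K\<^esub>B\<in>S. idem B) \<in> carrier ?K"
      using insert idem_closed by (intro K.finsum_closed) auto
    ultimately show ?case
      using insert kill[of B] idem_closed[of B] by (auto simp: par_rep_add[OF G _ _ \<delta>])
  qed (simp add: par_rep_zero_one[OF G \<delta>])
  from this[OF pointed_sets_finite subset_refl] have "\<delta> = (\<lambda>_. 0)"
    by (simp add: idem_sum par_rep_zero_one[OF G \<delta>])
  then have "\<delta> A = 0" by simp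
  then show False by (simp add: \<delta>_def ind_def)
qed

section \<open>The standard globalization\<close>

definition pcomb :: "('g, 'm) monoid_scheme \<Rightarrow> ('g set \<Rightarrow> 'k::field) \<Rightarrow> ('g list \<Rightarrow> 'k) set" where
  "pcomb G = partial_rep.comb G (k_par G) (par_gen G)"

context
  fixes G :: "('g, 'm) monoid_scheme" (structure)
  assumes G: "group G" and fin: "finite (carrier G)"
begin

interpretation group G by (rule G)

lemma A_par_carrier: "carrier (A_par G :: ('k::field, _) module) = range (pcomb G)"
proof -
  interpret partial_rep G "k_par G :: ('k, _) module" "par_gen G" by (rule k_par_partial_rep[OF G fin])
  show ?thesis
    using idem_alg_comb by (simp add: A_par_def idem_alg_def e_def pcomb_def)
qed

lemma pcomb_closed [simp]: "pcomb G c \<in> carrier (A_par G :: ('k::field, _) module)"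
  by (simp add: A_par_carrier)

lemma pcomb_simps:
  fixes c d :: "'g set \<Rightarrow> 'k::field"
  shows "pcomb G c \<otimes>\<^bsub>A_par G\<^esub> pcomb G d = pcomb G (\<lambda>A. c A * d A)"
    and "pcomb G c \<oplus>\<^bsub>A_par G\<^esub> pcomb G d = pcomb G (\<lambda>A. c A + d A)"
    and "r \<odot>\<^bsub>A_par G\<^esub> pcomb G c = pcomb G (\<lambda>A. r * c A)"
    and "\<one>\<^bsub>A_par G\<^esub> = pcomb G (\<lambda>_. 1 :: 'k)"
    and "\<zero>\<^bsub>A_par G\<^esub> = pcomb G (\<lambda>_. 0 :: 'k)"
    and "g \<in> carrier G \<Longrightarrow> A_par_act G g (pcomb G c) = pcomb G (\<lambda>A. if g \<in> A then c (inv g <# A) else 0)"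
proof -
  interpret partial_rep G "k_par G :: ('k, _) module" "par_gen G" by (rule k_par_partial_rep[OF G fin])
  show "pcomb G c \<otimes>\<^bsub>A_par G\<^esub> pcomb G d = pcomb G (\<lambda>A. c A * d A)"
    "pcomb G c \<oplus>\<^bsub>A_par G\<^esub> pcomb G d = pcomb G (\<lambda>A. c A + d A)"
    "r \<odot>\<^bsub>A_par G\<^esub> pcomb G c = pcomb G (\<lambda>A. r * c A)"
    "\<one>\<^bsub>A_par G\<^esub> = pcomb G (\<lambda>_. 1 :: 'k)" "\<zero>\<^bsub>A_par G\<^esub> = pcomb G (\<lambda>_. 0 :: 'k)"
    "g \<in> carrier G \<Longrightarrow> A_par_act G g (pcomb G c) = pcomb G (\<lambda>A. if g \<in> A then c (inv g <# A) else 0)"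
    by (simp_all add: A_par_def pcomb_def A_par_act_def comb_mult comb_add comb_smult comb_one comb_zero comb_act)
qed

lemma pcomb_eq_iff:
  fixes c d :: "'g set \<Rightarrow> 'k::field"
  shows "pcomb G c = pcomb G d \<longleftrightarrow> (\<forall>A\<in>pointed_sets G. c A = d A)"
proof -
  interpret partial_rep G "k_par G :: ('k, _) module" "par_gen G" by (rule k_par_partial_rep[OF G fin])
  show ?thesis
    unfolding pcomb_def
    using comb_eqD[of c d, OF _ _ k_par_idem_nonzero[OF G fin]] comb_cong[of c d] by blast
qed

lemma pcomb_cong: "(\<And>A. A \<in> pointed_sets G \<Longrightarrow> c A = d A) \<Longrightarrow> pcomb G c = (pcomb G d :: ('g list \<Rightarrow> 'k::field) set)"
  by (simp add: pcomb_eq_iff)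

lemma finite_pointed_sets: "finite (pointed_sets G)"
  using finite_subset[OF pointed_sets_nesubsets finite_nesubsets[OF fin]] .

lemma A_par_k_algebra: "k_algebra (A_par G :: ('k::field, _) module)"
proof (rule k_algebra_image[OF fun_alg_k_algebra[OF finite_pointed_sets]])
  note E = finite_pointed_sets
  show "alg_onto (fun_alg (pointed_sets G)) (A_par G :: ('k, _) module) (pcomb G)"
    unfolding alg_onto_def
  proof (intro conjI ballI allI)
    have "pcomb G c \<in> pcomb G ` carrier (fun_alg (pointed_sets G))" for c :: "'g set \<Rightarrow> 'k"
    proof (rule image_eqI)
      show "pcomb G c = pcomb G (\<lambda>A. if A \<in> pointed_sets G then c A else 0)" by (rule pcomb_cong) simp
    qed (simp add: fun_alg_carrier[OF E])
    then show "pcomb G ` carrier (fun_alg (pointed_sets G)) = carrier (A_par G :: ('k, _) module)"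
      by (auto simp: A_par_carrier)
  qed (auto simp: fun_alg_simps[OF E] fun_alg_mult[OF E] pcomb_simps intro!: pcomb_cong)
qed

lemma pcomb_finsum:
  assumes "finite I"
  shows "(\<Oplus>\<^bsub>A_par G\<^esub>i\<in>I. pcomb G (c i)) = (pcomb G (\<lambda>A. \<Sum>i\<in>I. c i A) :: ('g list \<Rightarrow> 'k::field) set)"
proof -
  interpret A: ring "A_par G :: ('k, _) module" by (rule k_algebra_ring[OF A_par_k_algebra])
  show ?thesis using assms
    by (induction I rule: finite_induct) (simp_all add: pcomb_simps)
qed

lemma pcomb_finsum':
  assumes "finite I" "\<And>i. i \<in> I \<Longrightarrow> f i = pcomb G (c i)"
  shows "(\<Oplus>\<^bsub>A_par G\<^esub>i\<in>I. f i) = (pcomb G (\<lambda>A. \<Sum>i\<in>I. c i A) :: ('g list \<Rightarrow> 'k::field) set)"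
proof -
  interpret A: ring "A_par G :: ('k, _) module" by (rule k_algebra_ring[OF A_par_k_algebra])
  have "(\<Oplus>\<^bsub>A_par G\<^esub>i\<in>I. f i) = (\<Oplus>\<^bsub>A_par G\<^esub>i\<in>I. pcomb G (c i))"
    by (rule A.finsum_cong') (use assms in auto)
  then show ?thesis using pcomb_finsum[OF assms(1)] by simp
qed

lemma pointed_setsD: "A \<in> pointed_sets G \<Longrightarrow> A \<in> nesubsets G" "A \<in> pointed_sets G \<Longrightarrow> A \<subseteq> carrier G"
  by (auto simp: pointed_sets_def nesubsets_def)

text \<open>This turns the factor [g \<in> A] in the partial action into extension by zero from the
  pointed sets to all nonempty sets.\<close>

lemma inv_l_coset_pointed:
  "g \<in> carrier G \<Longrightarrow> A \<in> nesubsets G \<Longrightarrow> inv g <# A \<in> pointed_sets G \<longleftrightarrow> g \<in> A"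
  using l_coset_subset_G[of A "inv g"] by (auto simp: pointed_sets_def nesubsets_def l_coset_mem)

lemma translate_apply: "A \<in> nesubsets G \<Longrightarrow> translate G g c A = c (inv g <# A)"
  by (simp add: translate_def)

lemma translate_translate:
  assumes "g \<in> carrier G" "h \<in> carrier G"
  shows "translate G h (translate G g c) = translate G (h \<otimes> g) c"
  using assms by (auto simp: translate_def l_coset_nesubsets l_coset_nesubsets_assoc inv_mult_group)

text \<open>For x in X the set \<open>inv x <# X\<close> is pointed, and c(X) is the value there of
  the translate of c by \<open>inv x\<close>. Although \<open>pcomb\<close> sees pointed sets only,
  the translates together determine c; this is injectivity for the globalization and for the
  morphisms alike.\<close>

lemma fun_determined:
  fixes c d :: "'g set \<Rightarrow> 'k::field"
  assumes c: "c \<in> carrier (fun_alg (nesubsets G))" and d: "d \<in> carrier (fun_alg (nesubsets G))"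
    and eq: "\<And>h. h \<in> carrier G \<Longrightarrow> pcomb G (translate G h c) = pcomb G (translate G h d)"
  shows "c = d"
proof
  fix X
  show "c X = d X"
  proof (cases "X \<in> nesubsets G")
    case True
    then obtain x where x: "x \<in> X" "x \<in> carrier G" by (auto simp: nesubsets_def)
    have "inv x <# X \<in> pointed_sets G" using x True by (simp add: inv_l_coset_pointed)
    then have "translate G (inv x) c (inv x <# X) = translate G (inv x) d (inv x <# X)"
      using eq[of "inv x"] x by (auto simp: pcomb_eq_iff)
    then show ?thesis using x True by (simp add: translate_apply l_coset_nesubsets_simps)
  qed (use c d in \<open>auto simp: fun_alg_carrier[OF finite_nesubsets[OF fin]]\<close>)
qed

lemma group_alg_carrier: "carrier (group_alg G :: ('k::field, _) module) = {x. \<forall>h. h \<notin> carrier G \<longrightarrow> x h = 0}"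
  using fin by (auto simp: group_alg_def span_alg_def elim: rev_finite_subset)

lemma ind_group_alg [simp]: "g \<in> carrier G \<Longrightarrow> (ind g :: 'g \<Rightarrow> 'k::field) \<in> carrier (group_alg G)"
  by (auto simp: group_alg_carrier ind_def)

text \<open>The element with components \<open>u\<^sub>h(A) = c(h\<^sup>-\<^sup>1A)\<close>,
  extended linearly to the group algebra; \<open>pcomb\<close> discards the values at sets that are
  not pointed.\<close>

definition glob_fun :: "('g set \<Rightarrow> 'k::field) \<Rightarrow> ('g \<Rightarrow> 'k) \<Rightarrow> ('g list \<Rightarrow> 'k) set" where
  "glob_fun c = (\<lambda>x\<in>carrier (group_alg G). pcomb G (\<lambda>A. \<Sum>h\<in>carrier G. x h * translate G h c A))"

lemma glob_fun_ind:
  fixes c :: "'g set \<Rightarrow> 'k::field"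
  assumes "g \<in> carrier G"
  shows "glob_fun c (ind g) = pcomb G (translate G g c)"
proof -
  have "(\<Sum>h\<in>carrier G. ind g h * translate G h c A) = (\<Sum>h\<in>carrier G. if h = g then translate G g c A else 0)" for A
    by (rule sum.cong) (auto simp: ind_def)
  then show ?thesis using assms fin by (simp add: glob_fun_def)
qed

lemma glob_fun_conv:
  fixes c d :: "'g set \<Rightarrow> 'k::field"
  shows "c \<in> carrier (fun_alg (nesubsets G)) \<Longrightarrow> d \<in> carrier (fun_alg (nesubsets G)) \<Longrightarrow>
      glob_fun (c \<otimes>\<^bsub>fun_alg (nesubsets G)\<^esub> d) = glob_fun c \<otimes>\<^bsub>conv_alg G (A_par G)\<^esub> glob_fun d"
    and "glob_fun (c \<oplus>\<^bsub>fun_alg (nesubsets G)\<^esub> d) = glob_fun c \<oplus>\<^bsub>conv_alg G (A_par G)\<^esub> glob_fun d"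
    and "glob_fun (r \<odot>\<^bsub>fun_alg (nesubsets G)\<^esub> c) = r \<odot>\<^bsub>conv_alg G (A_par G)\<^esub> glob_fun c"
    and "glob_fun \<one>\<^bsub>fun_alg (nesubsets G)\<^esub> = \<one>\<^bsub>conv_alg G (A_par G) :: ('k, _) module\<^esub>"
    and "glob_fun \<zero>\<^bsub>fun_alg (nesubsets G)\<^esub> = \<zero>\<^bsub>conv_alg G (A_par G) :: ('k, _) module\<^esub>"
    and "glob_fun c \<in> carrier (conv_alg G (A_par G))"
proof -
  note N = finite_nesubsets[OF fin]
  note F = fun_alg_simps[OF N]
  let ?kG = "group_alg G :: ('k, _) module"
  have ext: "f = f'" if "f \<in> extensional (carrier ?kG)" "f' \<in> extensional (carrier ?kG)"
    "\<And>x. x \<in> carrier ?kG \<Longrightarrow> f x = f' x" for f f' :: "('g \<Rightarrow> 'k) \<Rightarrow> ('g list \<Rightarrow> 'k) set"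
    using that by (rule extensionalityI)
  have gx: "glob_fun c x = pcomb G (\<lambda>A. \<Sum>h\<in>carrier G. x h * c (inv h <# A))" if "x \<in> carrier ?kG"
    for c :: "'g set \<Rightarrow> 'k" and x
    using that by (auto simp: glob_fun_def translate_apply pointed_setsD intro!: pcomb_cong)
  have lN: "inv h <# A \<in> nesubsets G" if "h \<in> carrier G" "A \<in> pointed_sets G" for h A
    using that by (simp add: l_coset_nesubsets pointed_setsD)
  show "glob_fun (c \<otimes>\<^bsub>fun_alg (nesubsets G)\<^esub> d) = glob_fun c \<otimes>\<^bsub>conv_alg G (A_par G)\<^esub> glob_fun d"
    if cd: "c \<in> carrier (fun_alg (nesubsets G))" "d \<in> carrier (fun_alg (nesubsets G))"
  proof (rule ext)
    fix x assume x: "x \<in> carrier ?kG"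
    have "(glob_fun c \<otimes>\<^bsub>conv_alg G (A_par G)\<^esub> glob_fun d) x
        = (\<Oplus>\<^bsub>A_par G\<^esub>h\<in>carrier G. x h \<odot>\<^bsub>A_par G\<^esub> (glob_fun c (ind h) \<otimes>\<^bsub>A_par G\<^esub> glob_fun d (ind h)))"
      using x by (simp add: conv_alg_def)
    also have "\<dots> = pcomb G (\<lambda>A. \<Sum>h\<in>carrier G. x h * (translate G h c A * translate G h d A))"
      by (rule pcomb_finsum'[OF fin]) (simp add: glob_fun_ind pcomb_simps)
    also have "\<dots> = glob_fun (c \<otimes>\<^bsub>fun_alg (nesubsets G)\<^esub> d) x"
      using x cd by (auto simp: gx fun_alg_mult[OF N] translate_apply pointed_setsD intro!: pcomb_cong)
    finally show "glob_fun (c \<otimes>\<^bsub>fun_alg (nesubsets G)\<^esub> d) x = (glob_fun c \<otimes>\<^bsub>conv_alg G (A_par G)\<^esub> glob_fun d) x" ..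
  qed (simp_all add: glob_fun_def conv_alg_def)
  show "glob_fun (c \<oplus>\<^bsub>fun_alg (nesubsets G)\<^esub> d) = glob_fun c \<oplus>\<^bsub>conv_alg G (A_par G)\<^esub> glob_fun d"
    by (rule ext) (simp_all add: gx F pcomb_simps distrib_left sum.distrib conv_alg_def, simp_all add: glob_fun_def)
  show "glob_fun (r \<odot>\<^bsub>fun_alg (nesubsets G)\<^esub> c) = r \<odot>\<^bsub>conv_alg G (A_par G)\<^esub> glob_fun c"
    by (rule ext) (simp_all add: gx F pcomb_simps sum_distrib_left mult.left_commute conv_alg_def, simp_all add: glob_fun_def)
  show "glob_fun \<zero>\<^bsub>fun_alg (nesubsets G)\<^esub> = \<zero>\<^bsub>conv_alg G (A_par G) :: ('k, _) module\<^esub>"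
    by (rule ext) (simp_all add: gx F pcomb_simps conv_alg_def, simp_all add: glob_fun_def)
  show "glob_fun \<one>\<^bsub>fun_alg (nesubsets G)\<^esub> = \<one>\<^bsub>conv_alg G (A_par G) :: ('k, _) module\<^esub>"
  proof (rule ext)
    fix x assume x: "x \<in> carrier ?kG"
    have "\<one>\<^bsub>conv_alg G (A_par G) :: ('k, _) module\<^esub> x = (\<Oplus>\<^bsub>A_par G\<^esub>h\<in>carrier G. x h \<odot>\<^bsub>A_par G\<^esub> \<one>\<^bsub>A_par G\<^esub>)"
      using x by (simp add: conv_alg_def)
    also have "\<dots> = pcomb G (\<lambda>A. \<Sum>h\<in>carrier G. x h)"
      by (rule pcomb_finsum'[OF fin]) (simp add: pcomb_simps)
    also have "\<dots> = glob_fun \<one>\<^bsub>fun_alg (nesubsets G)\<^esub> x"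
      unfolding gx[OF x] by (rule pcomb_cong, rule sum.cong) (auto simp: F lN)
    finally show "glob_fun \<one>\<^bsub>fun_alg (nesubsets G)\<^esub> x = \<one>\<^bsub>conv_alg G (A_par G) :: ('k, _) module\<^esub> x" ..
  qed (simp_all add: glob_fun_def conv_alg_def)
  have "glob_fun c (x \<oplus>\<^bsub>?kG\<^esub> y) = glob_fun c x \<oplus>\<^bsub>A_par G\<^esub> glob_fun c y"
    "glob_fun c (r \<odot>\<^bsub>?kG\<^esub> x) = r \<odot>\<^bsub>A_par G\<^esub> glob_fun c x"
    if "x \<in> carrier ?kG" "y \<in> carrier ?kG" for x y r
  proof -
    have "x \<oplus>\<^bsub>?kG\<^esub> y \<in> carrier ?kG" "r \<odot>\<^bsub>?kG\<^esub> x \<in> carrier ?kG"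
      and xy: "x \<oplus>\<^bsub>?kG\<^esub> y = (\<lambda>h. x h + y h)" "r \<odot>\<^bsub>?kG\<^esub> x = (\<lambda>h. r * x h)"
      using that unfolding group_alg_carrier by (auto simp: group_alg_def span_alg_def)
    then show "glob_fun c (x \<oplus>\<^bsub>?kG\<^esub> y) = glob_fun c x \<oplus>\<^bsub>A_par G\<^esub> glob_fun c y"
      "glob_fun c (r \<odot>\<^bsub>?kG\<^esub> x) = r \<odot>\<^bsub>A_par G\<^esub> glob_fun c x"
      using that by (simp_all add: gx pcomb_simps xy distrib_right sum.distrib sum_distrib_left mult.assoc)
  qed
  then show "glob_fun c \<in> carrier (conv_alg G (A_par G))"
    by (auto simp: conv_alg_def lin_maps_def) (auto simp: glob_fun_def)
qed

text \<open>Right multiplication by g replaces the component at h by the one at hg, and translation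
  by hg is translation by g followed by translation by h.\<close>

lemma glob_fun_act:
  fixes c :: "'g set \<Rightarrow> 'k::field"
  assumes g: "g \<in> carrier G"
  shows "conv_act G g (glob_fun c) = glob_fun (translate G g c)"
proof (rule extensionalityI[of _ "carrier (group_alg G)"])
  let ?kG = "group_alg G :: ('k, _) module"
  fix x assume x: "x \<in> carrier ?kG"
  have xg: "x \<otimes>\<^bsub>?kG\<^esub> ind g \<in> carrier ?kG"
    using x ind_group_alg[OF g, where 'k = 'k] unfolding group_alg_def
    by (rule span_alg_mult_closed[rotated]) auto
  have supp: "{h. x h \<noteq> 0} \<subseteq> carrier G" "{h. (x \<otimes>\<^bsub>?kG\<^esub> ind g) h \<noteq> 0} \<subseteq> carrier G"
    "{h. (ind g h :: 'k) \<noteq> 0} \<subseteq> {g}"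
    using x xg by (auto simp: group_alg_carrier ind_def split: if_splits)
  have "(\<Sum>l\<in>carrier G. (x \<otimes>\<^bsub>?kG\<^esub> ind g) l * translate G l c A)
      = (\<Sum>h\<in>carrier G. x h * translate G h (translate G g c) A)" for A
  proof -
    have "(\<Sum>l\<in>carrier G. (x \<otimes>\<^bsub>?kG\<^esub> ind g) l * translate G l c A)
        = (\<Sum>h\<in>carrier G. \<Sum>y\<in>{g}. x h * ind g y * (case Some (h \<otimes> y) of None \<Rightarrow> 0 | Some z \<Rightarrow> translate G z c A))"
      unfolding group_alg_def
      by (rule span_alg_pairing[OF x[unfolded group_alg_def] ind_group_alg[OF g, unfolded group_alg_def]
            fin supp(1) _ supp(3) fin supp(2)[unfolded group_alg_def]]) simp
    also have "\<dots> = (\<Sum>h\<in>carrier G. x h * translate G h (translate G g c) A)"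
      using g by (intro sum.cong) (simp_all add: ind_def translate_translate)
    finally show ?thesis .
  qed
  then show "conv_act G g (glob_fun c) x = glob_fun (translate G g c) x"
    using x xg by (simp add: conv_act_def glob_fun_def)
qed (simp_all add: conv_act_def glob_fun_def)

text \<open>The coefficient of g \<bullet> a at A is a(\<open>inv g <# A\<close>) if g is in A and 0
  otherwise. As g is in A exactly if \<open>inv g <# A\<close> is pointed, this is the translate by
  g of the extension of a by zero.\<close>

lemma glob_phi_pcomb:
  fixes a :: "'g set \<Rightarrow> 'k::field"
  shows "glob_phi G (pcomb G a) = glob_fun (\<lambda>A. if A \<in> pointed_sets G then a A else 0)"
proof (rule extensionalityI[of _ "carrier (group_alg G)"])
  fix x :: "'g \<Rightarrow> 'k" assume x: "x \<in> carrier (group_alg G)"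
  have "glob_phi G (pcomb G a) x
      = (\<Oplus>\<^bsub>A_par G\<^esub>g\<in>carrier G. x g \<odot>\<^bsub>A_par G\<^esub> A_par_act G g (pcomb G a))"
    using x by (simp add: glob_phi_def)
  also have "\<dots> = pcomb G (\<lambda>A. \<Sum>g\<in>carrier G. x g * (if g \<in> A then a (inv g <# A) else 0))"
    by (rule pcomb_finsum'[OF fin]) (simp add: pcomb_simps)
  also have "\<dots> = glob_fun (\<lambda>A. if A \<in> pointed_sets G then a A else 0) x"
    unfolding glob_fun_def using x
    by (auto intro!: pcomb_cong sum.cong simp: translate_apply pointed_setsD inv_l_coset_pointed)
  finally show "glob_phi G (pcomb G a) x = glob_fun (\<lambda>A. if A \<in> pointed_sets G then a A else 0) x" .
qed (simp_all add: glob_phi_def glob_fun_def)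

text \<open>The image of \<open>glob_fun\<close> is a submodule containing the generators, so it
  contains the hull. Conversely, the indicator of X is the translate by some x in X of the indicator
  of the pointed set \<open>inv x <# X\<close>, which corresponds to \<open>glob_phi\<close> of an
  idempotent. Being the image of an algebra, the hull is closed under convolution.\<close>

lemma A_par_bar_carrier:
  "glob_fun ` carrier (fun_alg (nesubsets G)) = carrier (A_par_bar G :: ('k::field, _) module)"
proof -
  note N = finite_nesubsets[OF fin]
  let ?F = "fun_alg (nesubsets G) :: ('k, _) module"
  let ?C = "conv_alg G (A_par G) :: ('k, _) module"
  let ?M = "kG_submodule G ?C (conv_act G)"
  let ?gen = "glob_phi G ` carrier (A_par G :: ('k, _) module)"
  interpret F: ring ?F by (rule k_algebra_ring[OF fun_alg_k_algebra[OF N]])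
  have trc: "translate G g c \<in> carrier ?F" for g c by (simp add: fun_alg_carrier[OF N] translate_def)
  have pc: "(\<lambda>A. if A \<in> pointed_sets G then a A else 0) \<in> carrier ?F" for a
    by (auto simp: fun_alg_carrier[OF N] pointed_setsD)
  have "?M (glob_fun ` carrier ?F)"
    unfolding kG_submodule_def subspace_of_def
  proof (intro conjI ballI allI)
    show "glob_fun ` carrier ?F \<subseteq> carrier ?C" using glob_fun_conv(6) by blast
    show "\<zero>\<^bsub>?C\<^esub> \<in> glob_fun ` carrier ?F" unfolding glob_fun_conv(5)[symmetric] by blast
    show "f \<oplus>\<^bsub>?C\<^esub> f' \<in> glob_fun ` carrier ?F" if "f \<in> glob_fun ` carrier ?F" "f' \<in> glob_fun ` carrier ?F" for f f'
      using that by (auto simp: glob_fun_conv(2)[symmetric])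
    show "r \<odot>\<^bsub>?C\<^esub> f \<in> glob_fun ` carrier ?F" if "f \<in> glob_fun ` carrier ?F" for f r
      using that by (auto simp: glob_fun_conv(3)[symmetric] k_algebra_smult[OF fun_alg_k_algebra[OF N]])
    show "conv_act G g f \<in> glob_fun ` carrier ?F" if "g \<in> carrier G" "f \<in> glob_fun ` carrier ?F" for g f
      using that trc by (auto simp: glob_fun_act)
  qed
  moreover have "?gen \<subseteq> glob_fun ` carrier ?F"
    using pc by (auto simp: A_par_carrier glob_phi_pcomb)
  ultimately have "?M hull ?gen \<subseteq> glob_fun ` carrier ?F" by (rule hull_minimal[rotated])
  moreover have "glob_fun c \<in> S" if c: "c \<in> carrier ?F" and S: "?M S" "?gen \<subseteq> S" for c S
  proof -
    have cl: "\<zero>\<^bsub>?C\<^esub> \<in> S" "f \<in> S \<Longrightarrow> f' \<in> S \<Longrightarrow> f \<oplus>\<^bsub>?C\<^esub> f' \<in> S" "f \<in> S \<Longrightarrow> r \<odot>\<^bsub>?C\<^esub> f \<in> S"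
      "g \<in> carrier G \<Longrightarrow> f \<in> S \<Longrightarrow> conv_act G g f \<in> S" for f f' r g
      using S(1) by (simp_all add: kG_submodule_def subspace_of_def)
    have ind: "glob_fun (ind X) \<in> S" if X: "X \<in> nesubsets G" for X
    proof -
      obtain x where x: "x \<in> X" "x \<in> carrier G" using X by (auto simp: nesubsets_def)
      let ?Y = "inv x <# X"
      have Y: "?Y \<in> pointed_sets G" using x X by (simp add: inv_l_coset_pointed)
      have "(\<lambda>A. if A \<in> pointed_sets G then ind ?Y A else 0) = (ind ?Y :: _ \<Rightarrow> 'k)"
        using Y by (auto simp: ind_def)
      moreover have "glob_phi G (pcomb G (ind ?Y :: _ \<Rightarrow> 'k)) \<in> S" using S(2) pcomb_closed by blast
      ultimately have "glob_fun (ind ?Y :: _ \<Rightarrow> 'k) \<in> S" by (simp only: glob_phi_pcomb)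
      then have "glob_fun (translate G x (ind ?Y :: _ \<Rightarrow> 'k)) \<in> S"
        unfolding glob_fun_act[OF x(2), symmetric] by (rule cl(4)[OF x(2)])
      moreover have "translate G x (ind ?Y) = (ind X :: _ \<Rightarrow> 'k)"
      proof
        fix Z
        have "inv x <# Z = ?Y \<longleftrightarrow> Z = X" if Z: "Z \<in> nesubsets G"
        proof
          assume "inv x <# Z = ?Y"
          then have "x <# (inv x <# Z) = x <# ?Y" by simp
          then show "Z = X" using x X Z by (simp add: l_coset_nesubsets_assoc l_coset_nesubsets_one)
        qed simp
        then show "translate G x (ind ?Y) Z = (ind X Z :: 'k)"
          using X by (auto simp: translate_def ind_def)
      qed
      ultimately show ?thesis by simp
    qed
    \<comment> \<open>\<open>S\<close> is closed under binary sums, so \<open>c\<close> is assembled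
      from its indicators one set at a time.\<close>
    have "glob_fun (\<lambda>X. if X \<in> T then c X else 0) \<in> S" if "finite T" "T \<subseteq> nesubsets G" for T
      using that
    proof (induction T rule: finite_induct)
      case empty
      have "glob_fun (\<lambda>X. 0) = \<zero>\<^bsub>?C\<^esub>" using glob_fun_conv(5) by (simp add: fun_alg_simps[OF N])
      then show ?case using cl(1) by simp
    next
      case (insert X T)
      have "(\<lambda>Z. if Z \<in> insert X T then c Z else 0)
          = (c X \<odot>\<^bsub>?F\<^esub> ind X) \<oplus>\<^bsub>?F\<^esub> (\<lambda>Z. if Z \<in> T then c Z else 0)"
        using insert.hyps by (auto simp: fun_alg_simps[OF N] ind_def)
      then show ?case
        using insert ind by (simp only: glob_fun_conv(2,3)) (intro cl, auto)
    qed
    from this[OF N subset_refl] have "glob_fun (\<lambda>X. if X \<in> nesubsets G then c X else 0) \<in> S" .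
    moreover have "(\<lambda>X. if X \<in> nesubsets G then c X else 0) = c"
      using c by (auto simp: fun_alg_carrier[OF N])
    ultimately show ?thesis by simp
  qed
  then have "glob_fun ` carrier ?F \<subseteq> ?M hull ?gen" by (auto simp: hull_def)
  ultimately show ?thesis by (auto simp: A_par_bar_def)
qed

lemma A_par_bar_glob_model: "glob_model G (A_par_bar G :: ('k::field, _) module) (conv_act G) glob_fun"
proof -
  note N = finite_nesubsets[OF fin]
  have ops: "mult (A_par_bar G) = mult (conv_alg G (A_par G))" "one (A_par_bar G) = one (conv_alg G (A_par G))"
    "add (A_par_bar G) = add (conv_alg G (A_par G))" "zero (A_par_bar G) = zero (conv_alg G (A_par G))"
    "smult (A_par_bar G :: ('k, _) module) = smult (conv_alg G (A_par G))"
    by (simp_all add: A_par_bar_def)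
  have "alg_onto (fun_alg (nesubsets G)) (A_par_bar G :: ('k, _) module) glob_fun"
    unfolding alg_onto_def ops
    by (intro conjI ballI allI A_par_bar_carrier glob_fun_conv)
  moreover have "inj_on glob_fun (carrier (fun_alg (nesubsets G) :: ('k, _) module))"
    by (rule inj_onI, rule fun_determined) (auto simp: glob_fun_ind[symmetric])
  ultimately show ?thesis by (simp add: glob_model_def glob_fun_act)
qed

section \<open>Morphisms of partial modules\<close>

lemma A_par_module: "module scalars (A_par G :: ('k::field, _) module)"
  by (rule k_algebra_module[OF A_par_k_algebra])

lemma tens_A_par_carrier:
  "carrier (tens_kG G (A_par G :: ('k::field, _) module)) = carrier G \<rightarrow>\<^sub>E carrier (A_par G)"
  using fin by (auto simp: tens_kG_def)

lemma tens_coordinates: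
  assumes "t \<in> carrier (tens_kG G (A_par G :: ('k::field, _) module))"
  shows "\<exists>v. \<forall>h\<in>carrier G. t h = pcomb G (v h)"
proof -
  have "\<forall>h\<in>carrier G. \<exists>c. t h = pcomb G c"
    using assms by (auto simp: tens_A_par_carrier PiE_iff A_par_carrier)
  then show ?thesis by metis
qed

lemma tens_closed_coordinates:
  assumes "t \<in> extensional (carrier G)" "\<And>h. h \<in> carrier G \<Longrightarrow> t h = pcomb G (v h)"
  shows "t \<in> carrier (tens_kG G (A_par G :: ('k::field, _) module))"
  using assms by (auto simp: tens_A_par_carrier PiE_iff)

text \<open>The morphism \<open>a \<otimes> h \<mapsto> a u\<^sub>h\<close> with
  \<open>u\<^sub>h = pcomb G (translate G h c)\<close>. Linearity over \<open>A_par\<close> leaves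
  only the elements \<open>u\<^sub>h\<close> to be chosen.\<close>

definition AA_fun :: "('g set \<Rightarrow> 'k::field) \<Rightarrow> ('g \<Rightarrow> ('g list \<Rightarrow> 'k) set) \<Rightarrow> ('g list \<Rightarrow> 'k) set" where
  "AA_fun c = (\<lambda>t\<in>carrier (tens_kG G (A_par G)).
     \<Oplus>\<^bsub>A_par G\<^esub>h\<in>carrier G. t h \<otimes>\<^bsub>A_par G\<^esub> pcomb G (translate G h c))"

lemma AA_fun_eval:
  fixes c :: "'g set \<Rightarrow> 'k::field"
  assumes "t \<in> extensional (carrier G)" "\<And>h. h \<in> carrier G \<Longrightarrow> t h = pcomb G (v h)"
  shows "AA_fun c t = pcomb G (\<lambda>A. \<Sum>h\<in>carrier G. v h A * translate G h c A)"
proof -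
  have "AA_fun c t = (\<Oplus>\<^bsub>A_par G\<^esub>h\<in>carrier G. t h \<otimes>\<^bsub>A_par G\<^esub> pcomb G (translate G h c))"
    using tens_closed_coordinates[OF assms] by (simp add: AA_fun_def)
  also have "\<dots> = pcomb G (\<lambda>A. \<Sum>h\<in>carrier G. v h A * translate G h c A)"
    by (rule pcomb_finsum'[OF fin]) (simp add: assms pcomb_simps)
  finally show ?thesis .
qed

abbreviation pure :: "('g list \<Rightarrow> 'k::field) set \<Rightarrow> 'g \<Rightarrow> 'g \<Rightarrow> ('g list \<Rightarrow> 'k) set" where
  "pure a h \<equiv> tens G (A_par G) a (ind h)"

lemma pure_eq:
  fixes a :: "('g list \<Rightarrow> 'k::field) set"
  assumes "a \<in> carrier (A_par G)"
  shows "pure a h = (\<lambda>l\<in>carrier G. if l = h then a else \<zero>\<^bsub>A_par G\<^esub>)"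
  by (rule tens_ind[OF A_par_module assms])

lemma pure_closed:
  fixes a :: "('g list \<Rightarrow> 'k::field) set"
  assumes "a \<in> carrier (A_par G)"
  shows "pure a h \<in> carrier (tens_kG G (A_par G))"
  by (rule tens_closed[OF fin A_par_module assms])

lemma AA_fun_pure:
  fixes a c :: "'g set \<Rightarrow> 'k::field"
  assumes h: "h \<in> carrier G"
  shows "AA_fun c (pure (pcomb G a) h) = pcomb G (\<lambda>A. a A * translate G h c A)"
proof -
  have "AA_fun c (pure (pcomb G a) h)
      = pcomb G (\<lambda>A. \<Sum>l\<in>carrier G. (if l = h then a A else 0) * translate G l c A)"
    by (rule AA_fun_eval) (auto simp: pure_eq pcomb_simps)
  also have "(\<lambda>A. \<Sum>l\<in>carrier G. (if l = h then a A else 0) * translate G l c A)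
      = (\<lambda>A. \<Sum>l\<in>carrier G. if l = h then a A * translate G h c A else 0)"
    by (intro ext sum.cong) auto
  finally show ?thesis using h fin by simp
qed

lemma AA_fun_ext:
  fixes f f' :: "('g \<Rightarrow> ('g list \<Rightarrow> 'k::field) set) \<Rightarrow> ('g list \<Rightarrow> 'k) set"
  assumes "f \<in> extensional (carrier (tens_kG G (A_par G)))" "f' \<in> extensional (carrier (tens_kG G (A_par G)))"
    and "\<And>t v. t \<in> carrier (tens_kG G (A_par G)) \<Longrightarrow> t \<in> extensional (carrier G) \<Longrightarrow>
      (\<And>h. h \<in> carrier G \<Longrightarrow> t h = pcomb G (v h)) \<Longrightarrow> f t = f' t"
  shows "f = f'"
proof (rule extensionalityI[OF assms(1,2)])
  fix t assume t: "t \<in> carrier (tens_kG G (A_par G :: ('k, _) module))"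
  obtain v where "\<And>h. h \<in> carrier G \<Longrightarrow> t h = pcomb G (v h)" using tens_coordinates[OF t] by blast
  then show "f t = f' t" using t assms(3) by (auto simp: tens_A_par_carrier PiE_iff)
qed

lemma AA_fun_extensional: "AA_fun (c :: 'g set \<Rightarrow> 'k::field) \<in> extensional (carrier (tens_kG G (A_par G)))"
  by (simp add: AA_fun_def)

lemma AA_alg_simps:
  fixes f f' :: "('g \<Rightarrow> ('g list \<Rightarrow> 'k::field) set) \<Rightarrow> ('g list \<Rightarrow> 'k) set"
  shows "carrier (AA_alg G :: ('k, _) module) =
      pmod_hom G (tens_kG G (A_par G)) (diag_act G (A_par_act G)) (A_par G) (A_par_act G)"
    and "f \<otimes>\<^bsub>AA_alg G\<^esub> f' = (\<lambda>t\<in>carrier (tens_kG G (A_par G)).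
      \<Oplus>\<^bsub>A_par G\<^esub>h\<in>carrier G. f' (pure (f (pure (t h) h)) h))"
    and "\<one>\<^bsub>AA_alg G :: ('k, _) module\<^esub> = (\<lambda>t\<in>carrier (tens_kG G (A_par G)). \<Oplus>\<^bsub>A_par G\<^esub>h\<in>carrier G. t h)"
    and "\<zero>\<^bsub>AA_alg G :: ('k, _) module\<^esub> = (\<lambda>t\<in>carrier (tens_kG G (A_par G)). \<zero>\<^bsub>A_par G\<^esub>)"
    and "f \<oplus>\<^bsub>AA_alg G\<^esub> f' = (\<lambda>t\<in>carrier (tens_kG G (A_par G)). f t \<oplus>\<^bsub>A_par G\<^esub> f' t)"
    and "r \<odot>\<^bsub>AA_alg G\<^esub> f = (\<lambda>t\<in>carrier (tens_kG G (A_par G)). r \<odot>\<^bsub>A_par G\<^esub> f t)"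
  by (simp_all add: AA_alg_def Let_def)

text \<open>Composition keeps the group component h and multiplies a first by the component of c and
  then by that of d. Translation is multiplicative, so composition becomes the pointwise
  product.\<close>

lemma AA_fun_alg:
  fixes c d :: "'g set \<Rightarrow> 'k::field"
  shows "c \<in> carrier (fun_alg (nesubsets G)) \<Longrightarrow> d \<in> carrier (fun_alg (nesubsets G)) \<Longrightarrow>
      AA_fun (c \<otimes>\<^bsub>fun_alg (nesubsets G)\<^esub> d) = AA_fun c \<otimes>\<^bsub>AA_alg G\<^esub> AA_fun d"
    and "AA_fun (c \<oplus>\<^bsub>fun_alg (nesubsets G)\<^esub> d) = AA_fun c \<oplus>\<^bsub>AA_alg G\<^esub> AA_fun d"
    and "AA_fun (r \<odot>\<^bsub>fun_alg (nesubsets G)\<^esub> c) = r \<odot>\<^bsub>AA_alg G\<^esub> AA_fun c"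
    and "AA_fun \<one>\<^bsub>fun_alg (nesubsets G)\<^esub> = \<one>\<^bsub>AA_alg G :: ('k, _) module\<^esub>"
    and "AA_fun \<zero>\<^bsub>fun_alg (nesubsets G)\<^esub> = \<zero>\<^bsub>AA_alg G :: ('k, _) module\<^esub>"
proof -
  note N = finite_nesubsets[OF fin]
  note F = fun_alg_simps[OF N]
  note S = AA_alg_simps
  have lN: "inv h <# A \<in> nesubsets G" if "h \<in> carrier G" "A \<in> pointed_sets G" for h A
    using that by (simp add: l_coset_nesubsets pointed_setsD)
  have tr: "translate G h c A = c (inv h <# A)" if "A \<in> pointed_sets G" for h A and c :: "'g set \<Rightarrow> 'k"
    using that by (simp add: translate_def pointed_setsD)
  show "AA_fun (c \<otimes>\<^bsub>fun_alg (nesubsets G)\<^esub> d) = AA_fun c \<otimes>\<^bsub>AA_alg G\<^esub> AA_fun d"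
    if cd: "c \<in> carrier (fun_alg (nesubsets G))" "d \<in> carrier (fun_alg (nesubsets G))"
  proof (rule AA_fun_ext)
    fix t v assume t: "t \<in> carrier (tens_kG G (A_par G :: ('k, _) module))" "t \<in> extensional (carrier G)"
      and v: "\<And>h. h \<in> carrier G \<Longrightarrow> t h = pcomb G (v h)"
    have "(AA_fun c \<otimes>\<^bsub>AA_alg G\<^esub> AA_fun d) t = (\<Oplus>\<^bsub>A_par G\<^esub>h\<in>carrier G. AA_fun d (pure (AA_fun c (pure (t h) h)) h))"
      using t(1) by (simp add: S)
    also have "\<dots> = pcomb G (\<lambda>A. \<Sum>h\<in>carrier G. v h A * translate G h c A * translate G h d A)"
      by (rule pcomb_finsum'[OF fin]) (simp add: v AA_fun_pure)
    also have "\<dots> = AA_fun (c \<otimes>\<^bsub>fun_alg (nesubsets G)\<^esub> d) t"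
      using cd by (simp add: AA_fun_eval[OF t(2) v] pcomb_eq_iff tr fun_alg_mult[OF N] mult.assoc)
    finally show "AA_fun (c \<otimes>\<^bsub>fun_alg (nesubsets G)\<^esub> d) t = (AA_fun c \<otimes>\<^bsub>AA_alg G\<^esub> AA_fun d) t" ..
  qed (simp_all add: AA_fun_extensional S)
  show "AA_fun (c \<oplus>\<^bsub>fun_alg (nesubsets G)\<^esub> d) = AA_fun c \<oplus>\<^bsub>AA_alg G\<^esub> AA_fun d"
  proof (rule AA_fun_ext)
    fix t v assume t: "t \<in> carrier (tens_kG G (A_par G :: ('k, _) module))" "t \<in> extensional (carrier G)"
      and v: "\<And>h. h \<in> carrier G \<Longrightarrow> t h = pcomb G (v h)"
    show "AA_fun (c \<oplus>\<^bsub>fun_alg (nesubsets G)\<^esub> d) t = (AA_fun c \<oplus>\<^bsub>AA_alg G\<^esub> AA_fun d) t"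
      using t by (simp add: S AA_fun_eval[OF t(2) v] pcomb_simps pcomb_eq_iff tr F distrib_left sum.distrib)
  qed (simp_all add: AA_fun_extensional S)
  show "AA_fun (r \<odot>\<^bsub>fun_alg (nesubsets G)\<^esub> c) = r \<odot>\<^bsub>AA_alg G\<^esub> AA_fun c"
  proof (rule AA_fun_ext)
    fix t v assume t: "t \<in> carrier (tens_kG G (A_par G :: ('k, _) module))" "t \<in> extensional (carrier G)"
      and v: "\<And>h. h \<in> carrier G \<Longrightarrow> t h = pcomb G (v h)"
    show "AA_fun (r \<odot>\<^bsub>fun_alg (nesubsets G)\<^esub> c) t = (r \<odot>\<^bsub>AA_alg G\<^esub> AA_fun c) t"
      using t by (simp add: S AA_fun_eval[OF t(2) v] pcomb_simps pcomb_eq_iff tr F sum_distrib_left mult.left_commute)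
  qed (simp_all add: AA_fun_extensional S)
  show "AA_fun \<zero>\<^bsub>fun_alg (nesubsets G)\<^esub> = \<zero>\<^bsub>AA_alg G :: ('k, _) module\<^esub>"
  proof (rule AA_fun_ext)
    fix t v assume t: "t \<in> carrier (tens_kG G (A_par G :: ('k, _) module))" "t \<in> extensional (carrier G)"
      and v: "\<And>h. h \<in> carrier G \<Longrightarrow> t h = pcomb G (v h)"
    show "AA_fun \<zero>\<^bsub>fun_alg (nesubsets G)\<^esub> t = (\<zero>\<^bsub>AA_alg G :: ('k, _) module\<^esub>) t"
      using t by (simp add: S AA_fun_eval[OF t(2) v] pcomb_simps pcomb_eq_iff tr F)
  qed (simp_all add: AA_fun_extensional S)
  show "AA_fun \<one>\<^bsub>fun_alg (nesubsets G)\<^esub> = \<one>\<^bsub>AA_alg G :: ('k, _) module\<^esub>"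
  proof (rule AA_fun_ext)
    fix t v assume t: "t \<in> carrier (tens_kG G (A_par G :: ('k, _) module))" "t \<in> extensional (carrier G)"
      and v: "\<And>h. h \<in> carrier G \<Longrightarrow> t h = pcomb G (v h)"
    have "\<one>\<^bsub>AA_alg G :: ('k, _) module\<^esub> t = (\<Oplus>\<^bsub>A_par G\<^esub>h\<in>carrier G. t h)" using t(1) by (simp add: S)
    also have "\<dots> = pcomb G (\<lambda>A. \<Sum>h\<in>carrier G. v h A)"
      by (rule pcomb_finsum'[OF fin v])
    finally show "AA_fun \<one>\<^bsub>fun_alg (nesubsets G)\<^esub> t = \<one>\<^bsub>AA_alg G :: ('k, _) module\<^esub> t"
      by (simp add: AA_fun_eval[OF t(2) v] pcomb_eq_iff tr F lN)
  qed (simp_all add: AA_fun_extensional S)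
qed

lemma AA_fun_closed: "AA_fun c \<in> carrier (AA_alg G :: ('k::field, _) module)"
proof -
  let ?A = "A_par G :: ('k, _) module"
  let ?T = "tens_kG G ?A"
  have clo: "AA_fun c t \<in> carrier ?A" if t: "t \<in> carrier ?T" for t
  proof -
    obtain v where "\<And>h. h \<in> carrier G \<Longrightarrow> t h = pcomb G (v h)" using tens_coordinates[OF t] by blast
    then show ?thesis using t by (subst AA_fun_eval[of t v]) (auto simp: tens_A_par_carrier PiE_iff)
  qed
  have "AA_fun c (s \<oplus>\<^bsub>?T\<^esub> t) = AA_fun c s \<oplus>\<^bsub>?A\<^esub> AA_fun c t" if st: "s \<in> carrier ?T" "t \<in> carrier ?T" for s t
  proof -
    obtain u where u: "\<And>h. h \<in> carrier G \<Longrightarrow> s h = pcomb G (u h)" using tens_coordinates[OF st(1)] by blast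
    obtain v where v: "\<And>h. h \<in> carrier G \<Longrightarrow> t h = pcomb G (v h)" using tens_coordinates[OF st(2)] by blast
    have e: "s \<in> extensional (carrier G)" "t \<in> extensional (carrier G)"
      using st by (auto simp: tens_A_par_carrier PiE_iff)
    have "AA_fun c (s \<oplus>\<^bsub>?T\<^esub> t) = pcomb G (\<lambda>A. \<Sum>h\<in>carrier G. (u h A + v h A) * translate G h c A)"
      by (rule AA_fun_eval) (simp_all add: tens_kG_def u v pcomb_simps)
    then show ?thesis
      by (simp add: AA_fun_eval[OF e(1) u] AA_fun_eval[OF e(2) v] pcomb_simps distrib_right sum.distrib)
  qed
  moreover have "AA_fun c (r \<odot>\<^bsub>?T\<^esub> t) = r \<odot>\<^bsub>?A\<^esub> AA_fun c t" if t: "t \<in> carrier ?T" for r t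
  proof -
    obtain v where v: "\<And>h. h \<in> carrier G \<Longrightarrow> t h = pcomb G (v h)" using tens_coordinates[OF t] by blast
    have e: "t \<in> extensional (carrier G)" using t by (auto simp: tens_A_par_carrier PiE_iff)
    have "AA_fun c (r \<odot>\<^bsub>?T\<^esub> t) = pcomb G (\<lambda>A. \<Sum>h\<in>carrier G. (r * v h A) * translate G h c A)"
      by (rule AA_fun_eval) (simp_all add: tens_kG_def v pcomb_simps)
    then show ?thesis
      by (simp add: AA_fun_eval[OF e v] pcomb_simps sum_distrib_left mult.assoc)
  qed
  moreover have "AA_fun c (diag_act G (A_par_act G) g t) = A_par_act G g (AA_fun c t)"
    if g: "g \<in> carrier G" and t: "t \<in> carrier ?T" for g t
  proof -
    obtain v where v: "\<And>h. h \<in> carrier G \<Longrightarrow> t h = pcomb G (v h)" using tens_coordinates[OF t] by blast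
    have e: "t \<in> extensional (carrier G)" using t by (auto simp: tens_A_par_carrier PiE_iff)
    have "AA_fun c (diag_act G (A_par_act G) g t) = pcomb G (\<lambda>A. \<Sum>l\<in>carrier G.
        (if g \<in> A then v (inv g \<otimes> l) (inv g <# A) else 0) * translate G l c A)"
      by (rule AA_fun_eval) (use g in \<open>simp_all add: diag_act_def v pcomb_simps\<close>)
    also have "\<dots> = pcomb G (\<lambda>A. if g \<in> A then \<Sum>h\<in>carrier G. v h (inv g <# A) * translate G h c (inv g <# A) else 0)"
    proof (rule pcomb_cong)
      fix A assume A: "A \<in> pointed_sets G"
      show "(\<Sum>l\<in>carrier G. (if g \<in> A then v (inv g \<otimes> l) (inv g <# A) else 0) * translate G l c A)
          = (if g \<in> A then \<Sum>h\<in>carrier G. v h (inv g <# A) * translate G h c (inv g <# A) else 0)"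
      proof (cases "g \<in> A")
        case True
        \<comment> \<open>Substituting l = gh; the coefficients of c agree because the inverse of gh
          takes A to \<open>inv h <# (inv g <# A)\<close>.\<close>
        have "(\<Sum>l\<in>carrier G. v (inv g \<otimes> l) (inv g <# A) * translate G l c A)
            = (\<Sum>h\<in>carrier G. v h (inv g <# A) * translate G h c (inv g <# A))"
          by (rule sum.reindex_bij_witness[of _ "\<lambda>h. g \<otimes> h" "\<lambda>l. inv g \<otimes> l"])
             (use g pointed_setsD(1)[OF A] in
               \<open>auto simp: inv_cancel_left translate_def l_coset_nesubsets l_coset_nesubsets_assoc inv_mult_group m_assoc\<close>)
        then show ?thesis using True by simp
      qed simp
    qed
    also have "\<dots> = A_par_act G g (AA_fun c t)"
      using g by (simp add: AA_fun_eval[OF e v] pcomb_simps)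
    finally show ?thesis .
  qed
  ultimately show ?thesis
    using clo AA_fun_extensional[of c]
    by (auto simp: AA_alg_simps pmod_hom_def lin_maps_def PiE_iff)
qed

lemma AA_fun_act:
  fixes c :: "'g set \<Rightarrow> 'k::field"
  assumes g: "g \<in> carrier G"
  shows "AA_act G g (AA_fun c) = AA_fun (translate G g c)"
proof (rule AA_fun_ext)
  fix t v assume t: "t \<in> carrier (tens_kG G (A_par G :: ('k, _) module))" "t \<in> extensional (carrier G)"
    and v: "\<And>h. h \<in> carrier G \<Longrightarrow> t h = pcomb G (v h)"
  have "AA_act G g (AA_fun c) t = AA_fun c (rshift G g t)" using t(1) by (simp add: AA_act_def)
  also have "\<dots> = pcomb G (\<lambda>A. \<Sum>l\<in>carrier G. v (l \<otimes> inv g) A * translate G l c A)"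
    by (rule AA_fun_eval) (use g in \<open>simp_all add: rshift_def v\<close>)
  also have "(\<lambda>A. \<Sum>l\<in>carrier G. v (l \<otimes> inv g) A * translate G l c A)
      = (\<lambda>A. \<Sum>h\<in>carrier G. v h A * translate G h (translate G g c) A)"
  proof
    fix A
    show "(\<Sum>l\<in>carrier G. v (l \<otimes> inv g) A * translate G l c A)
        = (\<Sum>h\<in>carrier G. v h A * translate G h (translate G g c) A)"
      by (rule sum.reindex_bij_witness[of _ "\<lambda>h. h \<otimes> g" "\<lambda>l. l \<otimes> inv g"])
         (use g in \<open>auto simp: m_assoc translate_translate\<close>)
  qed
  also have "pcomb G \<dots> = AA_fun (translate G g c) t"
    by (rule AA_fun_eval[OF t(2) v, symmetric])
  finally show "AA_act G g (AA_fun c) t = AA_fun (translate G g c) t" .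
qed (simp_all add: AA_fun_extensional AA_act_def)

text \<open>A morphism \<open>f\<close> commutes with the \<open>\<epsilon>\<^sub>g\<close>, which act on both sides by multiplication, so
  it is \<open>A\<^sub>p\<^sub>a\<^sub>r\<close>-linear and determined by the elements \<open>f (1 \<otimes> h)\<close>.\<close>

lemma pmod_hom_A_par_linear:
  fixes f :: "('g \<Rightarrow> ('g list \<Rightarrow> 'k::field) set) \<Rightarrow> ('g list \<Rightarrow> 'k) set"
  assumes f: "f \<in> carrier (AA_alg G)" and h: "h \<in> carrier G"
  shows "f (pure (pcomb G a) h) = pcomb G a \<otimes>\<^bsub>A_par G\<^esub> f (pure \<one>\<^bsub>A_par G\<^esub> h)"
proof -
  let ?A = "A_par G :: ('k, _) module"
  let ?T = "tens_kG G ?A"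
  let ?K = "k_par G :: ('k, _) module"
  interpret K: partial_rep G ?K "par_gen G" by (rule k_par_partial_rep[OF G fin])
  interpret A: ring ?A by (rule k_algebra_ring[OF A_par_k_algebra])
  interpret M: module scalars ?A by (rule A_par_module)
  note f' = f[unfolded AA_alg_simps pmod_hom_def lin_maps_def]
  have fc: "f t \<in> carrier ?A" if "t \<in> carrier ?T" for t using f' that by (auto simp: PiE_iff)
  have fadd: "f (s \<oplus>\<^bsub>?T\<^esub> t) = f s \<oplus>\<^bsub>?A\<^esub> f t" if "s \<in> carrier ?T" "t \<in> carrier ?T" for s t
    using f' that by auto
  have fsm: "f (r \<odot>\<^bsub>?T\<^esub> t) = r \<odot>\<^bsub>?A\<^esub> f t" if "t \<in> carrier ?T" for r t
    using f' that by auto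
  have fact': "f (diag_act G (A_par_act G) g t) = A_par_act G g (f t)" if "g \<in> carrier G" "t \<in> carrier ?T" for g t
    using f' that by auto
  have obt: "\<exists>c. a = pcomb G c" if "a \<in> carrier ?A" for a
    using that by (auto simp: A_par_carrier)
  have padd: "pure (a \<oplus>\<^bsub>?A\<^esub> b) h = pure a h \<oplus>\<^bsub>?T\<^esub> pure b h"
    and psm: "pure (r \<odot>\<^bsub>?A\<^esub> a) h = r \<odot>\<^bsub>?T\<^esub> pure a h" if "a \<in> carrier ?A" "b \<in> carrier ?A" for a b r
    using that k_algebra_smult(1)[OF A_par_k_algebra that(1)]
      k_algebra_smult(9)[OF A_par_k_algebra A.zero_closed, where c = r]
    by (auto simp: pure_eq tens_kG_def restrict_def fun_eq_iff)
  have pact: "diag_act G (A_par_act G) g (pure a l) = pure (A_par_act G g a) (g \<otimes> l)"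
    if a: "a \<in> carrier ?A" and g: "g \<in> carrier G" "l \<in> carrier G" for a g l
  proof -
    obtain c where c: "a = pcomb G c" using obt[OF a] by blast
    have "pcomb G (\<lambda>A. if g \<in> A then (0::'k) else 0) = pcomb G (\<lambda>A. 0)" by simp
    then show ?thesis
      using g by (intro diag_act_tens[OF G A_par_module a]) (simp_all add: c pcomb_simps)
  qed
  \<comment> \<open>Acting by \<open>inv g\<close> and then by g is multiplication by
    \<open>K.e g\<close>. This expresses the generators of \<open>A_par\<close> through the partial
    action, which \<open>f\<close> respects.\<close>
  have ee: "A_par_act G g (A_par_act G (inv g) a) = K.e g \<otimes>\<^bsub>?A\<^esub> a" and ec: "K.e g \<in> carrier ?A"
    if a: "a \<in> carrier ?A" and g: "g \<in> carrier G" for a g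
  proof -
    obtain c where c: "a = pcomb G c" using obt[OF a] by blast
    have e: "K.e g = pcomb G (\<lambda>A. if g \<in> A then 1 else 0)" unfolding K.comb_e[OF g] pcomb_def ..
    then show "K.e g \<in> carrier ?A" by simp
    have "inv g <# A \<subseteq> carrier G" "g <# (inv g <# A) = A" if "A \<in> pointed_sets G" for A
      using that g pointed_setsD[OF that]
      by (simp_all add: l_coset_subset_G l_coset_nesubsets_assoc l_coset_nesubsets_one)
    then show "A_par_act G g (A_par_act G (inv g) a) = K.e g \<otimes>\<^bsub>?A\<^esub> a"
      unfolding c e using g
      by (auto simp: pcomb_simps pcomb_eq_iff l_coset_mem pointed_sets_def)
  qed
  have Aac: "A_par_act G g a \<in> carrier ?A" if "a \<in> carrier ?A" "g \<in> carrier G" for a g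
    using obt[OF that(1)] that(2) by (auto simp: pcomb_simps)
  \<comment> \<open>On \<open>pure b h\<close> the same two actions return the group component to h,
    so \<open>f\<close> commutes with multiplication by \<open>K.e g\<close>.\<close>
  have e_lin: "f (pure (K.e g \<otimes>\<^bsub>?A\<^esub> b) h) = K.e g \<otimes>\<^bsub>?A\<^esub> f (pure b h)"
    if b: "b \<in> carrier ?A" and g: "g \<in> carrier G" for b g
  proof -
    have d: "diag_act G (A_par_act G) (inv g) (pure b h) \<in> carrier ?T"
      using b g h by (simp add: pact Aac pure_closed)
    have "pure (K.e g \<otimes>\<^bsub>?A\<^esub> b) h = diag_act G (A_par_act G) g (diag_act G (A_par_act G) (inv g) (pure b h))"
      using b g h by (simp add: pact Aac ee[symmetric] inv_cancel_left)
    then have "f (pure (K.e g \<otimes>\<^bsub>?A\<^esub> b) h) = A_par_act G g (A_par_act G (inv g) (f (pure b h)))"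
      by (simp only: fact'[OF g d] fact'[OF inv_closed[OF g] pure_closed[OF b]])
    then show ?thesis using b g by (simp add: ee fc pure_closed)
  qed
  \<comment> \<open>The elements over which \<open>f\<close> is linear at h. The condition runs over
    all \<open>b\<close>, not only the unit, so that \<open>?L\<close> is closed under
    products.\<close>
  let ?L = "{a \<in> carrier ?A. \<forall>b\<in>carrier ?A. f (pure (a \<otimes>\<^bsub>?A\<^esub> b) h) = a \<otimes>\<^bsub>?A\<^esub> f (pure b h)}"
  have ops: "mult ?K = mult ?A" "add ?K = add ?A" "zero ?K = zero ?A" "one ?K = one ?A" "smult ?K = smult ?A"
    by (simp_all add: A_par_def)
  have Acarr: "carrier ?A = subalgebra_of ?K hull {K.e g | g. g \<in> carrier G}"
    by (simp add: A_par_def K.e_def)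
  note Asm = k_algebra_smult[OF A_par_k_algebra]
  have "subalgebra_of ?K ?L"
    unfolding subalgebra_of_def subspace_of_def ops
  proof (intro conjI ballI allI)
    have "carrier ?A \<subseteq> carrier ?K" using K.idem_alg_closed(1) by (simp add: Acarr K.idem_alg_def)
    then show "?L \<subseteq> carrier ?K" by blast
    have "f (pure \<zero>\<^bsub>?A\<^esub> h) = \<zero>\<^bsub>?A\<^esub>"
      using fsm[of "pure \<zero>\<^bsub>?A\<^esub> h" 0] psm[of "\<zero>\<^bsub>?A\<^esub>" "\<zero>\<^bsub>?A\<^esub>" 0] fc[of "pure \<zero>\<^bsub>?A\<^esub> h"]
      by (simp add: pure_closed Asm)
    then show "\<zero>\<^bsub>?A\<^esub> \<in> ?L" by (simp add: fc pure_closed)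
    show "\<one>\<^bsub>?A\<^esub> \<in> ?L" by (simp add: fc pure_closed)
    show "x \<oplus>\<^bsub>?A\<^esub> y \<in> ?L" if "x \<in> ?L" "y \<in> ?L" for x y
      using that by (simp add: A.l_distr padd fadd fc pure_closed)
    show "r \<odot>\<^bsub>?A\<^esub> x \<in> ?L" if "x \<in> ?L" for r x
      using that by (simp add: Asm psm[OF _ A.zero_closed] fsm fc pure_closed)
    show "x \<otimes>\<^bsub>?A\<^esub> y \<in> ?L" if "x \<in> ?L" "y \<in> ?L" for x y
      using that by (simp add: A.m_assoc fc pure_closed)
  qed
  moreover have "{K.e g | g. g \<in> carrier G} \<subseteq> ?L"
    using e_lin ec[OF A.one_closed] by auto
  ultimately have "carrier ?A \<subseteq> ?L"
    unfolding Acarr by (rule hull_minimal[rotated])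
  then have "pcomb G a \<in> ?L" using pcomb_closed by blast
  then have "f (pure (pcomb G a \<otimes>\<^bsub>?A\<^esub> \<one>\<^bsub>?A\<^esub>) h) = pcomb G a \<otimes>\<^bsub>?A\<^esub> f (pure \<one>\<^bsub>?A\<^esub> h)" by blast
  then show ?thesis by simp
qed

section \<open>Every morphism comes from a function on the nonempty subsets\<close>

lemma AA_alg_carrier:
  "AA_fun ` carrier (fun_alg (nesubsets G)) = carrier (AA_alg G :: ('k::field, _) module)"
proof (intro equalityI subsetI)
  note N = finite_nesubsets[OF fin]
  let ?F = "fun_alg (nesubsets G) :: ('k, _) module"
  let ?A = "A_par G :: ('k, _) module"
  let ?T = "tens_kG G ?A"
  interpret A: ring ?A by (rule k_algebra_ring[OF A_par_k_algebra])
  fix f :: "('g \<Rightarrow> ('g list \<Rightarrow> 'k) set) \<Rightarrow> ('g list \<Rightarrow> 'k) set"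
  assume f: "f \<in> carrier (AA_alg G)"
  note f' = f[unfolded AA_alg_simps pmod_hom_def]
  have lin: "f \<in> lin_maps ?T ?A" using f' by simp
  have comm: "f (diag_act G (A_par_act G) g t) = A_par_act G g (f t)" if "g \<in> carrier G" "t \<in> carrier ?T" for g t
    using f' that by simp
  have fc: "f t \<in> carrier ?A" if "t \<in> carrier ?T" for t using lin that by (auto simp: lin_maps_def PiE_iff)
  have "\<forall>h\<in>carrier G. \<exists>c. f (pure \<one>\<^bsub>?A\<^esub> h) = pcomb G c"
    using fc[OF pure_closed[OF A.one_closed]] by (auto simp: A_par_carrier)
  then obtain v where v: "\<And>h. h \<in> carrier G \<Longrightarrow> f (pure \<one>\<^bsub>?A\<^esub> h) = pcomb G (v h)" by metis
  \<comment> \<open>Compares coefficients at A in f(g \<bullet> (1 \<otimes> h)) = g \<bullet> f(1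
    \<otimes> h), where g \<bullet> 1 is the idempotent of g and comes out of \<open>f\<close> by
    linearity over \<open>A_par\<close>.\<close>
  have step: "v h (inv g <# A) = v (g \<otimes> h) A"
    if gh: "g \<in> carrier G" "h \<in> carrier G" and A: "A \<in> pointed_sets G" "g \<in> A" for g h A
  proof -
    have one: "A_par_act G g \<one>\<^bsub>?A\<^esub> = pcomb G (\<lambda>A. if g \<in> A then 1 else 0)"
      using gh by (simp add: pcomb_simps if_distrib)
    have "diag_act G (A_par_act G) g (pure \<one>\<^bsub>?A\<^esub> h) = pure (A_par_act G g \<one>\<^bsub>?A\<^esub>) (g \<otimes> h)"
      using gh by (intro diag_act_tens[OF G A_par_module]) (simp_all add: one, simp add: pcomb_simps)
    then have "f (pure (A_par_act G g \<one>\<^bsub>?A\<^esub>) (g \<otimes> h)) = A_par_act G g (f (pure \<one>\<^bsub>?A\<^esub> h))"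
      using comm[OF gh(1) pure_closed[OF A.one_closed], of h] by (simp only:)
    then have "pcomb G (\<lambda>A. (if g \<in> A then 1 else 0) * v (g \<otimes> h) A) = pcomb G (\<lambda>A. if g \<in> A then v h (inv g <# A) else 0)"
      unfolding one using gh by (simp add: pmod_hom_A_par_linear[OF f] v pcomb_simps(1,6))
    then show ?thesis using A by (auto simp: pcomb_eq_iff)
  qed
  \<comment> \<open>For x in X the set \<open>inv x <# X\<close> is pointed, so the component at
    \<open>inv x\<close> has a coefficient there. The fact \<open>c\<close> proved next shows that
    the choice of x does not influence the value.\<close>
  define c where "c = (\<lambda>X. if X \<in> nesubsets G then let k = inv (SOME x. x \<in> X) in v k (k <# X) else 0)"
  have cF: "c \<in> carrier ?F" by (simp add: c_def fun_alg_carrier[OF N])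
  have c: "c (inv h <# A) = v h A" if h: "h \<in> carrier G" and A: "A \<in> pointed_sets G" for h A
  proof -
    let ?X = "inv h <# A"
    note An = pointed_setsD[OF A]
    have X: "?X \<in> nesubsets G" using h An by (simp add: l_coset_nesubsets)
    define x where "x = (SOME x. x \<in> ?X)"
    have "\<exists>x. x \<in> ?X" using X by (auto simp: nesubsets_def)
    then have xX: "x \<in> ?X" unfolding x_def by (rule someI_ex)
    then have x: "x \<in> carrier G" using nesubsets_subset[OF X] by blast
    \<comment> \<open>This element carries A to \<open>inv x <# ?X\<close>, and its product with h
      is \<open>inv x\<close>. So \<open>step\<close> identifies \<open>v h A\<close> with the value
      chosen for \<open>c\<close>.\<close>
    let ?g = "inv x \<otimes> inv h"
    let ?A = "inv x <# ?X"
    have hx: "h \<otimes> x \<in> A" using xX x h An by (simp add: l_coset_mem)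
    have gA: "?g <# A = ?A" using x h An by (simp add: l_coset_nesubsets_assoc)
    have pA: "?A \<in> pointed_sets G" using X x xX by (simp add: inv_l_coset_pointed)
    have "\<one> \<in> A" using A by (simp add: pointed_sets_def)
    then have g: "?g \<in> ?A"
      unfolding gA[symmetric] using x h An by (simp add: l_coset_mem)
    have "inv ?g <# ?A = A"
      unfolding gA[symmetric] using x h An by (simp add: l_coset_nesubsets_assoc l_coset_nesubsets_one)
    then have "v h A = v (?g \<otimes> h) ?A"
      using step[of ?g h ?A] x h pA g by simp
    also have "?g \<otimes> h = inv x" using x h by (simp add: m_assoc)
    finally show ?thesis using X by (simp add: c_def Let_def x_def)
  qed
  have "f = AA_fun c"
  proof (rule AA_fun_ext)
    show "f \<in> extensional (carrier ?T)" using lin by (auto simp: lin_maps_def PiE_iff)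
    fix t u assume t: "t \<in> carrier ?T" "t \<in> extensional (carrier G)"
      and u: "\<And>h. h \<in> carrier G \<Longrightarrow> t h = pcomb G (u h)"
    have "f t = (\<Oplus>\<^bsub>?A\<^esub>h\<in>carrier G. f (pure (t h) h))"
      by (rule lin_maps_tens_expand[OF fin A_par_module A_par_module lin fin subset_refl t(1)]) simp
    also have "\<dots> = pcomb G (\<lambda>A. \<Sum>h\<in>carrier G. u h A * v h A)"
      by (rule pcomb_finsum'[OF fin]) (simp add: u v pmod_hom_A_par_linear[OF f] pcomb_simps(1))
    also have "\<dots> = AA_fun c t"
      by (simp add: AA_fun_eval[OF t(2) u] pcomb_eq_iff translate_def pointed_setsD c)
    finally show "f t = AA_fun c t" .
  qed (rule AA_fun_extensional)
  then show "f \<in> AA_fun ` carrier ?F" using cF by blast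
qed (use AA_fun_closed in blast)

lemma AA_alg_glob_model: "glob_model G (AA_alg G :: ('k::field, _) module) (AA_act G) AA_fun"
proof -
  have "alg_onto (fun_alg (nesubsets G)) (AA_alg G :: ('k, _) module) AA_fun"
    unfolding alg_onto_def by (intro conjI ballI allI AA_alg_carrier AA_fun_alg)
  moreover have "inj_on AA_fun (carrier (fun_alg (nesubsets G) :: ('k, _) module))"
  proof (rule inj_onI, rule fun_determined)
    fix c d :: "'g set \<Rightarrow> 'k" and h assume "AA_fun c = AA_fun d" "h \<in> carrier G"
    \<comment> \<open>Evaluation at 1 \<otimes> h isolates the component at h.\<close>
    then show "pcomb G (translate G h c) = pcomb G (translate G h d)"
      using AA_fun_pure[of h c "\<lambda>_. 1"] AA_fun_pure[of h d "\<lambda>_. 1"] by simp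
  qed
  ultimately show ?thesis by (simp add: glob_model_def AA_fun_act)
qed

end

theorem corollary5p13:
  fixes G :: "('g, 'm) monoid_scheme"
  assumes "group G" and "finite (carrier G)"
  shows "(k_glob G :: ('k::field, _) module) \<cong>\<^sub>k groupoid_alg (Gamma_glob G)
    \<and> (groupoid_alg (Gamma_glob G) :: ('k, _) module) \<cong>\<^sub>k smash G (B_alg G) (B_act G)
    \<and> (smash G (B_alg G) (B_act G) :: ('k, _) module) \<cong>\<^sub>k smash G (A_par_bar G) (conv_act G)
    \<and> (smash G (A_par_bar G) (conv_act G) :: ('k, _) module) \<cong>\<^sub>k smash G (AA_alg G) (AA_act G)
    \<and> (smash G (AA_alg G) (AA_act G) :: ('k, _) module) \<cong>\<^sub>k kG_glob G"
proof -
  let ?K = "k_glob G :: ('k, _) module"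
  have K: "?K \<cong>\<^sub>k ?K" by (rule alg_isomorphic_refl[OF k_glob_k_algebra[OF assms]])
  have B: "?K \<cong>\<^sub>k smash G (B_alg G) (B_act G)"
    and A: "?K \<cong>\<^sub>k smash G (A_par_bar G) (conv_act G)"
    and AA: "?K \<cong>\<^sub>k smash G (AA_alg G) (AA_act G)"
    using B_alg_glob_model[OF assms] A_par_bar_glob_model[OF assms] AA_alg_glob_model[OF assms]
    by (blast intro: smash_glob_model[OF assms])+
  \<comment> \<open>The first isomorphism is reflexivity, since the two groupoid algebras are equal.
    So is the last in effect, since \<open>kG_glob\<close> unfolds to the preceding smash product;
    it is obtained from \<open>AA\<close> and its inverse.\<close>
  show ?thesis
    unfolding groupoid_alg_Gamma_glob kG_glob_def
    using K B alg_isomorphic_trans[OF alg_isomorphic_sym[OF B] A]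
      alg_isomorphic_trans[OF alg_isomorphic_sym[OF A] AA]
      alg_isomorphic_trans[OF alg_isomorphic_sym[OF AA] AA]
    by blast
qed

end
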